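(* Let $G=Sp_{2n}(\mathbb{R})$ or $G=O(p,q)$ with $p+q=2n+1$, let $\mu$ be a character of $K$, and let $k$ be at most the real rank of $G$. Suppose $X$ is a Harish-Chandra module of $G$ with a $*$-invariant Hermitian form $\langle\,,\rangle_X$. Then the $\mathfrak B_k^\theta$-module $F_{\mu,k}(X)$ has a $*$-invariant Hermitian form, namely $\langle\,,\rangle_{F_{\mu,k}}$. Furthermore, if $X$ is unitary then $F_{\mu,k}(X)$ is unitary.
   Context: Groups. $Sp_{2n}(\mathbb{R})$ preserves the form with matrix $\begin{bmatrix}0&I_n\\-I_n&0\end{bmatrix}$; $O(p,q)$, $q=\min(p,q)$, preserves $\mathrm{diag}(I_p,-I_q)$; the real rank is $n$, resp. $q$. $\mathfrak g_0$ is the Lie algebra, $\mathfrak g$ its complexification, $V$ the complexified defining matrix module. Let $\xi=\begin{bmatrix}0&iI_n\\-iI_n&0\end{bmatrix}$ (symplectic) or $\xi=\mathrm{diag}(I_p,-I_q)$ (orthogonal). Conjugation by $\xi$ is the Cartan involution; $K$ is its fixed group in $G$, a maximal compact subgroup, $\mathfrak g=\mathfrak k\oplus\mathfrak p$ and $\mathfrak p_0=\mathfrak p\cap\mathfrak g_0$. The algebra $\mathfrak B_k^\theta=\mathfrak B_k^\theta[m_0,m_1]$ (type $B/C$ VW-algebra). It is generated by $t_{i,i+1},e_{i,i+1}$ ($1\le i<k$), $z_i,\theta_i$ ($1\le i\le k$), subject to: the $t_{i,i+1}$ and $\theta_j$ generate a copy of $\mathbb C[W(B_k)]$, $W(B_k)$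 the hyperoctahedral group; $e_{i,i+1}^2=m_0e_{i,i+1}$; $t_{i,i+1}e_{i,i+1}=e_{i,i+1}t_{i,i+1}=e_{i,i+1}$; $t_{i,i+1}t_{i+1,i+2}e_{i,i+1}t_{i+1,i+2}t_{i,i+1}=e_{i+1,i+2}$; $[t_{i,i+1},e_{j,j+1}]=0$ for $j\ne i,i+1$; $t_{i,i+1}z_i-z_{i+1}t_{i,i+1}=1+e_{i,i+1}$; $[t_{i,i+1},z_j]=[e_{i,i+1},z_j]=0$ for $j\ne i,i+1$; $e_{i,i+1}(z_i+z_{i+1})=0=(z_i+z_{i+1})e_{i,i+1}$; $[z_i,z_j]=0$; $e_{12}z_1^ae_{12}=w_ae_{12}$ for constants $w_a\in\mathbb C$; $[e_{i,i+1},\theta_j]=0$ for all $j$; $e_{i,i+1}\theta_i\theta_{i+1}=e_{i,i+1}=\theta_i\theta_{i+1}e_{i,i+1}$; $[\theta_k,z_j]=0$ for $j\ne k$; $e_{i,i+1}\theta_ie_{i,i+1}=m_1e_{i,i+1}$. Here $(m_0,m_1)=(-n,0)$ for $Sp_{2n}(\mathbb R)$ and $(\lfloor\frac{p+q}2\rfloor,p-q)$ for $O(p,q)$. Functor. $F_{\mu,k}(X)=\operatorname{Hom}_K(\mu,X\otimes V^{\otimes k})$ is a $\mathfrak B_k^\theta$-module through the following action on $X\otimes V^{\otimes k}$. Tensor factors are numbered $0$ (for $X$), $1,\dots,k$; $(g)_i$ is $g$ acting on the $i$-th factor; $\Omega_{ij}=\sum_{b\in B}(b)_i(b^* )_j$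 for a basis $B$ of $\mathfrak g$ and dual basis $b\mapsto b^*$ for the Killing form. Then $z_i$ acts by $\sum_{0\le j<i}\Omega_{ji}$, $t_{i,i+1}$ by the flip of factors $i,i+1$, $\theta_i$ by $(\xi)_i$, and $e_{i,i+1}$ by $m_0$ times the projection of factors $i,i+1$ onto the trivial $\mathfrak g$-submodule of $V\otimes V$. Forms. A Hermitian form is a map linear in the first and conjugate linear in the second variable. On a Harish-Chandra module $X$ it is $*$-invariant if $\langle gx,y\rangle=\langle x,g^*y\rangle$ for all $g\in\mathfrak g$, where $g^*=-\bar g$ and the bar is conjugation with respect to $\mathfrak g_0$. On $\mathfrak B_k^\theta$ let $\bullet$ be the conjugate-linear antihomomorphism with $z_i^\bullet=z_i$, $e_{i,i+1}^\bullet=e_{i,i+1}$, $g^\bullet=g^{-1}$ for $g\in W(B_k)$, and put $b^*=w_0b^\bullet w_0$ with $w_0=\theta_1\cdots\theta_k$; a Hermitian form on a $\mathfrak B_k^\theta$-module is $*$-invariant if $\langle bu,v\rangle=\langle u,b^*v\rangle$ for all $b\in\mathfrak B_k^\theta$. A module of either kind is unitary if it has a positive definite $*$-invariant Hermitian form. $V$ is given a Hermitian form making it unitary with respect to $\bullet$: $\langle kv,w\rangle=\langle v,k^{-1}w\rangle$ for $k\in K$, $\langle pv,w\rangle=\langle v,pw\rangle$ for $p\in\mathfrak p_0$. $X\otimes V^{\otimes k}$ has the product form, and $\langle\phi,\psi\rangle_{F_{\mu,k}}=\langle\phi(1),\psi(1)\rangle_{X\otimes V^{\otimes k}}$ for $\phi,\psi\in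 F_{\mu,k}(X)$, where $1$ is a fixed spanning vector of $\mu$. *)

theory Defs
  imports Complex_Main "Jordan_Normal_Form.Matrix"
begin

section \<open>The classical groups and their Lie algebras\<close>

datatype classical = Sp_real nat | O_real nat nat

fun vdim :: "classical \<Rightarrow> nat" where
  "vdim (Sp_real n) = 2 * n"
| "vdim (O_real p q) = p + q"

fun real_rank :: "classical \<Rightarrow> nat" where
  "real_rank (Sp_real n) = n"
| "real_rank (O_real p q) = min p q"

fun gram :: "classical \<Rightarrow> complex mat" where
  "gram (Sp_real n) = four_block_mat (0\<^sub>m n n) (1\<^sub>m n) (- 1\<^sub>m n) (0\<^sub>m n n)"
| "gram (O_real p q) = four_block_mat (1\<^sub>m p) (0\<^sub>m p q) (0\<^sub>m q p) (- 1\<^sub>m q)"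

fun xi :: "classical \<Rightarrow> complex mat" where
  "xi (Sp_real n) = four_block_mat (0\<^sub>m n n) (\<i> \<cdot>\<^sub>m 1\<^sub>m n) (- (\<i> \<cdot>\<^sub>m 1\<^sub>m n)) (0\<^sub>m n n)"
| "xi (O_real p q) = four_block_mat (1\<^sub>m p) (0\<^sub>m p q) (0\<^sub>m q p) (- 1\<^sub>m q)"

fun par0 :: "classical \<Rightarrow> complex" where
  "par0 (Sp_real n) = - of_nat n"
| "par0 (O_real p q) = of_nat ((p + q) div 2)"

fun par1 :: "classical \<Rightarrow> complex" where
  "par1 (Sp_real n) = 0"
| "par1 (O_real p q) = of_nat p - of_nat q"

definition real_mats :: "nat \<Rightarrow> complex mat set" where
  "real_mats N = {A \<in> carrier_mat N N. \<forall>i<N. \<forall>j<N. A $$ (i, j) \<in> \<real>}"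

definition grp_G :: "classical \<Rightarrow> complex mat set" where
  "grp_G G = {g \<in> real_mats (vdim G). transpose_mat g * gram G * g = gram G}"

definition lie_g0 :: "classical \<Rightarrow> complex mat set" where
  "lie_g0 G = {A \<in> real_mats (vdim G).
     transpose_mat A * gram G + gram G * A = 0\<^sub>m (vdim G) (vdim G)}"

definition lie_g :: "classical \<Rightarrow> complex mat set" where
  "lie_g G = {A + \<i> \<cdot>\<^sub>m B | A B. A \<in> lie_g0 G \<and> B \<in> lie_g0 G}"

text \<open>The matrix \<open>xi G\<close> is its own inverse, so the Cartan involution is
  \<open>A \<mapsto> xi G * A * xi G\<close>.\<close>

definition grp_K :: "classical \<Rightarrow> complex mat set" where
  "grp_K G = {g \<in> grp_G G. xi G * g * xi G = g}"

definition lie_k0 :: "classical \<Rightarrow> complex mat set" where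
  "lie_k0 G = {A \<in> lie_g0 G. xi G * A * xi G = A}"

definition lie_p0 :: "classical \<Rightarrow> complex mat set" where
  "lie_p0 G = {A \<in> lie_g0 G. xi G * A * xi G = - A}"

definition bracket :: "complex mat \<Rightarrow> complex mat \<Rightarrow> complex mat" where
  "bracket A B = A * B - B * A"

definition mat_star :: "complex mat \<Rightarrow> complex mat" where
  "mat_star A = - map_mat cnj A"


subsection \<open>Killing form and dual bases\<close>

definition coeffs_wrt :: "nat \<Rightarrow> complex mat set \<Rightarrow> complex mat \<Rightarrow> (complex mat \<Rightarrow> complex) \<Rightarrow> bool" where
  "coeffs_wrt N B A c \<longleftrightarrow> (\<forall>b. b \<notin> B \<longrightarrow> c b = 0) \<and>
     (\<forall>i<N. \<forall>j<N. A $$ (i, j) = (\<Sum>b\<in>B. c b * b $$ (i, j)))"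

definition lie_basis :: "classical \<Rightarrow> complex mat set \<Rightarrow> bool" where
  "lie_basis G B \<longleftrightarrow> finite B \<and> B \<subseteq> lie_g G \<and> (\<forall>A\<in>lie_g G. \<exists>!c. coeffs_wrt (vdim G) B A c)"

definition coord :: "nat \<Rightarrow> complex mat set \<Rightarrow> complex mat \<Rightarrow> complex mat \<Rightarrow> complex" where
  "coord N B A = (THE c. coeffs_wrt N B A c)"

text \<open>The trace of \<open>ad A \<circ> ad A'\<close> on the Lie algebra, read off in the basis \<open>B\<close>.\<close>

definition killing :: "nat \<Rightarrow> complex mat set \<Rightarrow> complex mat \<Rightarrow> complex mat \<Rightarrow> complex" where
  "killing N B A A' = (\<Sum>b\<in>B. coord N B (bracket A (bracket A' b)) b)"

definition dual_basis :: "classical \<Rightarrow> complex mat set \<Rightarrow> (complex mat \<Rightarrow> complex mat) \<Rightarrow> bool" where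
  "dual_basis G B d \<longleftrightarrow> (\<forall>b\<in>B. d b \<in> lie_g G) \<and>
     (\<forall>b\<in>B. \<forall>b'\<in>B. killing (vdim G) B b (d b') = (if b = b' then 1 else 0))"


section \<open>Harish-Chandra modules\<close>

text \<open>The underlying vector space is a whole type \<open>'x\<close> with scalar multiplication \<open>scl X\<close>; the
  two action maps matter only on the Lie algebra and on the maximal compact subgroup.\<close>

record 'x gK_data =
  scl :: "complex \<Rightarrow> 'x \<Rightarrow> 'x"
  lie :: "complex mat \<Rightarrow> 'x \<Rightarrow> 'x"
  grp :: "complex mat \<Rightarrow> 'x \<Rightarrow> 'x"

definition entrywise_lim :: "nat \<Rightarrow> (nat \<Rightarrow> complex mat) \<Rightarrow> complex mat \<Rightarrow> bool" where
  "entrywise_lim N s A \<longleftrightarrow> (\<forall>i<N. \<forall>j<N. (\<lambda>m. s m $$ (i, j)) \<longlonglongrightarrow> A $$ (i, j))"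

definition continuous_on_K :: "classical \<Rightarrow> (complex mat \<Rightarrow> complex) \<Rightarrow> bool" where
  "continuous_on_K G f \<longleftrightarrow>
     (\<forall>s g. (\<forall>m. s m \<in> grp_K G) \<and> g \<in> grp_K G \<and> entrywise_lim (vdim G) s g
        \<longrightarrow> (\<lambda>m. f (s m)) \<longlonglongrightarrow> f g)"

text \<open>The one-parameter subgroup \<open>t \<mapsto> exp (t Y)\<close> of the maximal compact subgroup.\<close>

definition one_param :: "classical \<Rightarrow> complex mat \<Rightarrow> (real \<Rightarrow> complex mat) \<Rightarrow> bool" where
  "one_param G Y c \<longleftrightarrow> (\<forall>t. c t \<in> grp_K G) \<and> (\<forall>s t. c (s + t) = c s * c t) \<and>
     (\<forall>i<vdim G. \<forall>j<vdim G. ((\<lambda>t. c t $$ (i, j)) has_vector_derivative Y $$ (i, j)) (at 0))"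

text \<open>A K-orbit spans a finite-dimensional space, so continuity and differentiability of orbit
  maps can be tested on arbitrary linear functionals.\<close>

definition gK_module :: "classical \<Rightarrow> 'x::ab_group_add gK_data \<Rightarrow> bool" where
  "gK_module G X \<longleftrightarrow>
     vector_space (scl X) \<and>
     (\<forall>A\<in>lie_g G. Vector_Spaces.linear (scl X) (scl X) (lie X A)) \<and>
     (\<forall>A\<in>lie_g G. \<forall>B\<in>lie_g G. \<forall>v. lie X (A + B) v = lie X A v + lie X B v) \<and>
     (\<forall>a. \<forall>A\<in>lie_g G. \<forall>v. lie X (a \<cdot>\<^sub>m A) v = scl X a (lie X A v)) \<and>
     (\<forall>A\<in>lie_g G. \<forall>B\<in>lie_g G. \<forall>v.
        lie X (bracket A B) v = lie X A (lie X B v) - lie X B (lie X A v)) \<and>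
     (\<forall>g\<in>grp_K G. Vector_Spaces.linear (scl X) (scl X) (grp X g)) \<and>
     (\<forall>v. grp X (1\<^sub>m (vdim G)) v = v) \<and>
     (\<forall>g\<in>grp_K G. \<forall>h\<in>grp_K G. \<forall>v. grp X (g * h) v = grp X g (grp X h v)) \<and>
     (\<forall>g\<in>grp_K G. \<forall>h\<in>grp_K G. g * h = 1\<^sub>m (vdim G) \<longrightarrow>
        (\<forall>A\<in>lie_g G. \<forall>v. grp X g (lie X A v) = lie X (g * A * h) (grp X g v))) \<and>
     (\<forall>v. \<exists>S. finite S \<and> (\<forall>g\<in>grp_K G. grp X g v \<in> module.span (scl X) S)) \<and>
     (\<forall>v f. Vector_Spaces.linear (scl X) (*) f \<longrightarrow> continuous_on_K G (\<lambda>g. f (grp X g v))) \<and>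
     (\<forall>Y\<in>lie_k0 G. \<forall>c v f. one_param G Y c \<and> Vector_Spaces.linear (scl X) (*) f \<longrightarrow>
        ((\<lambda>t. f (grp X (c t) v)) has_vector_derivative f (lie X Y v)) (at 0))"

definition K_subspace :: "classical \<Rightarrow> 'x::ab_group_add gK_data \<Rightarrow> 'x set \<Rightarrow> bool" where
  "K_subspace G X W \<longleftrightarrow> module.subspace (scl X) W \<and> (\<forall>g\<in>grp_K G. grp X g ` W \<subseteq> W)"

definition K_irreducible :: "classical \<Rightarrow> 'x::ab_group_add gK_data \<Rightarrow> 'x set \<Rightarrow> bool" where
  "K_irreducible G X W \<longleftrightarrow> K_subspace G X W \<and> W \<noteq> {0} \<and>
     (\<forall>U. K_subspace G X U \<and> U \<subseteq> W \<longrightarrow> U = {0} \<or> U = W)"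

definition K_map_on :: "classical \<Rightarrow> 'x::ab_group_add gK_data \<Rightarrow> 'x set \<Rightarrow> ('x \<Rightarrow> 'x) \<Rightarrow> bool" where
  "K_map_on G X W h \<longleftrightarrow>
     (\<forall>u\<in>W. \<forall>v\<in>W. h (u + v) = h u + h v) \<and> (\<forall>a. \<forall>u\<in>W. h (scl X a u) = scl X a (h u)) \<and>
     (\<forall>g\<in>grp_K G. \<forall>u\<in>W. h (grp X g u) = grp X g (h u))"

text \<open>Finite multiplicity of a K-type: its isotypic component is finite-dimensional.\<close>

definition admissible :: "classical \<Rightarrow> 'x::ab_group_add gK_data \<Rightarrow> bool" where
  "admissible G X \<longleftrightarrow> (\<forall>W. K_irreducible G X W \<longrightarrow>
     (\<exists>S. finite S \<and> (\<forall>h. K_map_on G X W h \<longrightarrow> h ` W \<subseteq> module.span (scl X) S)))"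

definition Harish_Chandra_module :: "classical \<Rightarrow> 'x::ab_group_add gK_data \<Rightarrow> bool" where
  "Harish_Chandra_module G X \<longleftrightarrow> gK_module G X \<and> admissible G X"

definition K_character :: "classical \<Rightarrow> (complex mat \<Rightarrow> complex) \<Rightarrow> bool" where
  "K_character G \<mu> \<longleftrightarrow> (\<forall>g\<in>grp_K G. \<mu> g \<noteq> 0) \<and>
     (\<forall>g\<in>grp_K G. \<forall>h\<in>grp_K G. \<mu> (g * h) = \<mu> g * \<mu> h) \<and> continuous_on_K G \<mu>"


section \<open>Hermitian forms\<close>

text \<open>Following the convention that a Hermitian form is a map which is linear in the first and
  conjugate linear in the second variable; conjugate symmetry is a separate predicate. It is
  automatic for positive definite forms. The arguments \<open>M\<close>, \<open>pl\<close>, \<open>s\<close> give the carrier, addition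
  and scalar multiplication.\<close>

definition hermitian_form ::
  "'m set \<Rightarrow> ('m \<Rightarrow> 'm \<Rightarrow> 'm) \<Rightarrow> (complex \<Rightarrow> 'm \<Rightarrow> 'm) \<Rightarrow> ('m \<Rightarrow> 'm \<Rightarrow> complex) \<Rightarrow> bool" where
  "hermitian_form M pl s f \<longleftrightarrow>
     (\<forall>u\<in>M. \<forall>v\<in>M. \<forall>w\<in>M. f (pl u v) w = f u w + f v w \<and> f w (pl u v) = f w u + f w v) \<and>
     (\<forall>a. \<forall>u\<in>M. \<forall>v\<in>M. f (s a u) v = a * f u v \<and> f u (s a v) = cnj a * f u v)"

definition conj_symmetric :: "'m set \<Rightarrow> ('m \<Rightarrow> 'm \<Rightarrow> complex) \<Rightarrow> bool" where
  "conj_symmetric M f \<longleftrightarrow> (\<forall>u\<in>M. \<forall>v\<in>M. f v u = cnj (f u v))"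

definition positive_definite :: "'m set \<Rightarrow> 'm \<Rightarrow> ('m \<Rightarrow> 'm \<Rightarrow> complex) \<Rightarrow> bool" where
  "positive_definite M z f \<longleftrightarrow> (\<forall>u\<in>M. u \<noteq> z \<longrightarrow> Im (f u u) = 0 \<and> 0 < Re (f u u))"

definition HC_star_invariant ::
  "classical \<Rightarrow> 'x gK_data \<Rightarrow> ('x \<Rightarrow> 'x \<Rightarrow> complex) \<Rightarrow> bool" where
  "HC_star_invariant G X f \<longleftrightarrow>
     (\<forall>A\<in>lie_g G. \<forall>u v. f (lie X A u) v = f u (lie X (mat_star A) v))"

definition HC_unitary :: "classical \<Rightarrow> 'x::ab_group_add gK_data \<Rightarrow> bool" where
  "HC_unitary G X \<longleftrightarrow> (\<exists>f. hermitian_form UNIV (+) (scl X) f \<and>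
     positive_definite UNIV 0 f \<and> HC_star_invariant G X f)"

definition V_bullet_unitary :: "classical \<Rightarrow> (complex vec \<Rightarrow> complex vec \<Rightarrow> complex) \<Rightarrow> bool" where
  "V_bullet_unitary G f \<longleftrightarrow>
     hermitian_form (carrier_vec (vdim G)) (+) (\<cdot>\<^sub>v) f \<and>
     positive_definite (carrier_vec (vdim G)) (0\<^sub>v (vdim G)) f \<and>
     (\<forall>g\<in>grp_K G. \<forall>h\<in>grp_K G. g * h = 1\<^sub>m (vdim G) \<longrightarrow>
        (\<forall>v\<in>carrier_vec (vdim G). \<forall>w\<in>carrier_vec (vdim G).
           f (g *\<^sub>v v) w = f v (h *\<^sub>v w))) \<and>
     (\<forall>A\<in>lie_p0 G. \<forall>v\<in>carrier_vec (vdim G). \<forall>w\<in>carrier_vec (vdim G).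
        f (A *\<^sub>v v) w = f v (A *\<^sub>v w))"


section \<open>The type B/C VW-algebra\<close>

text \<open>\<open>T i\<close> and \<open>E i\<close> stand for the generators with index pair \<open>i, i + 1\<close>. The algebra is the set
  of algebra expressions modulo the congruence generated by the laws of unital associative
  complex algebras and the defining relations.\<close>

datatype gen = T nat | E nat | Z nat | Th nat

datatype expr = Gen gen | Const complex | Add expr expr | Mul expr expr

instantiation expr :: "{zero, one, plus, minus, times}"
begin
definition "0 = Const 0"
definition "1 = Const 1"
definition "x + y = Add x y" for x y :: expr
definition "x - y = Add x (Mul (Const (- 1)) y)" for x y :: expr
definition "x * y = Mul x y" for x y :: expr
instance ..
end

instance expr :: power ..

abbreviation "tt i \<equiv> Gen (T i)"
abbreviation "ee i \<equiv> Gen (E i)"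
abbreviation "zz i \<equiv> Gen (Z i)"
abbreviation "th i \<equiv> Gen (Th i)"

fun gen_ok :: "nat \<Rightarrow> gen \<Rightarrow> bool" where
  "gen_ok k (T i) \<longleftrightarrow> 1 \<le> i \<and> i < k"
| "gen_ok k (E i) \<longleftrightarrow> 1 \<le> i \<and> i < k"
| "gen_ok k (Z i) \<longleftrightarrow> 1 \<le> i \<and> i \<le> k"
| "gen_ok k (Th i) \<longleftrightarrow> 1 \<le> i \<and> i \<le> k"

fun expr_ok :: "nat \<Rightarrow> expr \<Rightarrow> bool" where
  "expr_ok k (Gen g) \<longleftrightarrow> gen_ok k g"
| "expr_ok k (Const c) \<longleftrightarrow> True"
| "expr_ok k (Add x y) \<longleftrightarrow> expr_ok k x \<and> expr_ok k y"
| "expr_ok k (Mul x y) \<longleftrightarrow> expr_ok k x \<and> expr_ok k y"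

definition exprs :: "nat \<Rightarrow> expr set" where
  "exprs k = {x. expr_ok k x}"

text \<open>The relations from \<open>t_sq\<close> to \<open>t_th_comm\<close> present the hyperoctahedral group.\<close>

inductive VW_rel :: "nat \<Rightarrow> complex \<Rightarrow> complex \<Rightarrow> (nat \<Rightarrow> complex) \<Rightarrow> expr \<Rightarrow> expr \<Rightarrow> bool"
  for k :: nat and m0 m1 :: complex and w :: "nat \<Rightarrow> complex" where
  t_sq: "1 \<le> i \<Longrightarrow> i < k \<Longrightarrow> VW_rel k m0 m1 w (tt i * tt i) 1"
| t_braid: "1 \<le> i \<Longrightarrow> i + 1 < k \<Longrightarrow>
    VW_rel k m0 m1 w (tt i * tt (i + 1) * tt i) (tt (i + 1) * tt i * tt (i + 1))"
| t_comm: "1 \<le> i \<Longrightarrow> i + 2 \<le> j \<Longrightarrow> j < k \<Longrightarrow> VW_rel k m0 m1 w (tt i * tt j) (tt j * tt i)"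
| th_sq: "1 \<le> i \<Longrightarrow> i \<le> k \<Longrightarrow> VW_rel k m0 m1 w (th i * th i) 1"
| th_comm: "1 \<le> i \<Longrightarrow> i \<le> k \<Longrightarrow> 1 \<le> j \<Longrightarrow> j \<le> k \<Longrightarrow>
    VW_rel k m0 m1 w (th i * th j) (th j * th i)"
| t_th: "1 \<le> i \<Longrightarrow> i < k \<Longrightarrow> VW_rel k m0 m1 w (tt i * th i) (th (i + 1) * tt i)"
| t_th_comm: "1 \<le> i \<Longrightarrow> i < k \<Longrightarrow> 1 \<le> j \<Longrightarrow> j \<le> k \<Longrightarrow> j \<noteq> i \<Longrightarrow> j \<noteq> i + 1 \<Longrightarrow>
    VW_rel k m0 m1 w (tt i * th j) (th j * tt i)"
| e_sq: "1 \<le> i \<Longrightarrow> i < k \<Longrightarrow> VW_rel k m0 m1 w (ee i * ee i) (Const m0 * ee i)"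
| t_e: "1 \<le> i \<Longrightarrow> i < k \<Longrightarrow> VW_rel k m0 m1 w (tt i * ee i) (ee i)"
| e_t: "1 \<le> i \<Longrightarrow> i < k \<Longrightarrow> VW_rel k m0 m1 w (ee i * tt i) (ee i)"
| t_t_e: "1 \<le> i \<Longrightarrow> i + 1 < k \<Longrightarrow>
    VW_rel k m0 m1 w (tt i * tt (i + 1) * ee i * tt (i + 1) * tt i) (ee (i + 1))"
| t_e_comm: "1 \<le> i \<Longrightarrow> i < k \<Longrightarrow> 1 \<le> j \<Longrightarrow> j < k \<Longrightarrow> j \<noteq> i \<Longrightarrow> j \<noteq> i + 1 \<Longrightarrow>
    VW_rel k m0 m1 w (tt i * ee j) (ee j * tt i)"
| t_z: "1 \<le> i \<Longrightarrow> i < k \<Longrightarrow> VW_rel k m0 m1 w (tt i * zz i - zz (i + 1) * tt i) (1 + ee i)"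
| t_z_comm: "1 \<le> i \<Longrightarrow> i < k \<Longrightarrow> 1 \<le> j \<Longrightarrow> j \<le> k \<Longrightarrow> j \<noteq> i \<Longrightarrow> j \<noteq> i + 1 \<Longrightarrow>
    VW_rel k m0 m1 w (tt i * zz j) (zz j * tt i)"
| e_z_comm: "1 \<le> i \<Longrightarrow> i < k \<Longrightarrow> 1 \<le> j \<Longrightarrow> j \<le> k \<Longrightarrow> j \<noteq> i \<Longrightarrow> j \<noteq> i + 1 \<Longrightarrow>
    VW_rel k m0 m1 w (ee i * zz j) (zz j * ee i)"
| e_zz: "1 \<le> i \<Longrightarrow> i < k \<Longrightarrow> VW_rel k m0 m1 w (ee i * (zz i + zz (i + 1))) 0"
| zz_e: "1 \<le> i \<Longrightarrow> i < k \<Longrightarrow> VW_rel k m0 m1 w ((zz i + zz (i + 1)) * ee i) 0"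
| z_comm: "1 \<le> i \<Longrightarrow> i \<le> k \<Longrightarrow> 1 \<le> j \<Longrightarrow> j \<le> k \<Longrightarrow>
    VW_rel k m0 m1 w (zz i * zz j) (zz j * zz i)"
| e_z_e: "1 < k \<Longrightarrow> VW_rel k m0 m1 w (ee 1 * zz 1 ^ a * ee 1) (Const (w a) * ee 1)"
| e_th_comm: "1 \<le> i \<Longrightarrow> i < k \<Longrightarrow> 1 \<le> j \<Longrightarrow> j \<le> k \<Longrightarrow>
    VW_rel k m0 m1 w (ee i * th j) (th j * ee i)"
| e_th_th: "1 \<le> i \<Longrightarrow> i < k \<Longrightarrow> VW_rel k m0 m1 w (ee i * th i * th (i + 1)) (ee i)"
| th_th_e: "1 \<le> i \<Longrightarrow> i < k \<Longrightarrow> VW_rel k m0 m1 w (th i * th (i + 1) * ee i) (ee i)"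
| th_z_comm: "1 \<le> k \<Longrightarrow> 1 \<le> j \<Longrightarrow> j < k \<Longrightarrow> VW_rel k m0 m1 w (th k * zz j) (zz j * th k)"
| e_th_e: "1 \<le> i \<Longrightarrow> i < k \<Longrightarrow> VW_rel k m0 m1 w (ee i * th i * ee i) (Const m1 * ee i)"

inductive VW_eq :: "nat \<Rightarrow> complex \<Rightarrow> complex \<Rightarrow> (nat \<Rightarrow> complex) \<Rightarrow> expr \<Rightarrow> expr \<Rightarrow> bool"
  for k :: nat and m0 m1 :: complex and w :: "nat \<Rightarrow> complex" where
  rel: "VW_rel k m0 m1 w x y \<Longrightarrow> VW_eq k m0 m1 w x y"
| refl: "VW_eq k m0 m1 w x x"
| sym: "VW_eq k m0 m1 w x y \<Longrightarrow> VW_eq k m0 m1 w y x"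
| trans: "VW_eq k m0 m1 w x y \<Longrightarrow> VW_eq k m0 m1 w y z \<Longrightarrow> VW_eq k m0 m1 w x z"
| add_cong: "VW_eq k m0 m1 w x x' \<Longrightarrow> VW_eq k m0 m1 w y y' \<Longrightarrow> VW_eq k m0 m1 w (x + y) (x' + y')"
| mul_cong: "VW_eq k m0 m1 w x x' \<Longrightarrow> VW_eq k m0 m1 w y y' \<Longrightarrow> VW_eq k m0 m1 w (x * y) (x' * y')"
| add_assoc: "VW_eq k m0 m1 w (x + y + z) (x + (y + z))"
| add_comm: "VW_eq k m0 m1 w (x + y) (y + x)"
| add_zero: "VW_eq k m0 m1 w (x + 0) x"
| add_inv: "VW_eq k m0 m1 w (x - x) 0"
| mul_assoc: "VW_eq k m0 m1 w (x * y * z) (x * (y * z))"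
| mul_one: "VW_eq k m0 m1 w (1 * x) x"
| distrib_left: "VW_eq k m0 m1 w (x * (y + z)) (x * y + x * z)"
| distrib_right: "VW_eq k m0 m1 w ((x + y) * z) (x * z + y * z)"
| const_add: "VW_eq k m0 m1 w (Const a + Const b) (Const (a + b))"
| const_mul: "VW_eq k m0 m1 w (Const a * Const b) (Const (a * b))"
| const_central: "VW_eq k m0 m1 w (Const a * x) (x * Const a)"

definition VW_algebra :: "nat \<Rightarrow> complex \<Rightarrow> complex \<Rightarrow> (nat \<Rightarrow> complex) \<Rightarrow> expr set set" where
  "VW_algebra k m0 m1 w =
     exprs k // {(x, y). x \<in> exprs k \<and> y \<in> exprs k \<and> VW_eq k m0 m1 w x y}"

text \<open>On the hyperoctahedral group \<open>bullet\<close> is inversion, so it fixes the involutions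
  \<open>tt i\<close> and \<open>th i\<close>.\<close>

fun bullet :: "expr \<Rightarrow> expr" where
  "bullet (Gen g) = Gen g"
| "bullet (Const c) = Const (cnj c)"
| "bullet (Add x y) = Add (bullet x) (bullet y)"
| "bullet (Mul x y) = Mul (bullet y) (bullet x)"

fun w0 :: "nat \<Rightarrow> expr" where
  "w0 0 = 1"
| "w0 (Suc k) = w0 k * th (Suc k)"

definition star :: "nat \<Rightarrow> expr \<Rightarrow> expr" where
  "star k x = w0 k * bullet x * w0 k"

text \<open>An element \<open>b\<close> of the algebra acts through any of its representatives \<open>x\<close>, and its adjoint
  is represented by \<open>star k x\<close>. The identity is demanded for every representative.\<close>

definition VW_star_invariant ::
  "nat \<Rightarrow> complex \<Rightarrow> complex \<Rightarrow> (nat \<Rightarrow> complex) \<Rightarrow> 'm set \<Rightarrow> (expr \<Rightarrow> 'm \<Rightarrow> 'm) \<Rightarrow>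
   ('m \<Rightarrow> 'm \<Rightarrow> complex) \<Rightarrow> bool" where
  "VW_star_invariant k m0 m1 w M act f \<longleftrightarrow>
     (\<forall>b\<in>VW_algebra k m0 m1 w. \<forall>x\<in>b. \<forall>u\<in>M. \<forall>v\<in>M. f (act x u) v = f u (act (star k x) v))"

text \<open>Data on which representatives of one element act equally form a module; there the
  representative-wise condition is the \<open>*\<close>-invariance of the form under the algebra.\<close>

definition VW_module ::
  "nat \<Rightarrow> complex \<Rightarrow> complex \<Rightarrow> (nat \<Rightarrow> complex) \<Rightarrow> 'm set \<Rightarrow> (expr \<Rightarrow> 'm \<Rightarrow> 'm) \<Rightarrow> bool" where
  "VW_module k m0 m1 w M act \<longleftrightarrow>
     (\<forall>x\<in>exprs k. \<forall>u\<in>M. act x u \<in> M) \<and>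
     (\<forall>x\<in>exprs k. \<forall>y\<in>exprs k. VW_eq k m0 m1 w x y \<longrightarrow> (\<forall>u\<in>M. act x u = act y u))"

lemma VW_algebra_act_eq:
  assumes "VW_module k m0 m1 w M act" "b \<in> VW_algebra k m0 m1 w" "x \<in> b" "y \<in> b" "u \<in> M"
  shows "act x u = act y u"
proof -
  obtain a where a: "a \<in> exprs k" "b = {(x, y). x \<in> exprs k \<and> y \<in> exprs k \<and> VW_eq k m0 m1 w x y} `` {a}"
    using assms(2) unfolding VW_algebra_def by (auto elim!: quotientE)
  then have "x \<in> exprs k" "y \<in> exprs k" "VW_eq k m0 m1 w a x" "VW_eq k m0 m1 w a y"
    using assms(3,4) by auto
  with a(1) assms(1,5) show ?thesis unfolding VW_module_def by metis
qed

lemma VW_star_invariant_on_classes: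
  assumes "VW_module k m0 m1 w M act" "VW_star_invariant k m0 m1 w M act f"
    and "b \<in> VW_algebra k m0 m1 w" "b' \<in> VW_algebra k m0 m1 w" "x \<in> b" "star k x \<in> b'"
    and "x' \<in> b" "y' \<in> b'" "u \<in> M" "v \<in> M"
  shows "f (act x' u) v = f u (act y' v)"
proof -
  have "f (act x u) v = f u (act (star k x) v)"
    using assms(2,3,5,9,10) unfolding VW_star_invariant_def by blast
  then show ?thesis
    using VW_algebra_act_eq[OF assms(1,3,5,7,9)] VW_algebra_act_eq[OF assms(1,4,6,8,10)] by simp
qed

definition VW_unitary ::
  "nat \<Rightarrow> complex \<Rightarrow> complex \<Rightarrow> (nat \<Rightarrow> complex) \<Rightarrow> 'm set \<Rightarrow> ('m \<Rightarrow> 'm \<Rightarrow> 'm) \<Rightarrow>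
   (complex \<Rightarrow> 'm \<Rightarrow> 'm) \<Rightarrow> 'm \<Rightarrow> (expr \<Rightarrow> 'm \<Rightarrow> 'm) \<Rightarrow> bool" where
  "VW_unitary k m0 m1 w M pl s z act \<longleftrightarrow> (\<exists>f. hermitian_form M pl s f \<and>
     positive_definite M z f \<and> VW_star_invariant k m0 m1 w M act f)"


section \<open>The tensor product of a module with powers of the defining module\<close>

text \<open>Elements of \<open>X \<otimes> V\<^sup>k\<close> (\<open>k\<close>-fold tensor power) are families \<open>u\<close> of elements of \<open>X\<close> indexed by
  multi-indices \<open>I\<close>, standing for the sum over \<open>I\<close> of the tensors with factors
  \<open>u I\<close>, \<open>e\<^bsub>I!0\<^esub>\<close>, ..., \<open>e\<^bsub>I!(k-1)\<^esub>\<close>, where \<open>e\<^bsub>a\<^esub>\<close> are the standard basis vectors of \<open>V\<close>. Thus the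
  tensor factor number \<open>i \<ge> 1\<close> corresponds to position \<open>i - 1\<close> of \<open>I\<close>.\<close>

definition mindex :: "nat \<Rightarrow> nat \<Rightarrow> nat list set" where
  "mindex N k = {I. length I = k \<and> set I \<subseteq> {..<N}}"

definition tensor_space :: "nat \<Rightarrow> nat \<Rightarrow> (nat list \<Rightarrow> 'x::ab_group_add) set" where
  "tensor_space N k = {u. \<forall>I. I \<notin> mindex N k \<longrightarrow> u I = 0}"

definition on_factor :: "classical \<Rightarrow> 'x::ab_group_add gK_data \<Rightarrow> nat \<Rightarrow> nat \<Rightarrow> complex mat \<Rightarrow>
    (nat list \<Rightarrow> 'x) \<Rightarrow> nat list \<Rightarrow> 'x" where
  "on_factor G X k i A u = (\<lambda>I. if I \<in> mindex (vdim G) k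
     then (if i = 0 then lie X A (u I)
           else (\<Sum>a<vdim G. scl X (A $$ (I ! (i - 1), a)) (u (I[i - 1 := a]))))
     else 0)"

definition Omega :: "classical \<Rightarrow> 'x::ab_group_add gK_data \<Rightarrow> nat \<Rightarrow> complex mat set \<Rightarrow>
    (complex mat \<Rightarrow> complex mat) \<Rightarrow> nat \<Rightarrow> nat \<Rightarrow> (nat list \<Rightarrow> 'x) \<Rightarrow> nat list \<Rightarrow> 'x" where
  "Omega G X k B d i j u =
     (\<lambda>I. \<Sum>b\<in>B. on_factor G X k i b (on_factor G X k j (d b) u) I)"

definition flip :: "nat \<Rightarrow> nat \<Rightarrow> nat \<Rightarrow> (nat list \<Rightarrow> 'x::ab_group_add) \<Rightarrow> nat list \<Rightarrow> 'x" where
  "flip N k i u = (\<lambda>I. if I \<in> mindex N k then u (I[i - 1 := I ! i, i := I ! (i - 1)]) else 0)"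

subsection \<open>Projection of the tensor square onto its trivial submodule\<close>

text \<open>Vectors of \<open>V \<otimes> V\<close> are given by their coordinates \<open>u a b\<close>, \<open>a, b < N\<close>, and operators by
  their matrix entries \<open>P (a, b) (c, d)\<close>.\<close>

definition VV_space :: "nat \<Rightarrow> (nat \<Rightarrow> nat \<Rightarrow> complex) set" where
  "VV_space N = {u. \<forall>a b. \<not> (a < N \<and> b < N) \<longrightarrow> u a b = 0}"

definition VV_lie :: "nat \<Rightarrow> complex mat \<Rightarrow> (nat \<Rightarrow> nat \<Rightarrow> complex) \<Rightarrow> nat \<Rightarrow> nat \<Rightarrow> complex" where
  "VV_lie N A u = (\<lambda>a b. if a < N \<and> b < N
     then (\<Sum>c<N. A $$ (a, c) * u c b) + (\<Sum>c<N. A $$ (b, c) * u a c) else 0)"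

definition VV_op :: "nat \<Rightarrow> (nat \<times> nat \<Rightarrow> nat \<times> nat \<Rightarrow> complex) \<Rightarrow>
    (nat \<Rightarrow> nat \<Rightarrow> complex) \<Rightarrow> nat \<Rightarrow> nat \<Rightarrow> complex" where
  "VV_op N P u = (\<lambda>a b. if a < N \<and> b < N
     then (\<Sum>c<N. \<Sum>d<N. P (a, b) (c, d) * u c d) else 0)"

definition trivial_part :: "classical \<Rightarrow> (nat \<Rightarrow> nat \<Rightarrow> complex) set" where
  "trivial_part G = {u \<in> VV_space (vdim G). \<forall>A\<in>lie_g G. VV_lie (vdim G) A u = (\<lambda>_ _. 0)}"

definition trivial_projection :: "classical \<Rightarrow> (nat \<times> nat \<Rightarrow> nat \<times> nat \<Rightarrow> complex) \<Rightarrow> bool" where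
  "trivial_projection G P \<longleftrightarrow>
     (\<forall>u\<in>VV_space (vdim G). VV_op (vdim G) P u \<in> trivial_part G) \<and>
     (\<forall>u\<in>trivial_part G. VV_op (vdim G) P u = u) \<and>
     (\<forall>A\<in>lie_g G. \<forall>u\<in>VV_space (vdim G).
        VV_op (vdim G) P (VV_lie (vdim G) A u) = VV_lie (vdim G) A (VV_op (vdim G) P u))"

definition proj_factors :: "classical \<Rightarrow> 'x::ab_group_add gK_data \<Rightarrow> nat \<Rightarrow>
    (nat \<times> nat \<Rightarrow> nat \<times> nat \<Rightarrow> complex) \<Rightarrow> nat \<Rightarrow> (nat list \<Rightarrow> 'x) \<Rightarrow> nat list \<Rightarrow> 'x" where
  "proj_factors G X k P i u = (\<lambda>I. if I \<in> mindex (vdim G) k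
     then (\<Sum>a<vdim G. \<Sum>b<vdim G.
       scl X (P (I ! (i - 1), I ! i) (a, b)) (u (I[i - 1 := a, i := b])))
     else 0)"


subsection \<open>Action of the VW-algebra and of the compact group\<close>

fun gen_act :: "classical \<Rightarrow> 'x::ab_group_add gK_data \<Rightarrow> nat \<Rightarrow> complex mat set \<Rightarrow>
    (complex mat \<Rightarrow> complex mat) \<Rightarrow> (nat \<times> nat \<Rightarrow> nat \<times> nat \<Rightarrow> complex) \<Rightarrow> gen \<Rightarrow>
    (nat list \<Rightarrow> 'x) \<Rightarrow> nat list \<Rightarrow> 'x" where
  "gen_act G X k B d P (T i) u = flip (vdim G) k i u"
| "gen_act G X k B d P (E i) u = (\<lambda>I. scl X (par0 G) (proj_factors G X k P i u I))"
| "gen_act G X k B d P (Z i) u = (\<lambda>I. \<Sum>j<i. Omega G X k B d j i u I)"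
| "gen_act G X k B d P (Th i) u = on_factor G X k i (xi G) u"

fun expr_act :: "classical \<Rightarrow> 'x::ab_group_add gK_data \<Rightarrow> nat \<Rightarrow> complex mat set \<Rightarrow>
    (complex mat \<Rightarrow> complex mat) \<Rightarrow> (nat \<times> nat \<Rightarrow> nat \<times> nat \<Rightarrow> complex) \<Rightarrow> expr \<Rightarrow>
    (nat list \<Rightarrow> 'x) \<Rightarrow> nat list \<Rightarrow> 'x" where
  "expr_act G X k B d P (Gen g) u = gen_act G X k B d P g u"
| "expr_act G X k B d P (Const c) u = (\<lambda>I. scl X c (u I))"
| "expr_act G X k B d P (Add x y) u =
     (\<lambda>I. expr_act G X k B d P x u I + expr_act G X k B d P y u I)"
| "expr_act G X k B d P (Mul x y) u = expr_act G X k B d P x (expr_act G X k B d P y u)"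

definition K_act :: "classical \<Rightarrow> 'x::ab_group_add gK_data \<Rightarrow> nat \<Rightarrow> complex mat \<Rightarrow>
    (nat list \<Rightarrow> 'x) \<Rightarrow> nat list \<Rightarrow> 'x" where
  "K_act G X k g u = (\<lambda>I. if I \<in> mindex (vdim G) k
     then (\<Sum>J\<in>mindex (vdim G) k. scl X (\<Prod>j<k. g $$ (I ! j, J ! j)) (grp X g (u J))) else 0)"

definition tensor_form :: "nat \<Rightarrow> nat \<Rightarrow> ('x \<Rightarrow> 'x \<Rightarrow> complex) \<Rightarrow>
    (complex vec \<Rightarrow> complex vec \<Rightarrow> complex) \<Rightarrow> (nat list \<Rightarrow> 'x) \<Rightarrow> (nat list \<Rightarrow> 'x) \<Rightarrow> complex" where
  "tensor_form N k fX fV u v = (\<Sum>I\<in>mindex N k. \<Sum>J\<in>mindex N k.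
     fX (u I) (v J) * (\<Prod>j<k. fV (unit_vec N (I ! j)) (unit_vec N (J ! j))))"


section \<open>The functor\<close>

text \<open>The one-dimensional module of the character \<open>\<mu>\<close> is realised on \<open>complex\<close>, with spanning
  vector \<open>1\<close>.\<close>

definition F_space :: "classical \<Rightarrow> 'x::ab_group_add gK_data \<Rightarrow> (complex mat \<Rightarrow> complex) \<Rightarrow> nat \<Rightarrow>
    (complex \<Rightarrow> nat list \<Rightarrow> 'x) set" where
  "F_space G X \<mu> k = {\<phi>. (\<forall>c. \<phi> c \<in> tensor_space (vdim G) k) \<and>
     (\<forall>c d. \<phi> (c + d) = (\<lambda>I. \<phi> c I + \<phi> d I)) \<and>
     (\<forall>a c. \<phi> (a * c) = (\<lambda>I. scl X a (\<phi> c I))) \<and>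
     (\<forall>g\<in>grp_K G. \<forall>c. \<phi> (\<mu> g * c) = K_act G X k g (\<phi> c))}"

definition F_add :: "(complex \<Rightarrow> nat list \<Rightarrow> 'x::ab_group_add) \<Rightarrow> (complex \<Rightarrow> nat list \<Rightarrow> 'x) \<Rightarrow>
    complex \<Rightarrow> nat list \<Rightarrow> 'x" where
  "F_add \<phi> \<psi> = (\<lambda>c I. \<phi> c I + \<psi> c I)"

definition F_scale :: "'x gK_data \<Rightarrow> complex \<Rightarrow> (complex \<Rightarrow> nat list \<Rightarrow> 'x) \<Rightarrow>
    complex \<Rightarrow> nat list \<Rightarrow> 'x" where
  "F_scale X a \<phi> = (\<lambda>c I. scl X a (\<phi> c I))"

definition F_act :: "classical \<Rightarrow> 'x::ab_group_add gK_data \<Rightarrow> nat \<Rightarrow> complex mat set \<Rightarrow>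
    (complex mat \<Rightarrow> complex mat) \<Rightarrow> (nat \<times> nat \<Rightarrow> nat \<times> nat \<Rightarrow> complex) \<Rightarrow> expr \<Rightarrow>
    (complex \<Rightarrow> nat list \<Rightarrow> 'x) \<Rightarrow> complex \<Rightarrow> nat list \<Rightarrow> 'x" where
  "F_act G X k B d P x \<phi> = (\<lambda>c. expr_act G X k B d P x (\<phi> c))"

definition F_form :: "classical \<Rightarrow> nat \<Rightarrow> ('x \<Rightarrow> 'x \<Rightarrow> complex) \<Rightarrow>
    (complex vec \<Rightarrow> complex vec \<Rightarrow> complex) \<Rightarrow> (complex \<Rightarrow> nat list \<Rightarrow> 'x) \<Rightarrow>
    (complex \<Rightarrow> nat list \<Rightarrow> 'x) \<Rightarrow> complex" where
  "F_form G k fX fV \<phi> \<psi> = tensor_form (vdim G) k fX fV (\<phi> 1) (\<psi> 1)"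

end

theory Submission
  imports Defs "Jordan_Normal_Form.Determinant"
begin

text \<open>
  The operators of all generators are built from operators on single tensor factors, and conjugation
  by \<open>w0\<close>, which acts by \<open>xi\<close> on every factor of \<open>V\<close>, turns the adjoint \<open>A\<^sup>H\<close> of \<open>A\<close> in the complexified
  Lie algebra acting on \<open>V\<close> into \<open>xi A\<^sup>H xi = mat_star A\<close>. As \<open>mat_star\<close> is, up to sign, a
  conjugate linear automorphism of the Lie algebra, it fixes the Casimir tensor \<open>\<Sum> b \<otimes> d b\<close>, so
  each \<open>z\<^sub>i\<close> is self-adjoint up to conjugation by \<open>w0\<close>; conjugation by elements of \<open>K\<close> fixes the tensor too.
  For the remaining generators it is enough to know that only scalars commute with \<open>lie_p0 G\<close>:
  this forces the form on \<open>V\<close> to be a multiple of the standard one, and the projection of \<open>V \<otimes> V\<close>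
  onto its invariants to be a real multiple of \<open>J \<otimes> J\<close> with \<open>J = gram G\<close>.
\<close>

section \<open>The Lie algebra and its compact group\<close>

text \<open>The form on X is invariant for \<open>mat_star\<close>, the form on V for conjugate
  transposition; that \<open>w0\<close> can reconcile the two rests on the Cartan involution being A
  \<mapsto> -A^T (\<open>lie_g_iff\<close>). Adjointness is checked on generators and carried to
  expressions by induction on their syntax, so it holds for each representative of a class.
  Commutation with K is checked in the same way and keeps the operators inside Hom_K.

  The data \<open>B\<close>, \<open>d\<close>, \<open>P\<close> and the form on V enter through
  axioms only. The existence of \<open>d\<close> stands for nondegeneracy of the Killing form;
  \<open>P\<close> and the form on V are pinned down by Schur's lemma, made explicit by a few
  matrices in \<open>lie_p0 G\<close>. This needs real rank at least 1, and p \<ge> 2 in the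
  orthogonal case: for O(1,1) the noncompact part is spanned by a single matrix, so more than
  scalars commute with it. Odd p + q excludes this. For real rank 0 one has k = 0, and the tensor
  power of V is trivial.\<close>

fun gram_sign :: "classical \<Rightarrow> complex" where
  "gram_sign (Sp_real n) = - 1"
| "gram_sign (O_real p q) = 1"

text \<open>With J = \<open>gram G\<close> and \<epsilon> = \<open>gram_sign G\<close> one has J^T =
  \<epsilon> J and J^2 = \<epsilon> I. The matrix \<open>xi G\<close> is J times this scalar, whose
  square is \<epsilon>; hence \<open>xi G\<close> is an involution.\<close>

fun xi_unit :: "classical \<Rightarrow> complex" where
  "xi_unit (Sp_real n) = \<i>"
| "xi_unit (O_real p q) = 1"

lemma gram_sign_sq [simp]: "gram_sign G * gram_sign G = 1" "gram_sign G \<noteq> 0"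
  by (cases G; simp)+

lemma xi_unit_sq: "xi_unit G * xi_unit G = gram_sign G" "cnj (xi_unit G) = xi_unit G * gram_sign G"
  by (cases G; simp)+

lemma gram_carrier [simp]: "gram G \<in> carrier_mat (vdim G) (vdim G)"
  by (cases G) (auto simp: mult_2)

lemma gram_dims [simp]: "dim_row (gram G) = vdim G" "dim_col (gram G) = vdim G"
  using gram_carrier[of G] by blast+

lemma gram_Sp_entry:
  "a < 2 * n \<Longrightarrow> b < 2 * n \<Longrightarrow>
    gram (Sp_real n) $$ (a, b) = (if b = a + n then 1 else if a = b + n then - 1 else 0)"
  by auto

lemma gram_O_entry:
  "a < p + q \<Longrightarrow> b < p + q \<Longrightarrow>
    gram (O_real p q) $$ (a, b) = (if a = b then if a < p then 1 else - 1 else 0)"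
  by auto

lemma gram_real: "a < vdim G \<Longrightarrow> b < vdim G \<Longrightarrow> cnj (gram G $$ (a, b)) = gram G $$ (a, b)"
  by (cases G) (auto simp: gram_Sp_entry gram_O_entry simp del: gram.simps)

lemma transpose_gram: "transpose_mat (gram G) = gram_sign G \<cdot>\<^sub>m gram G"
  by (rule eq_matI; cases G) (auto simp: gram_Sp_entry gram_O_entry simp del: gram.simps)

lemma gram_sq: "gram G * gram G = gram_sign G \<cdot>\<^sub>m 1\<^sub>m (vdim G)"
proof (cases G)
  case (Sp_real n)
  have "gram G * gram G = four_block_mat (- 1\<^sub>m n) (0\<^sub>m n n) (0\<^sub>m n n) (- 1\<^sub>m n)"
    unfolding Sp_real gram.simps by (subst mult_four_block_mat[of _ n n _ n _ n]) auto
  then show ?thesis unfolding Sp_real by (auto intro!: eq_matI)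
next
  case (O_real p q)
  have "gram G * gram G = four_block_mat (1\<^sub>m p) (- 0\<^sub>m p q) (0\<^sub>m q p) (1\<^sub>m q)"
    unfolding O_real gram.simps by (subst mult_four_block_mat[of _ p p _ q _ q]) (auto simp del: four_block_one_mat)
  then show ?thesis unfolding O_real by (auto intro!: eq_matI)
qed

text \<open>This allows a common treatment of the two families until the commutant is computed:
  facts about \<open>xi G\<close> come from the identities for J and for the scalar.\<close>

lemma xi_gram: "xi G = xi_unit G \<cdot>\<^sub>m gram G"
  by (cases G; auto intro!: eq_matI)

lemma xi_carrier [simp]: "xi G \<in> carrier_mat (vdim G) (vdim G)"
  by (simp add: xi_gram)

lemma xi_dims [simp]: "dim_row (xi G) = vdim G" "dim_col (xi G) = vdim G"
  using xi_carrier[of G] by blast+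

lemma smult_smult: "a \<cdot>\<^sub>m (b \<cdot>\<^sub>m M) = (a * b) \<cdot>\<^sub>m (M :: complex mat)"
  by (rule eq_matI) auto

lemma one_smult: "1 \<cdot>\<^sub>m M = (M :: complex mat)"
  by (rule eq_matI) auto

lemma xi_sq: "xi G * xi G = 1\<^sub>m (vdim G)"
proof -
  have "xi G * xi G = xi_unit G \<cdot>\<^sub>m (gram G * (xi_unit G \<cdot>\<^sub>m gram G))"
    unfolding xi_gram by (intro mult_smult_assoc_mat[of _ "vdim G" "vdim G" _ "vdim G"]) auto
  also have "gram G * (xi_unit G \<cdot>\<^sub>m gram G) = xi_unit G \<cdot>\<^sub>m (gram G * gram G)"
    by (intro mult_smult_distrib[of _ "vdim G" "vdim G" _ "vdim G"]) auto
  finally show ?thesis by (simp add: gram_sq smult_smult one_smult xi_unit_sq mult.assoc[symmetric])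
qed

text \<open>Transposing J and conjugating the scalar both produce the sign \<epsilon>. This makes
  the generators \<open>th i\<close> self-adjoint.\<close>

lemma xi_hermitian: "a < vdim G \<Longrightarrow> b < vdim G \<Longrightarrow> cnj (xi G $$ (a, b)) = xi G $$ (b, a)"
proof -
  assume ab: "a < vdim G" "b < vdim G"
  have "gram G $$ (b, a) = gram_sign G * gram G $$ (a, b)"
    using arg_cong[OF transpose_gram[of G], of "\<lambda>M. M $$ (a, b)"] ab by simp
  then show ?thesis
    using ab by (simp add: xi_gram gram_real xi_unit_sq)
qed

section \<open>Matrix entries and membership in the complexified Lie algebra\<close>

lemma mat_eqI: "A \<in> carrier_mat n n \<Longrightarrow> B \<in> carrier_mat n n \<Longrightarrow>
    (\<And>a b. a < n \<Longrightarrow> b < n \<Longrightarrow> A $$ (a, b) = B $$ (a, b)) \<Longrightarrow> A = B"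
  by (rule eq_matI) auto

lemma mat_mult_entry: "A \<in> carrier_mat n n \<Longrightarrow> B \<in> carrier_mat n n \<Longrightarrow> a < n \<Longrightarrow> b < n \<Longrightarrow>
    (A * B) $$ (a, b) = (\<Sum>c<n. A $$ (a, c) * B $$ (c, b))"
  by (auto simp: scalar_prod_def lessThan_atLeast0 intro!: sum.cong)

text \<open>The equation A^T J + J A = 0 in entries, without the reality condition. It is complex
  linear and has real coefficients, so its solutions form the complexification of
  \<open>lie_g0 G\<close>.\<close>

definition lie_entries :: "classical \<Rightarrow> complex mat \<Rightarrow> bool" where
  "lie_entries G A \<longleftrightarrow> A \<in> carrier_mat (vdim G) (vdim G) \<and> (\<forall>a<vdim G. \<forall>b<vdim G.
     (\<Sum>c<vdim G. A $$ (c, a) * gram G $$ (c, b)) +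
     (\<Sum>c<vdim G. gram G $$ (a, c) * A $$ (c, b)) = 0)"

lemma lie_g0_entries: "A \<in> lie_g0 G \<longleftrightarrow> lie_entries G A \<and>
    (\<forall>a<vdim G. \<forall>b<vdim G. A $$ (a, b) \<in> \<real>)"
proof -
  let ?N = "vdim G"
  have "transpose_mat A * gram G + gram G * A = 0\<^sub>m ?N ?N \<longleftrightarrow>
     (\<forall>a<?N. \<forall>b<?N. (\<Sum>c<?N. A $$ (c, a) * gram G $$ (c, b)) +
       (\<Sum>c<?N. gram G $$ (a, c) * A $$ (c, b)) = 0)" (is "?l \<longleftrightarrow> ?r")
    if A: "A \<in> carrier_mat ?N ?N"
  proof -
    have e: "(transpose_mat A * gram G + gram G * A) $$ (a, b) =
       (\<Sum>c<?N. A $$ (c, a) * gram G $$ (c, b)) + (\<Sum>c<?N. gram G $$ (a, c) * A $$ (c, b))"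
      if "a < ?N" "b < ?N" for a b
      using A that mat_mult_entry[of "transpose_mat A" ?N "gram G" a b]
        mat_mult_entry[of "gram G" ?N A a b] by (auto intro!: sum.cong)
    show ?thesis
    proof
      assume l: ?l
      show ?r
      proof (intro allI impI)
        fix a b assume "a < ?N" "b < ?N"
        then show "(\<Sum>c<?N. A $$ (c, a) * gram G $$ (c, b)) +
            (\<Sum>c<?N. gram G $$ (a, c) * A $$ (c, b)) = 0"
          using e[of a b] unfolding l by simp
      qed
    next
      assume ?r then show ?l using e A by (auto intro!: mat_eqI[of _ ?N])
    qed
  qed
  then show ?thesis
    unfolding lie_g0_def lie_entries_def real_mats_def by auto
qed

lemma lie_entries_add:
  assumes "lie_entries G A" "lie_entries G B" shows "lie_entries G (A + B)"
proof -
  let ?N = "vdim G" and ?J = "gram G"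
  let ?L = "\<lambda>A a b. (\<Sum>c<?N. A $$ (c, a) * ?J $$ (c, b)) + (\<Sum>c<?N. ?J $$ (a, c) * A $$ (c, b))"
  have c: "A \<in> carrier_mat ?N ?N" "B \<in> carrier_mat ?N ?N"
    using assms by (auto simp: lie_entries_def)
  have "?L (A + B) a b = ?L A a b + ?L B a b" if "a < ?N" "b < ?N" for a b
  proof -
    have "(\<Sum>c<?N. (A + B) $$ (c, a) * ?J $$ (c, b)) =
        (\<Sum>c<?N. A $$ (c, a) * ?J $$ (c, b) + B $$ (c, a) * ?J $$ (c, b))"
      using c that by (intro sum.cong) (auto simp: ring_distribs)
    moreover have "(\<Sum>c<?N. ?J $$ (a, c) * (A + B) $$ (c, b)) =
        (\<Sum>c<?N. ?J $$ (a, c) * A $$ (c, b) + ?J $$ (a, c) * B $$ (c, b))"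
      using c that by (intro sum.cong) (auto simp: ring_distribs)
    ultimately show ?thesis by (simp add: sum.distrib)
  qed
  then show ?thesis using assms unfolding lie_entries_def by simp
qed

lemma lie_entries_smult:
  assumes "lie_entries G A" shows "lie_entries G (r \<cdot>\<^sub>m A)"
proof -
  let ?N = "vdim G" and ?J = "gram G"
  let ?L = "\<lambda>A a b. (\<Sum>c<?N. A $$ (c, a) * ?J $$ (c, b)) + (\<Sum>c<?N. ?J $$ (a, c) * A $$ (c, b))"
  have c: "A \<in> carrier_mat ?N ?N"
    using assms by (auto simp: lie_entries_def)
  have "?L (r \<cdot>\<^sub>m A) a b = r * ?L A a b" if "a < ?N" "b < ?N" for a b
    unfolding ring_distribs(1) sum_distrib_left using c that
    by (intro arg_cong2[of _ _ _ _ "(+)"] sum.cong) auto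
  then show ?thesis using assms unfolding lie_entries_def by simp
qed

lemma lie_entries_cnj:
  assumes "lie_entries G A" shows "lie_entries G (map_mat cnj A)"
proof -
  have A: "A \<in> carrier_mat (vdim G) (vdim G)" using assms by (auto simp: lie_entries_def)
  have "(\<Sum>c<vdim G. map_mat cnj A $$ (c, a) * gram G $$ (c, b)) +
     (\<Sum>c<vdim G. gram G $$ (a, c) * map_mat cnj A $$ (c, b)) =
     cnj ((\<Sum>c<vdim G. A $$ (c, a) * gram G $$ (c, b)) +
     (\<Sum>c<vdim G. gram G $$ (a, c) * A $$ (c, b)))" if "a < vdim G" "b < vdim G" for a b
    using A that by (auto simp: gram_real)
  then show ?thesis using assms unfolding lie_entries_def by auto
qed

lemma lie_g_entries: "A \<in> lie_g G \<longleftrightarrow> lie_entries G A"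
proof
  assume "A \<in> lie_g G"
  then show "lie_entries G A"
    by (auto simp: lie_g_def lie_g0_entries lie_entries_add lie_entries_smult)
next
  assume A: "lie_entries G A"
  then have c: "A \<in> carrier_mat (vdim G) (vdim G)" by (auto simp: lie_entries_def)
  \<comment> \<open>The real and the imaginary part of A; conjugation preserves the equation because
    J is real.\<close>
  let ?R = "(1/2) \<cdot>\<^sub>m (A + map_mat cnj A)"
  let ?I = "(-\<i>/2) \<cdot>\<^sub>m (A + (- 1) \<cdot>\<^sub>m map_mat cnj A)"
  have "?R \<in> lie_g0 G" "?I \<in> lie_g0 G"
    using A c by (auto simp: lie_g0_entries lie_entries_add lie_entries_smult lie_entries_cnj
      complex_is_Real_iff)
  moreover have "A = ?R + \<i> \<cdot>\<^sub>m ?I"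
    using c by (intro mat_eqI[of _ "vdim G"]) (auto simp: field_simps)
  ultimately show "A \<in> lie_g G" unfolding lie_g_def by blast
qed

lemma lie_g_carrier: "A \<in> lie_g G \<Longrightarrow> A \<in> carrier_mat (vdim G) (vdim G)"
  by (simp add: lie_g_entries lie_entries_def)

lemma lie_g0_subset: "lie_g0 G \<subseteq> lie_g G"
  by (auto simp: lie_g_entries lie_g0_entries)

lemma lie_g_add: "A \<in> lie_g G \<Longrightarrow> B \<in> lie_g G \<Longrightarrow> A + B \<in> lie_g G"
  by (simp add: lie_g_entries lie_entries_add)

lemma lie_g_smult: "A \<in> lie_g G \<Longrightarrow> a \<cdot>\<^sub>m A \<in> lie_g G"
  by (simp add: lie_g_entries lie_entries_smult)

lemma lie_g_cnj: "A \<in> lie_g G \<Longrightarrow> map_mat cnj A \<in> lie_g G"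
  by (simp add: lie_g_entries lie_entries_cnj)

lemma mat_star_smult: "mat_star A = (- 1) \<cdot>\<^sub>m map_mat cnj A"
  by (rule eq_matI) (auto simp: mat_star_def)

lemma lie_g_mat_star: "A \<in> lie_g G \<Longrightarrow> mat_star A \<in> lie_g G"
  by (simp add: mat_star_smult lie_g_smult lie_g_cnj)

lemma uminus_smult: "r \<cdot>\<^sub>m (- A) = - (r \<cdot>\<^sub>m (A :: complex mat))"
  by (rule eq_matI) auto

lemmas mult_assoc_n = assoc_mult_mat[of _ n n _ n _ n] for n
lemmas mult_carrier_n = mult_carrier_mat[of _ n n _ n] for n

text \<open>Multiply A^T J = -J A by J from the right and use J^2 = \<epsilon> I; the sign is
  absorbed by the square of \<open>xi_unit\<close>. The result says that the complex linear Cartan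
  involution is A \<mapsto> -A^T, the bridge between transposes on V and the Lie algebra.\<close>

lemma lie_g_iff:
  "A \<in> lie_g G \<longleftrightarrow> A \<in> carrier_mat (vdim G) (vdim G) \<and> transpose_mat A = - (xi G * A * xi G)"
proof -
  let ?N = "vdim G" and ?J = "gram G"
  have xx: "xi G * A * xi G = gram_sign G \<cdot>\<^sub>m (?J * A * ?J)" if A: "A \<in> carrier_mat ?N ?N"
  proof -
    have "xi G * A * xi G = (xi_unit G \<cdot>\<^sub>m (?J * A)) * (xi_unit G \<cdot>\<^sub>m ?J)"
      using A by (simp add: xi_gram mult_smult_assoc_mat[of _ ?N ?N])
    also have "\<dots> = xi_unit G \<cdot>\<^sub>m (?J * A * (xi_unit G \<cdot>\<^sub>m ?J))"
      using A by (intro mult_smult_assoc_mat[of _ ?N ?N _ ?N]) (auto simp: mult_carrier_n[of _ ?N])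
    also have "?J * A * (xi_unit G \<cdot>\<^sub>m ?J) = xi_unit G \<cdot>\<^sub>m (?J * A * ?J)"
      using A by (intro mult_smult_distrib[of _ ?N ?N _ ?N]) (auto simp: mult_carrier_n[of _ ?N])
    finally show ?thesis by (simp add: smult_smult one_smult xi_unit_sq)
  qed
  have eq: "(\<forall>a<?N. \<forall>b<?N. (\<Sum>c<?N. A $$ (c, a) * ?J $$ (c, b)) +
       (\<Sum>c<?N. ?J $$ (a, c) * A $$ (c, b)) = 0) \<longleftrightarrow> transpose_mat A * ?J = - (?J * A)" (is "?l \<longleftrightarrow> ?r")
    if A: "A \<in> carrier_mat ?N ?N"
  proof -
    have e: "(transpose_mat A * ?J) $$ (a, b) = (\<Sum>c<?N. A $$ (c, a) * ?J $$ (c, b))"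
       "(?J * A) $$ (a, b) = (\<Sum>c<?N. ?J $$ (a, c) * A $$ (c, b))"
      if "a < ?N" "b < ?N" for a b
      using A that mat_mult_entry[of "transpose_mat A" ?N "gram G" a b]
        mat_mult_entry[of "gram G" ?N A a b] by (auto intro!: sum.cong)
    show ?thesis
    proof
      assume ?l then show ?r using e A
        by (intro mat_eqI[of _ ?N]) (auto simp: eq_neg_iff_add_eq_0 mult_carrier_n[of _ ?N] simp del: index_mult_mat(1))
    next
      assume r: ?r
      show ?l
      proof (intro allI impI)
        fix a b assume "a < ?N" "b < ?N"
        then show "(\<Sum>c<?N. A $$ (c, a) * ?J $$ (c, b)) + (\<Sum>c<?N. ?J $$ (a, c) * A $$ (c, b)) = 0"
          using arg_cong[OF r, of "\<lambda>M. M $$ (a, b)"] e[of a b] A by (simp del: index_mult_mat(1))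
      qed
    qed
  qed
  have JJ: "M * ?J * ?J = gram_sign G \<cdot>\<^sub>m M" if "M \<in> carrier_mat ?N ?N" for M
    using that by (simp add: mult_assoc_n[of _ ?N] gram_sq mult_smult_distrib[of _ ?N ?N _ ?N])
  have "transpose_mat A * ?J = - (?J * A) \<longleftrightarrow> transpose_mat A = - (gram_sign G \<cdot>\<^sub>m (?J * A * ?J))" (is "?l \<longleftrightarrow> ?r")
    if A: "A \<in> carrier_mat ?N ?N"
  proof
    assume ?l
    then have "transpose_mat A * ?J * ?J = - (?J * A) * ?J" by simp
    then have "gram_sign G \<cdot>\<^sub>m transpose_mat A = - (?J * A * ?J)"
      using JJ[of "transpose_mat A"] A by simp
    then have "gram_sign G \<cdot>\<^sub>m (gram_sign G \<cdot>\<^sub>m transpose_mat A) = gram_sign G \<cdot>\<^sub>m (- (?J * A * ?J))" by simp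
    then have "transpose_mat A = gram_sign G \<cdot>\<^sub>m (- (?J * A * ?J))" by (simp add: smult_smult one_smult)
    then show ?r by (metis uminus_smult)
  next
    assume ?r
    then have "transpose_mat A * ?J = - (gram_sign G \<cdot>\<^sub>m (?J * A * ?J)) * ?J" by simp
    also have "\<dots> = - ((gram_sign G \<cdot>\<^sub>m (?J * A * ?J)) * ?J)" using A by simp
    also have "(gram_sign G \<cdot>\<^sub>m (?J * A * ?J)) * ?J = gram_sign G \<cdot>\<^sub>m (?J * A * ?J * ?J)"
      using A by (intro mult_smult_assoc_mat[of _ ?N ?N _ ?N]) (auto simp: mult_carrier_n[of _ ?N])
    also have "?J * A * ?J * ?J = gram_sign G \<cdot>\<^sub>m (?J * A)"
      using A by (intro JJ) (auto simp: mult_carrier_n[of _ ?N])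
    finally show ?l by (simp add: smult_smult one_smult)
  qed
  then show ?thesis using xx eq unfolding lie_g_entries lie_entries_def by auto
qed

text \<open>Conjugation by the involution \<open>xi G\<close> is multiplicative, whereas
  transposition reverses products; the reversal accounts for the minus sign in
  \<open>lie_g_iff\<close>.\<close>

lemma lie_g_bracket:
  assumes "A \<in> lie_g G" "B \<in> lie_g G" shows "bracket A B \<in> lie_g G"
proof -
  let ?N = "vdim G" and ?x = "xi G"
  have c: "A \<in> carrier_mat ?N ?N" "B \<in> carrier_mat ?N ?N"
    and t: "transpose_mat A = - (?x * A * ?x)" "transpose_mat B = - (?x * B * ?x)"
    using assms by (auto simp: lie_g_iff)
  have p: "(?x * A * ?x) * (?x * B * ?x) = ?x * (A * B) * ?x"
    if c: "A \<in> carrier_mat ?N ?N" "B \<in> carrier_mat ?N ?N" for A B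
  proof -
    have "(?x * A * ?x) * (?x * B * ?x) = ?x * A * (?x * ?x) * B * ?x"
      using c by (simp add: mult_assoc_n[of _ ?N] mult_carrier_n[of _ ?N])
    then show ?thesis using c by (simp add: xi_sq mult_assoc_n[of _ ?N] mult_carrier_n[of _ ?N])
  qed
  have "transpose_mat (bracket A B) = transpose_mat (A * B) - transpose_mat (B * A)"
    unfolding bracket_def using c by (intro transpose_minus[of _ ?N ?N]) (auto simp: mult_carrier_n[of _ ?N])
  also have "\<dots> = transpose_mat B * transpose_mat A - transpose_mat A * transpose_mat B"
    using c by (simp add: transpose_mult[of _ ?N ?N _ ?N])
  also have "\<dots> = ?x * (B * A) * ?x - ?x * (A * B) * ?x"
    unfolding t using c by (simp add: p)
  also have "\<dots> = ?x * (B * A - A * B) * ?x"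
    using c by (simp add: mult_minus_distrib_mat[of _ ?N ?N _ ?N] minus_mult_distrib_mat[of _ ?N ?N _ _ ?N]
        mult_carrier_n[of _ ?N])
  also have "B * A - A * B = - bracket A B"
    unfolding bracket_def using c by (intro mat_eqI[of _ ?N]) auto
  finally show ?thesis using c by (simp add: lie_g_iff bracket_def mult_carrier_n[of _ ?N] minus_carrier_mat[of _ ?N])
qed

text \<open>As the Cartan involution is A \<mapsto> -A^T, its -1 eigenspace consists of symmetric
  matrices.\<close>

lemma lie_p0_iff: "A \<in> lie_p0 G \<longleftrightarrow> A \<in> lie_g0 G \<and> transpose_mat A = A"
proof (cases "A \<in> lie_g0 G")
  case True
  then have "A \<in> lie_g G" using lie_g0_subset by blast
  then have t: "transpose_mat A = - (xi G * A * xi G)" by (simp add: lie_g_iff)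
  have "xi G * A * xi G = - A \<longleftrightarrow> - (xi G * A * xi G) = A"
    by (metis uminus_uminus_mat)
  then show ?thesis using True by (simp add: lie_p0_def t)
qed (simp add: lie_p0_def)

text \<open>An element g of K commutes with \<open>xi G\<close>, hence with J, so g^T J g = J reads
  g^T g J = J and g is orthogonal. Inverses in K can therefore be written as transposes, as is done
  from here on.\<close>

lemma grp_K_facts:
  assumes "g \<in> grp_K G"
  shows "g \<in> carrier_mat (vdim G) (vdim G)" "\<And>a b. a < vdim G \<Longrightarrow> b < vdim G \<Longrightarrow> g $$ (a, b) \<in> \<real>"
    "xi G * g = g * xi G" "gram G * g = g * gram G" "transpose_mat g * g = 1\<^sub>m (vdim G)"
    "g * transpose_mat g = 1\<^sub>m (vdim G)" "xi G * transpose_mat g = transpose_mat g * xi G"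
    "transpose_mat g \<in> grp_K G"
proof -
  let ?N = "vdim G" and ?x = "xi G" and ?J = "gram G" and ?t = "transpose_mat g"
  note as = mult_assoc_n[of _ ?N] and cr = mult_carrier_n[of _ ?N]
  show c: "g \<in> carrier_mat ?N ?N" and r: "\<And>a b. a < ?N \<Longrightarrow> b < ?N \<Longrightarrow> g $$ (a, b) \<in> \<real>"
    using assms by (auto simp: grp_K_def grp_G_def real_mats_def)
  have x: "?x * g * ?x = g" and J: "?t * ?J * g = ?J"
    using assms by (auto simp: grp_K_def grp_G_def)
  have "?x * g = ?x * g * ?x * ?x" using c by (simp add: as cr xi_sq)
  then show xg: "?x * g = g * ?x" unfolding x .
  have Jx: "?J = (gram_sign G * xi_unit G) \<cdot>\<^sub>m ?x"
    by (simp add: xi_gram smult_smult one_smult xi_unit_sq mult.assoc)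
  show Jg: "?J * g = g * ?J"
    unfolding Jx using c xg by (simp add: mult_smult_assoc_mat[of _ ?N ?N _ ?N] mult_smult_distrib[of _ ?N ?N _ ?N])
  have "?t * g * ?J = ?J" using J c Jg by (simp add: as cr)
  then have "?t * g * ?J * ?J = ?J * ?J" by simp
  then have "?t * g * (gram_sign G \<cdot>\<^sub>m 1\<^sub>m ?N) = gram_sign G \<cdot>\<^sub>m 1\<^sub>m ?N"
    using c by (simp add: as cr gram_sq)
  then have "gram_sign G \<cdot>\<^sub>m (gram_sign G \<cdot>\<^sub>m (?t * g)) = gram_sign G \<cdot>\<^sub>m (gram_sign G \<cdot>\<^sub>m 1\<^sub>m ?N)"
    using c by (simp add: mult_smult_distrib[of _ ?N ?N _ ?N] cr)
  then show tg: "?t * g = 1\<^sub>m ?N" by (simp add: smult_smult one_smult)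
  then show gt: "g * ?t = 1\<^sub>m ?N" using c mat_mult_left_right_inverse[of ?t ?N g] by simp
  \<comment> \<open>Commutation with g, conjugated by g^T, becomes commutation with g^T.\<close>
  have conj: "?t * (M * g) * ?t = ?t * M" "?t * (g * M) * ?t = M * ?t" if "M \<in> carrier_mat ?N ?N" for M
  proof -
    have "?t * (M * g) * ?t = ?t * M * (g * ?t)" "?t * (g * M) * ?t = (?t * g) * M * ?t"
      using c that by (simp_all add: as cr)
    then show "?t * (M * g) * ?t = ?t * M" "?t * (g * M) * ?t = M * ?t"
      using c that by (simp_all add: tg gt cr)
  qed
  show xt: "?x * ?t = ?t * ?x" using conj[of ?x] xg by simp
  have "?J * ?t = ?t * ?J" using conj[of ?J] Jg by simp
  then have "g * ?J * ?t = ?J" using c by (simp add: as cr gt) (simp add: as[symmetric] cr gt)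
  moreover have "?x * ?t * ?x = ?t" using xt c by (simp add: as cr xi_sq)
  ultimately show "?t \<in> grp_K G"
    using c r by (auto simp: grp_K_def grp_G_def real_mats_def)
qed

lemma lie_g_conjugate:
  assumes "g \<in> grp_K G" "A \<in> lie_g G" shows "g * A * transpose_mat g \<in> lie_g G"
proof -
  let ?N = "vdim G" and ?x = "xi G" and ?t = "transpose_mat g"
  note as = mult_assoc_n[of _ ?N] and cr = mult_carrier_n[of _ ?N] and g = grp_K_facts[OF assms(1)]
  have A: "A \<in> carrier_mat ?N ?N" "transpose_mat A = - (?x * A * ?x)"
    using assms by (auto simp: lie_g_iff)
  have "transpose_mat (g * A * ?t) = g * (transpose_mat A * ?t)"
    using g A(1) by (simp add: transpose_mult[of _ ?N ?N _ ?N] cr)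
  also have "\<dots> = - (g * ?x * A * (?x * ?t))"
    unfolding A(2) using g A(1) by (simp add: as cr)
  also have "\<dots> = - (?x * (g * A * ?t) * ?x)"
    unfolding g(7) g(3)[symmetric] using g(1) A(1) by (simp add: as cr)
  finally show ?thesis using g(1) A(1) by (simp add: lie_g_iff cr)
qed

section \<open>Invariance of the Casimir tensor\<close>

lemma bracket_add_right:
  assumes "A \<in> carrier_mat n n" "B \<in> carrier_mat n n" "C \<in> carrier_mat n n"
  shows "bracket A (B + C) = bracket A B + bracket A C"
  using assms unfolding bracket_def
  by (intro mat_eqI[of _ n])
    (auto simp: minus_carrier_mat[of _ n] mult_add_distrib_mat[of _ n n _ n] add_mult_distrib_mat[of _ n n _ _ n])

lemma bracket_add_left:
  assumes "A \<in> carrier_mat n n" "B \<in> carrier_mat n n" "C \<in> carrier_mat n n"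
  shows "bracket (A + B) C = bracket A C + bracket B C"
  using assms unfolding bracket_def
  by (intro mat_eqI[of _ n])
    (auto simp: minus_carrier_mat[of _ n] mult_add_distrib_mat[of _ n n _ n] add_mult_distrib_mat[of _ n n _ _ n])

lemma bracket_smult:
  assumes "A \<in> carrier_mat n n" "B \<in> carrier_mat n n"
  shows "bracket A (r \<cdot>\<^sub>m B) = r \<cdot>\<^sub>m bracket A B" "bracket (r \<cdot>\<^sub>m A) B = r \<cdot>\<^sub>m bracket A B"
  using assms unfolding bracket_def
  by (auto intro!: mat_eqI[of _ n] simp: minus_carrier_mat[of _ n] mult_smult_distrib[of _ n n _ n]
      mult_smult_assoc_mat[of _ n n _ n] right_diff_distrib)

text \<open>The twist h of the scalars is the identity for conjugation by K and for multilinear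
  maps, and \<open>cnj\<close> for complex conjugation of matrices, so one argument serves both
  symmetries of the Casimir tensor. The laws are restricted to the Lie algebra because
  \<open>lie X\<close> is constrained only there.\<close>

definition semilin :: "classical \<Rightarrow> (complex \<Rightarrow> complex) \<Rightarrow> (complex \<Rightarrow> 'x \<Rightarrow> 'x::ab_group_add) \<Rightarrow>
    (complex mat \<Rightarrow> 'x) \<Rightarrow> bool" where
  "semilin G h s \<phi> \<longleftrightarrow> (\<forall>A\<in>lie_g G. \<forall>A'\<in>lie_g G. \<phi> (A + A') = \<phi> A + \<phi> A') \<and>
     (\<forall>a. \<forall>A\<in>lie_g G. \<phi> (a \<cdot>\<^sub>m A) = s (h a) (\<phi> A))"

definition semilin_endo :: "classical \<Rightarrow> (complex \<Rightarrow> complex) \<Rightarrow> (complex mat \<Rightarrow> complex mat) \<Rightarrow> bool" where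
  "semilin_endo G h \<sigma> \<longleftrightarrow> (\<forall>A\<in>lie_g G. \<sigma> A \<in> lie_g G) \<and>
     (\<forall>A\<in>lie_g G. \<forall>A'\<in>lie_g G. \<sigma> (A + A') = \<sigma> A + \<sigma> A') \<and>
     (\<forall>a. \<forall>A\<in>lie_g G. \<sigma> (a \<cdot>\<^sub>m A) = h a \<cdot>\<^sub>m \<sigma> A)"

lemma semilin_comp: "semilin_endo G h \<sigma> \<Longrightarrow> semilin G h' s \<phi> \<Longrightarrow> semilin G (\<lambda>a. h' (h a)) s (\<lambda>A. \<phi> (\<sigma> A))"
  unfolding semilin_def semilin_endo_def by simp

lemma semilin_endo_comp: "semilin_endo G h \<sigma> \<Longrightarrow> semilin_endo G h' \<tau> \<Longrightarrow> semilin_endo G (\<lambda>a. h' (h a)) (\<lambda>A. \<tau> (\<sigma> A))"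
  unfolding semilin_endo_def by simp

lemma semilin_endo_bracket: "A \<in> lie_g G \<Longrightarrow> semilin_endo G (\<lambda>a. a) (bracket A)"
  unfolding semilin_endo_def
  by (auto simp: lie_g_bracket bracket_add_right[of _ "vdim G"] bracket_smult[of _ "vdim G"] lie_g_carrier)

section \<open>Coordinates, the Killing form and dual families\<close>

locale lie_dual_basis =
  fixes G :: classical and B :: "complex mat set" and d :: "complex mat \<Rightarrow> complex mat"
  assumes basis: "lie_basis G B" and dual: "dual_basis G B d"
begin

abbreviation "cf \<equiv> coord (vdim G) B"
abbreviation "\<kappa> \<equiv> killing (vdim G) B"

lemma finite_B: "finite B" and B_sub: "b \<in> B \<Longrightarrow> b \<in> lie_g G"
  using basis by (auto simp: lie_basis_def)

lemma dual_in: "b \<in> B \<Longrightarrow> d b \<in> lie_g G"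
  using dual by (auto simp: dual_basis_def)

lemma coord_ex1:
  assumes "A \<in> lie_g G" shows "\<exists>!c. coeffs_wrt (vdim G) B A c"
  using basis assms unfolding lie_basis_def by blast

lemma coord_spec: "A \<in> lie_g G \<Longrightarrow> coeffs_wrt (vdim G) B A (cf A)"
  unfolding coord_def by (rule theI'[OF coord_ex1])

lemma coord_unique: "A \<in> lie_g G \<Longrightarrow> coeffs_wrt (vdim G) B A c \<Longrightarrow> cf A = c"
  unfolding coord_def by (rule the1_equality[OF coord_ex1])

lemma coord_add:
  assumes "A \<in> lie_g G" "A' \<in> lie_g G" shows "cf (A + A') = (\<lambda>b. cf A b + cf A' b)"
proof (rule coord_unique[OF lie_g_add[OF assms]])
  have "A \<in> carrier_mat (vdim G) (vdim G)" "A' \<in> carrier_mat (vdim G) (vdim G)"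
    using assms lie_g_carrier by auto
  then show "coeffs_wrt (vdim G) B (A + A') (\<lambda>b. cf A b + cf A' b)"
    using coord_spec[OF assms(1)] coord_spec[OF assms(2)]
    by (simp add: coeffs_wrt_def ring_distribs sum.distrib)
qed

lemma coord_smult:
  assumes "A \<in> lie_g G" shows "cf (r \<cdot>\<^sub>m A) = (\<lambda>b. r * cf A b)"
proof (rule coord_unique[OF lie_g_smult[OF assms]])
  have "A \<in> carrier_mat (vdim G) (vdim G)"
    using assms lie_g_carrier by auto
  then show "coeffs_wrt (vdim G) B (r \<cdot>\<^sub>m A) (\<lambda>b. r * cf A b)"
    using coord_spec[OF assms] by (simp add: coeffs_wrt_def sum_distrib_left mult.assoc)
qed

lemma coord_basis: "b \<in> B \<Longrightarrow> cf b = (\<lambda>c. if c = b then 1 else 0)"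
proof (rule coord_unique[OF B_sub])
  assume b: "b \<in> B"
  have "(\<Sum>c\<in>B. (if c = b then 1 else 0) * c $$ (i, j)) = (\<Sum>c\<in>B. if c = b then b $$ (i, j) else 0)" for i j
    by (rule sum.cong) auto
  then show "coeffs_wrt (vdim G) B b (\<lambda>c. if c = b then 1 else 0)"
    using b finite_B by (auto simp: coeffs_wrt_def)
qed

lemma coord_semilin: "semilin G (\<lambda>a. a) (*) (\<lambda>A. cf A e)"
  by (simp add: semilin_def coord_add coord_smult)

lemma semilin_expand:
  assumes \<phi>: "semilin G h s \<phi>" and A: "A \<in> lie_g G"
  shows "\<phi> A = (\<Sum>b\<in>B. s (h (cf A b)) (\<phi> b))"
proof -
  let ?N = "vdim G"
  \<comment> \<open>Partial sums of the expansion of A, for an induction over the subsets of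
    \<open>B\<close>. The induction starts at the zero matrix, which lies in the Lie algebra as 0
    times A.\<close>
  define lin where "lin S = mat ?N ?N (\<lambda>(i, j). \<Sum>b\<in>S. cf A b * b $$ (i, j))" for S
  have "0 \<cdot>\<^sub>m A = 0\<^sub>m ?N ?N" using lie_g_carrier[OF A] by (intro mat_eqI[of _ ?N]) auto
  then have z: "0\<^sub>m ?N ?N \<in> lie_g G" using lie_g_smult[OF A, of 0] by simp
  have "lin S \<in> lie_g G \<and> \<phi> (lin S) = (\<Sum>b\<in>S. s (h (cf A b)) (\<phi> b))" if "S \<subseteq> B" for S
    using finite_subset[OF that finite_B] that
  proof (induction S rule: finite_induct)
    case empty
    have "\<phi> (0\<^sub>m ?N ?N + 0\<^sub>m ?N ?N) = \<phi> (0\<^sub>m ?N ?N) + \<phi> (0\<^sub>m ?N ?N)"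
      using \<phi> z unfolding semilin_def by blast
    then have "\<phi> (0\<^sub>m ?N ?N) = 0" by simp
    moreover have "lin {} = 0\<^sub>m ?N ?N" by (auto simp: lin_def)
    ultimately show ?case using z by (metis sum.empty)
  next
    case (insert b S)
    have bg: "b \<in> lie_g G" using insert B_sub by auto
    have "lin (insert b S) = cf A b \<cdot>\<^sub>m b + lin S"
      using insert lie_g_carrier[OF bg] by (intro mat_eqI[of _ ?N]) (auto simp: lin_def)
    then show ?case
      using insert bg \<phi> lie_g_smult[OF bg, of "cf A b"] by (auto simp: semilin_def lie_g_add)
  qed
  moreover have "lin B = A"
    using coord_spec[OF A] lie_g_carrier[OF A] by (intro mat_eqI[of _ ?N]) (auto simp: lin_def coeffs_wrt_def)
  ultimately show ?thesis by auto
qed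

text \<open>The numbers \<open>cf (\<sigma> b) e\<close> form the matrix of \<sigma>; semilinearity
  twists the coordinates of the argument before this matrix is applied.\<close>

lemma coord_endo:
  assumes "semilin_endo G h \<sigma>" "A \<in> lie_g G"
  shows "cf (\<sigma> A) e = (\<Sum>b\<in>B. h (cf A b) * cf (\<sigma> b) e)"
  using semilin_expand[OF semilin_comp[OF assms(1) coord_semilin] assms(2)] by simp

lemma sum_delta_B:
  "c \<in> B \<Longrightarrow> (\<Sum>b\<in>B. (if b = c then 1 else 0) * f b) = (f c :: complex)"
proof -
  assume "c \<in> B"
  have "(\<Sum>b\<in>B. (if b = c then 1 else 0) * f b) = (\<Sum>b\<in>B. if b = c then f b else 0)"
    by (rule sum.cong) auto
  then show ?thesis using \<open>c \<in> B\<close> finite_B by simp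
qed

lemma killing_semilin_left:
  assumes "A' \<in> lie_g G"
  shows "semilin G (\<lambda>a. a) (*) (\<lambda>A. \<kappa> A A')"
proof -
  have "bracket A' b \<in> lie_g G" if "b \<in> B" for b using assms B_sub that lie_g_bracket by blast
  then show ?thesis unfolding semilin_def killing_def
    by (auto simp: bracket_add_left[of _ "vdim G"] bracket_smult[of _ "vdim G"] lie_g_carrier coord_add coord_smult
      lie_g_bracket sum.distrib sum_distrib_left)
qed

lemma killing_semilin_right:
  assumes "A \<in> lie_g G"
  shows "semilin G (\<lambda>a. a) (*) (\<lambda>A'. \<kappa> A A')"
  unfolding semilin_def killing_def using assms
  by (auto simp: bracket_add_right[of _ "vdim G"] bracket_add_left[of _ "vdim G"] bracket_smult[of _ "vdim G"]
      lie_g_carrier coord_add coord_smult lie_g_bracket sum.distrib sum_distrib_left B_sub)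

lemma killing_dual: "b \<in> B \<Longrightarrow> b' \<in> B \<Longrightarrow> \<kappa> b (d b') = (if b = b' then 1 else 0)"
  using dual by (auto simp: dual_basis_def)

lemma killing_dual_coord:
  assumes "A \<in> lie_g G" "b \<in> B"
  shows "\<kappa> A (d b) = cf A b"
proof -
  have "\<kappa> A (d b) = (\<Sum>c\<in>B. cf A c * \<kappa> c (d b))"
    by (rule semilin_expand[OF killing_semilin_left assms(1)]) (use assms in \<open>simp add: dual_in\<close>)
  also have "\<dots> = (\<Sum>c\<in>B. (if c = b then 1 else 0) * cf A c)"
    using assms by (intro sum.cong) (auto simp: killing_dual)
  finally show ?thesis using sum_delta_B[OF assms(2)] by simp
qed

text \<open>Duality says that the Gram matrix of the Killing form times the coordinate matrix of \<open>d\<close> is the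
  identity; for square matrices the product in the other order is then the identity as well.\<close>

lemma dual_gram_inverse:
  assumes "c \<in> B" "e \<in> B"
  shows "(\<Sum>b\<in>B. cf (d b) e * \<kappa> b c) = (if c = e then 1 else 0)"
proof -
  obtain f where f: "bij_betw f {..<card B} B"
    using ex_bij_betw_nat_finite[OF finite_B] by (auto simp: lessThan_atLeast0)
  let ?n = "card B"
  define K where "K = mat ?n ?n (\<lambda>(i, j). \<kappa> (f i) (f j))"
  define D where "D = mat ?n ?n (\<lambda>(i, j). cf (d (f j)) (f i))"
  have fB: "i < ?n \<Longrightarrow> f i \<in> B" for i using f by (auto simp: bij_betw_def)
  have reidx: "(\<Sum>i<?n. g (f i)) = (\<Sum>b\<in>B. g b)" for g :: "complex mat \<Rightarrow> complex"
    using sum.reindex_bij_betw[OF f] .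
  have inj: "i < ?n \<Longrightarrow> j < ?n \<Longrightarrow> f i = f j \<longleftrightarrow> i = j" for i j
    using f by (auto simp: bij_betw_def inj_on_def)
  have c: "K \<in> carrier_mat ?n ?n" "D \<in> carrier_mat ?n ?n" by (auto simp: K_def D_def)
  have "K * D = 1\<^sub>m ?n"
  proof (rule mat_eqI[of _ ?n])
    fix i j assume ij: "i < ?n" "j < ?n"
    have "(K * D) $$ (i, j) = (\<Sum>l<?n. \<kappa> (f i) (f l) * cf (d (f j)) (f l))"
      unfolding mat_mult_entry[OF c ij] using ij by (intro sum.cong) (auto simp: K_def D_def)
    also have "\<dots> = (\<Sum>b\<in>B. cf (d (f j)) b * \<kappa> (f i) b)"
      using reidx[of "\<lambda>b. cf (d (f j)) b * \<kappa> (f i) b"] by (simp add: mult.commute)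
    also have "\<dots> = \<kappa> (f i) (d (f j))"
      using semilin_expand[OF killing_semilin_right[of "f i"], of "d (f j)"] ij fB by (simp add: B_sub dual_in)
    finally show "(K * D) $$ (i, j) = 1\<^sub>m ?n $$ (i, j)"
      using ij fB inj by (simp add: killing_dual)
  qed (use c in auto)
  then have DK: "D * K = 1\<^sub>m ?n" using mat_mult_left_right_inverse c by blast
  obtain i j where ij: "i < ?n" "j < ?n" "f i = e" "f j = c"
    using assms f unfolding bij_betw_def by (metis imageE lessThan_iff)
  have "(\<Sum>b\<in>B. cf (d b) e * \<kappa> b c) = (\<Sum>l<?n. cf (d (f l)) e * \<kappa> (f l) c)"
    by (rule reidx[symmetric])
  also have "\<dots> = (D * K) $$ (i, j)"
    unfolding mat_mult_entry[OF c(2,1) ij(1,2)] using ij by (intro sum.cong) (auto simp: K_def D_def)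
  finally show ?thesis unfolding DK using ij inj by auto
qed

text \<open>The dual family spans as well: A is the sum of the \<open>d b\<close> with coefficients
  \<open>\<kappa> b A\<close>, seen here through a linear map \<phi>. After expanding A and each
  \<open>d b\<close> in \<open>B\<close>, the inner sum over b is a Kronecker delta by
  \<open>dual_gram_inverse\<close>.\<close>

lemma dual_expand:
  assumes \<phi>: "semilin G (\<lambda>a. a) s \<phi>" and s: "vector_space s" and A: "A \<in> lie_g G"
  shows "\<phi> A = (\<Sum>b\<in>B. s (\<kappa> b A) (\<phi> (d b)))"
proof -
  interpret vector_space s by fact
  have "(\<Sum>b\<in>B. s (\<kappa> b A) (\<phi> (d b))) =
      (\<Sum>b\<in>B. \<Sum>c\<in>B. \<Sum>e\<in>B. s (cf A c * (cf (d b) e * \<kappa> b c)) (\<phi> e))"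
  proof (rule sum.cong[OF HOL.refl])
    fix b assume b: "b \<in> B"
    have "s (\<kappa> b A) (\<phi> (d b)) = s (\<Sum>c\<in>B. cf A c * \<kappa> b c) (\<Sum>e\<in>B. s (cf (d b) e) (\<phi> e))"
      using semilin_expand[OF killing_semilin_right[OF B_sub[OF b]] A]
        semilin_expand[OF \<phi> dual_in[OF b]] by simp
    also have "\<dots> = (\<Sum>c\<in>B. \<Sum>e\<in>B. s (cf A c * (cf (d b) e * \<kappa> b c)) (\<phi> e))"
      by (subst sum.swap) (simp add: scale_sum_left scale_sum_right sum_distrib_left ac_simps)
    finally show "s (\<kappa> b A) (\<phi> (d b)) = (\<Sum>c\<in>B. \<Sum>e\<in>B. s (cf A c * (cf (d b) e * \<kappa> b c)) (\<phi> e))" .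
  qed
  also have "\<dots> = (\<Sum>c\<in>B. \<Sum>e\<in>B. \<Sum>b\<in>B. s (cf A c * (cf (d b) e * \<kappa> b c)) (\<phi> e))"
    by (subst sum.swap, rule sum.cong[OF HOL.refl], rule sum.swap)
  also have "\<dots> = (\<Sum>c\<in>B. \<Sum>e\<in>B. s (cf A c * (\<Sum>b\<in>B. cf (d b) e * \<kappa> b c)) (\<phi> e))"
    by (simp add: scale_sum_left sum_distrib_left)
  also have "\<dots> = (\<Sum>c\<in>B. \<Sum>e\<in>B. if e = c then s (cf A c) (\<phi> e) else 0)"
    by (intro sum.cong) (auto simp: dual_gram_inverse)
  also have "\<dots> = (\<Sum>c\<in>B. s (cf A c) (\<phi> c))"
    using finite_B by simp
  also have "\<dots> = \<phi> A" using semilin_expand[OF \<phi> A] by simp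
  finally show ?thesis by simp
qed

section \<open>Invariance of the Killing form and the Casimir tensor under semilinear
  automorphisms\<close>

context
  fixes h :: "complex \<Rightarrow> complex" and \<sigma> \<tau> :: "complex mat \<Rightarrow> complex mat"
  assumes h: "\<And>a b. h (a + b) = h a + h b" "\<And>a b. h (a * b) = h a * h b" "\<And>a. h (h a) = a"
    and endo: "semilin_endo G h \<sigma>" "semilin_endo G h \<tau>"
    and inverse: "\<And>A. A \<in> lie_g G \<Longrightarrow> \<sigma> (\<tau> A) = A" "\<And>A. A \<in> lie_g G \<Longrightarrow> \<tau> (\<sigma> A) = A"
    and bracket: "\<And>A A'. A \<in> lie_g G \<Longrightarrow> A' \<in> lie_g G \<Longrightarrow> \<sigma> (bracket A A') = bracket (\<sigma> A) (\<sigma> A')"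
begin

lemma h_simps: "h 0 = 0" "h 1 = 1" "h (sum f S) = (\<Sum>x\<in>S. h (f x))"
proof -
  show z: "h 0 = 0" using h(1)[of 0 0] by simp
  \<comment> \<open>The number \<open>h 1\<close> is idempotent, and it is nonzero because the
    involution h is injective.\<close>
  have "h 1 * h 1 = h 1" "h 1 \<noteq> 0" using h(2)[of 1 1] h(3)[of 1] z by auto
  then show "h 1 = 1" by simp
  show "h (sum f S) = (\<Sum>x\<in>S. h (f x))"
    by (induction S rule: infinite_finite_induct) (auto simp: h z)
qed

text \<open>Composing semilinear maps multiplies their matrices with one factor twisted by h. The
  first identity is \<sigma> \<tau> = id in coordinates; the second is \<tau> \<sigma> = id after
  applying h to both sides.\<close>

lemma coord_inverse:
  assumes "e \<in> B"
  shows "(\<Sum>b\<in>B. cf (\<sigma> b) c * h (cf (\<tau> e) b)) = (if c = e then 1 else 0)"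
    "(\<Sum>b\<in>B. cf (\<sigma> e) b * h (cf (\<tau> b) c)) = (if c = e then 1 else 0)"
proof -
  have in_g: "\<sigma> e \<in> lie_g G" "\<tau> e \<in> lie_g G" using endo B_sub[OF assms] by (auto simp: semilin_endo_def)
  have "cf (\<sigma> (\<tau> e)) c = (\<Sum>b\<in>B. h (cf (\<tau> e) b) * cf (\<sigma> b) c)"
    by (rule coord_endo[OF endo(1) in_g(2)])
  then show "(\<Sum>b\<in>B. cf (\<sigma> b) c * h (cf (\<tau> e) b)) = (if c = e then 1 else 0)"
    using assms by (simp add: inverse B_sub coord_basis mult.commute)
  have "cf (\<tau> (\<sigma> e)) c = (\<Sum>b\<in>B. h (cf (\<sigma> e) b) * cf (\<tau> b) c)"
    by (rule coord_endo[OF endo(2) in_g(1)])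
  then have "h (if c = e then 1 else 0) = (\<Sum>b\<in>B. cf (\<sigma> e) b * h (cf (\<tau> b) c))"
    using assms by (simp add: inverse B_sub coord_basis h_simps h)
  then show "(\<Sum>b\<in>B. cf (\<sigma> e) b * h (cf (\<tau> b) c)) = (if c = e then 1 else 0)"
    by (auto simp: h_simps split: if_splits)
qed

text \<open>With T = ad A ad A', the product for the images is \<sigma> T \<tau>. Cyclicity of the
  trace removes \<sigma> and \<tau>, but because these are semilinear the trace of T comes out
  twisted by h.\<close>

lemma killing_invariant:
  assumes A: "A \<in> lie_g G" "A' \<in> lie_g G"
  shows "\<kappa> (\<sigma> A) (\<sigma> A') = h (\<kappa> A A')"
proof -
  define T where "T Y = bracket A (bracket A' Y)" for Y
  have T: "semilin_endo G (\<lambda>a. a) T"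
    using semilin_endo_comp[OF semilin_endo_bracket semilin_endo_bracket] A by (simp add: T_def[abs_def])
  then have Tin: "Y \<in> lie_g G \<Longrightarrow> T Y \<in> lie_g G" for Y by (simp add: semilin_endo_def)
  have sT: "semilin_endo G h (\<lambda>Y. \<sigma> (T Y))" using semilin_endo_comp[OF T endo(1)] by simp
  have \<tau>in: "Y \<in> lie_g G \<Longrightarrow> \<tau> Y \<in> lie_g G" for Y using endo by (simp add: semilin_endo_def)
  have "bracket (\<sigma> A) (bracket (\<sigma> A') b) = \<sigma> (T (\<tau> b))" if "b \<in> B" for b
    using that A B_sub[OF that] by (simp add: T_def bracket inverse \<tau>in lie_g_bracket)
  then have "\<kappa> (\<sigma> A) (\<sigma> A') = (\<Sum>b\<in>B. cf (\<sigma> (T (\<tau> b))) b)"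
    by (simp add: killing_def)
  also have "\<dots> = (\<Sum>b\<in>B. \<Sum>c\<in>B. h (cf (\<tau> b) c) * cf (\<sigma> (T c)) b)"
    by (intro sum.cong HOL.refl coord_endo[OF sT] \<tau>in B_sub)
  also have "\<dots> = (\<Sum>b\<in>B. \<Sum>c\<in>B. \<Sum>e\<in>B. h (cf (T c) e) * (cf (\<sigma> e) b * h (cf (\<tau> b) c)))"
    by (intro sum.cong HOL.refl) (simp add: coord_endo[OF endo(1) Tin] B_sub sum_distrib_left ac_simps)
  also have "\<dots> = (\<Sum>c\<in>B. \<Sum>e\<in>B. \<Sum>b\<in>B. h (cf (T c) e) * (cf (\<sigma> e) b * h (cf (\<tau> b) c)))"
    by (subst sum.swap, rule sum.cong[OF HOL.refl], rule sum.swap)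
  also have "\<dots> = (\<Sum>c\<in>B. \<Sum>e\<in>B. if e = c then h (cf (T c) e) else 0)"
    by (intro sum.cong HOL.refl) (auto simp: sum_distrib_left[symmetric] coord_inverse)
  also have "\<dots> = (\<Sum>c\<in>B. h (cf (T c) c))" using finite_B by simp
  finally show ?thesis by (simp add: killing_def h_simps T_def)
qed

text \<open>Expand \<sigma> b in the basis \<open>B\<close> and \<sigma> (d b) in the dual family.
  Invariance of the Killing form makes the second coefficients entries of the twisted matrix of
  \<tau>, so summation over b leaves only the diagonal by \<open>coord_inverse\<close>.\<close>

lemma casimir_invariant:
  assumes \<beta>1: "\<And>A'. A' \<in> lie_g G \<Longrightarrow> semilin G (\<lambda>a. a) s (\<lambda>A. \<beta> A A')"
    and \<beta>2: "\<And>A. A \<in> lie_g G \<Longrightarrow> semilin G (\<lambda>a. a) s (\<lambda>A'. \<beta> A A')"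
    and s: "vector_space s"
  shows "(\<Sum>b\<in>B. \<beta> (\<sigma> b) (\<sigma> (d b))) = (\<Sum>b\<in>B. \<beta> b (d b))"
proof -
  interpret vector_space s by fact
  have in_g: "Y \<in> lie_g G \<Longrightarrow> \<tau> Y \<in> lie_g G" "Y \<in> lie_g G \<Longrightarrow> \<sigma> Y \<in> lie_g G" for Y
    using endo by (simp_all add: semilin_endo_def)
  have "\<beta> (\<sigma> b) (\<sigma> (d b)) = (\<Sum>c\<in>B. \<Sum>e\<in>B. s (cf (\<sigma> b) c * h (cf (\<tau> e) b)) (\<beta> c (d e)))"
    if b: "b \<in> B" for b
  proof -
    \<comment> \<open>Write e = \<sigma> (\<tau> e), move \<sigma> out of the Killing form as the
      twist h, and read the pairing with \<open>d b\<close> as a coordinate.\<close>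
    have k: "\<kappa> e (\<sigma> (d b)) = h (cf (\<tau> e) b)" if "e \<in> B" for e
      using killing_invariant[of "\<tau> e" "d b"] that b by (simp add: inverse in_g B_sub dual_in killing_dual_coord)
    have "\<beta> (\<sigma> b) (\<sigma> (d b)) = (\<Sum>c\<in>B. s (cf (\<sigma> b) c) (\<beta> c (\<sigma> (d b))))"
      using semilin_expand[OF \<beta>1, of "\<sigma> (d b)" "\<sigma> b"] b by (simp add: in_g B_sub dual_in)
    also have "\<dots> = (\<Sum>c\<in>B. s (cf (\<sigma> b) c) (\<Sum>e\<in>B. s (\<kappa> e (\<sigma> (d b))) (\<beta> c (d e))))"
      by (intro sum.cong HOL.refl arg_cong2[of _ _ _ _ s] dual_expand[OF \<beta>2 s]) (use b in \<open>auto simp: in_g B_sub dual_in\<close>)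
    finally show ?thesis by (simp add: k scale_sum_right)
  qed
  then have "(\<Sum>b\<in>B. \<beta> (\<sigma> b) (\<sigma> (d b))) =
      (\<Sum>b\<in>B. \<Sum>c\<in>B. \<Sum>e\<in>B. s (cf (\<sigma> b) c * h (cf (\<tau> e) b)) (\<beta> c (d e)))"
    by simp
  also have "\<dots> = (\<Sum>c\<in>B. \<Sum>e\<in>B. \<Sum>b\<in>B. s (cf (\<sigma> b) c * h (cf (\<tau> e) b)) (\<beta> c (d e)))"
    by (subst sum.swap, rule sum.cong[OF HOL.refl], rule sum.swap)
  also have "\<dots> = (\<Sum>c\<in>B. \<Sum>e\<in>B. if e = c then \<beta> c (d e) else 0)"
    by (intro sum.cong HOL.refl) (auto simp: scale_sum_left[symmetric] coord_inverse)
  also have "\<dots> = (\<Sum>c\<in>B. \<beta> c (d c))" using finite_B by simp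
  finally show ?thesis .
qed

end

end

context lie_dual_basis
begin

text \<open>\<open>mat_star\<close> changes the sign of brackets, so it is not itself an
  automorphism. Invariance is applied to entrywise conjugation instead, and the two minus signs
  cancel because \<beta> is bilinear.\<close>

lemma casimir_star:
  assumes \<beta>1: "\<And>A'. A' \<in> lie_g G \<Longrightarrow> semilin G (\<lambda>a. a) s (\<lambda>A. \<beta> A A')"
    and \<beta>2: "\<And>A. A \<in> lie_g G \<Longrightarrow> semilin G (\<lambda>a. a) s (\<lambda>A'. \<beta> A A')"
    and s: "vector_space s"
  shows "(\<Sum>b\<in>B. \<beta> (mat_star b) (mat_star (d b))) = (\<Sum>b\<in>B. \<beta> b (d b))"
proof -
  interpret vector_space s by fact
  let ?N = "vdim G" and ?\<sigma> = "map_mat cnj"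
  have endo: "semilin_endo G cnj ?\<sigma>"
    unfolding semilin_endo_def
    by (auto simp: lie_g_cnj dest!: lie_g_carrier intro!: mat_eqI[of _ ?N])
  have "(\<Sum>b\<in>B. \<beta> (?\<sigma> b) (?\<sigma> (d b))) = (\<Sum>b\<in>B. \<beta> b (d b))"
  proof (rule casimir_invariant[OF _ _ _ endo endo _ _ _ \<beta>1 \<beta>2 s])
    show "?\<sigma> (bracket A A') = bracket (?\<sigma> A) (?\<sigma> A')" if "A \<in> lie_g G" "A' \<in> lie_g G" for A A'
    proof -
      have c: "A \<in> carrier_mat ?N ?N" "A' \<in> carrier_mat ?N ?N" using that lie_g_carrier by auto
      have m: "(?\<sigma> A * ?\<sigma> A') $$ (i, j) = cnj ((A * A') $$ (i, j))"
        if "i < ?N" "j < ?N" "A \<in> carrier_mat ?N ?N" "A' \<in> carrier_mat ?N ?N" for i j A A'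
        using that mat_mult_entry[of "?\<sigma> A" ?N "?\<sigma> A'" i j] mat_mult_entry[of A ?N A' i j] by simp
      show ?thesis using c unfolding bracket_def
        by (intro mat_eqI[of _ ?N]) (auto simp: m minus_carrier_mat[of _ ?N] simp del: index_mult_mat(1))
    qed
  qed (auto dest!: lie_g_carrier intro!: mat_eqI[of _ ?N])
  moreover have "\<beta> (mat_star b) (mat_star (d b)) = \<beta> (?\<sigma> b) (?\<sigma> (d b))" if "b \<in> B" for b
  proof -
    have g: "?\<sigma> b \<in> lie_g G" "?\<sigma> (d b) \<in> lie_g G" "mat_star (d b) \<in> lie_g G" using that
      by (simp_all add: B_sub dual_in lie_g_cnj lie_g_mat_star)
    have "\<beta> (mat_star b) (mat_star (d b)) = s (- 1) (\<beta> (?\<sigma> b) (mat_star (d b)))"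
      using \<beta>1[OF g(3)] g(1) unfolding mat_star_smult[of b] semilin_def by blast
    also have "\<beta> (?\<sigma> b) (mat_star (d b)) = s (- 1) (\<beta> (?\<sigma> b) (?\<sigma> (d b)))"
      using \<beta>2[OF g(1)] g(2) unfolding mat_star_smult[of "d b"] semilin_def by blast
    finally show ?thesis by simp
  qed
  ultimately show ?thesis by simp
qed

text \<open>Here h is the identity, and the inverse of conjugation by g is conjugation by g^T, since
  g is orthogonal.\<close>

lemma casimir_conjugate:
  assumes g: "g \<in> grp_K G"
    and \<beta>1: "\<And>A'. A' \<in> lie_g G \<Longrightarrow> semilin G (\<lambda>a. a) s (\<lambda>A. \<beta> A A')"
    and \<beta>2: "\<And>A. A \<in> lie_g G \<Longrightarrow> semilin G (\<lambda>a. a) s (\<lambda>A'. \<beta> A A')"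
    and s: "vector_space s"
  shows "(\<Sum>b\<in>B. \<beta> (g * b * transpose_mat g) (g * d b * transpose_mat g)) = (\<Sum>b\<in>B. \<beta> b (d b))"
proof -
  let ?N = "vdim G" and ?t = transpose_mat
  note as = mult_assoc_n[of _ ?N] and cr = mult_carrier_n[of _ ?N]
  have endo: "semilin_endo G (\<lambda>a. a) (\<lambda>A. g * A * ?t g)" if g: "g \<in> grp_K G" for g
    unfolding semilin_endo_def
    using grp_K_facts(1)[OF g] lie_g_conjugate[OF g]
    by (auto dest!: lie_g_carrier simp: cr mult_add_distrib_mat[of _ ?N ?N _ ?N] add_mult_distrib_mat[of _ ?N ?N _ _ ?N]
        mult_smult_distrib[of _ ?N ?N _ ?N] mult_smult_assoc_mat[of _ ?N ?N _ ?N])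
  have inv: "g * (?t g * M) = M" "?t g * (g * M) = M"
    if g: "g \<in> grp_K G" and M: "M \<in> carrier_mat ?N ?N" for g M
    using grp_K_facts[OF g] M by (simp_all add: as[symmetric])
  note gf = grp_K_facts[OF g]
  show ?thesis
  proof (rule casimir_invariant[OF _ _ _ endo[OF g] endo[OF gf(8)] _ _ _ \<beta>1 \<beta>2 s])
    fix A A' assume "A \<in> lie_g G" "A' \<in> lie_g G"
    then have c: "A \<in> carrier_mat ?N ?N" "A' \<in> carrier_mat ?N ?N" using lie_g_carrier by auto
    show "g * (?t g * A * ?t (?t g)) * ?t g = A" "?t g * (g * A * ?t g) * ?t (?t g) = A"
      using c gf by (simp_all add: as cr inv g)
    show "g * bracket A A' * ?t g = bracket (g * A * ?t g) (g * A' * ?t g)"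
      using c gf(1) unfolding bracket_def
      by (simp add: as cr mult_minus_distrib_mat[of _ ?N ?N _ ?N] minus_mult_distrib_mat[of _ ?N ?N _ _ ?N] inv g
          minus_carrier_mat[of _ ?N])
  qed auto
qed

end

section \<open>The commutant of the noncompact part\<close>

text \<open>For l \<noteq> m this is E_lm + E_ml in terms of matrix units.\<close>

definition sym_pair :: "nat \<Rightarrow> nat \<Rightarrow> nat \<Rightarrow> complex mat" where
  "sym_pair N l m = mat N N (\<lambda>(x, y). if x = l \<and> y = m \<or> x = m \<and> y = l then 1 else 0)"

lemma sym_pair_carrier [simp]: "sym_pair N l m \<in> carrier_mat N N"
  by (simp add: sym_pair_def)

lemma sym_pair_sum:
  assumes "l < N" "m < N" "l \<noteq> m" "x < N"
  shows "(\<Sum>c<N. sym_pair N l m $$ (x, c) * f c) = (if x = l then f m else if x = m then f l else 0)"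
    "(\<Sum>c<N. f c * sym_pair N l m $$ (x, c)) = (if x = l then f m else if x = m then f l else 0)"
    "(\<Sum>c<N. sym_pair N l m $$ (c, x) * f c) = (if x = l then f m else if x = m then f l else 0)"
    "(\<Sum>c<N. f c * sym_pair N l m $$ (c, x)) = (if x = l then f m else if x = m then f l else 0)"
proof -
  have "(\<Sum>c<N. sym_pair N l m $$ (x, c) * f c) =
      (\<Sum>c<N. if c = m then if x = l then f c else 0 else if c = l then if x = m then f c else 0 else 0)"
    using assms by (intro sum.cong) (auto simp: sym_pair_def)
  also have "\<dots> = (\<Sum>c\<in>{l, m}. if c = m then if x = l then f c else 0 else if c = l then if x = m then f c else 0 else 0)"
    using assms by (intro sum.mono_neutral_right) auto
  finally show 1: "(\<Sum>c<N. sym_pair N l m $$ (x, c) * f c) = (if x = l then f m else if x = m then f l else 0)"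
    using assms by auto
  have "sym_pair N l m $$ (c, x) = sym_pair N l m $$ (x, c)" if "c < N" for c
    using assms that by (auto simp: sym_pair_def)
  then show "(\<Sum>c<N. f c * sym_pair N l m $$ (x, c)) = (if x = l then f m else if x = m then f l else 0)"
    "(\<Sum>c<N. sym_pair N l m $$ (c, x) * f c) = (if x = l then f m else if x = m then f l else 0)"
    "(\<Sum>c<N. f c * sym_pair N l m $$ (c, x)) = (if x = l then f m else if x = m then f l else 0)"
    using 1 by (simp_all add: mult.commute)
qed

lemma lie_p0_entries: "A \<in> lie_p0 G \<longleftrightarrow> lie_entries G A \<and>
    (\<forall>a<vdim G. \<forall>b<vdim G. A $$ (a, b) \<in> \<real> \<and> A $$ (b, a) = A $$ (a, b))"
proof -
  have "transpose_mat A = A \<longleftrightarrow> (\<forall>a<vdim G. \<forall>b<vdim G. A $$ (b, a) = A $$ (a, b))"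
    if A: "A \<in> carrier_mat (vdim G) (vdim G)"
  proof
    assume t: "transpose_mat A = A"
    show "\<forall>a<vdim G. \<forall>b<vdim G. A $$ (b, a) = A $$ (a, b)"
    proof (intro allI impI)
      fix a b assume "a < vdim G" "b < vdim G"
      then show "A $$ (b, a) = A $$ (a, b)" using A arg_cong[OF t, of "\<lambda>M. M $$ (a, b)"] by simp
    qed
  next
    assume "\<forall>a<vdim G. \<forall>b<vdim G. A $$ (b, a) = A $$ (a, b)"
    then show "transpose_mat A = A" using A by (intro mat_eqI[of _ "vdim G"]) auto
  qed
  then show ?thesis unfolding lie_p0_iff lie_g0_entries lie_entries_def by blast
qed

text \<open>The index l lies in the positive block and m in the negative one: the noncompact part of
  the orthogonal Lie algebra is the off-diagonal block.\<close>

lemma sym_pair_O: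
  assumes "l < p" "p \<le> m" "m < p + q" shows "sym_pair (p + q) l m \<in> lie_p0 (O_real p q)"
  unfolding lie_p0_entries lie_entries_def using assms
  by (auto simp: sym_pair_sum gram_O_entry simp del: gram.simps) (auto simp: sym_pair_def)

lemma add_mat_sum:
  assumes "A \<in> carrier_mat n n" "B \<in> carrier_mat n n" "x < n"
  shows "(\<Sum>c<n. (A + B) $$ (x, c) * f c) = (\<Sum>c<n. A $$ (x, c) * f c) + (\<Sum>c<n. B $$ (x, c) * (f c :: complex))"
    "(\<Sum>c<n. f c * (A + B) $$ (x, c)) = (\<Sum>c<n. f c * A $$ (x, c)) + (\<Sum>c<n. f c * B $$ (x, c))"
    "(\<Sum>c<n. (A + B) $$ (c, x) * f c) = (\<Sum>c<n. A $$ (c, x) * f c) + (\<Sum>c<n. B $$ (c, x) * f c)"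
    "(\<Sum>c<n. f c * (A + B) $$ (c, x)) = (\<Sum>c<n. f c * A $$ (c, x)) + (\<Sum>c<n. f c * B $$ (c, x))"
  using assms by (simp_all add: ring_distribs flip: sum.distrib)

lemma gram_Sp_sum:
  assumes "b < n"
  shows "(\<Sum>c<2 * n. f c * gram (Sp_real n) $$ (c, b)) = - f (n + b)"
    "(\<Sum>c<2 * n. f c * gram (Sp_real n) $$ (c, n + b)) = f b"
    "(\<Sum>c<2 * n. gram (Sp_real n) $$ (b, c) * f c) = f (n + b)"
    "(\<Sum>c<2 * n. gram (Sp_real n) $$ (n + b, c) * f c) = - f b"
proof -
  have "(\<Sum>c<2 * n. f c * gram (Sp_real n) $$ (c, b)) = (\<Sum>c<2 * n. if c = n + b then - f c else 0)"
    "(\<Sum>c<2 * n. f c * gram (Sp_real n) $$ (c, n + b)) = (\<Sum>c<2 * n. if c = b then f c else 0)"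
    "(\<Sum>c<2 * n. gram (Sp_real n) $$ (b, c) * f c) = (\<Sum>c<2 * n. if c = n + b then f c else 0)"
    "(\<Sum>c<2 * n. gram (Sp_real n) $$ (n + b, c) * f c) = (\<Sum>c<2 * n. if c = b then - f c else 0)"
    using assms by (intro sum.cong; auto simp: gram_Sp_entry simp del: gram.simps)+
  then show "(\<Sum>c<2 * n. f c * gram (Sp_real n) $$ (c, b)) = - f (n + b)"
    "(\<Sum>c<2 * n. f c * gram (Sp_real n) $$ (c, n + b)) = f b"
    "(\<Sum>c<2 * n. gram (Sp_real n) $$ (b, c) * f c) = f (n + b)"
    "(\<Sum>c<2 * n. gram (Sp_real n) $$ (n + b, c) * f c) = - f b"
    using assms by simp_all
qed

lemma less_double_cases:
  assumes "a < 2 * (n :: nat)"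
  obtains "a < n" | b where "a = n + b" "b < n"
  using assms by (metis add_less_cancel_left le_Suc_ex mult_2 not_less)

text \<open>In blocks of size n the hypotheses describe the matrices [[S, T], [T, -S]] with S and T
  real symmetric, which make up the noncompact part in the symplectic case.\<close>

lemma lie_p0_SpI:
  assumes A: "A \<in> carrier_mat (2 * n) (2 * n)"
    and real: "\<And>a b. a < 2 * n \<Longrightarrow> b < 2 * n \<Longrightarrow> A $$ (a, b) \<in> \<real> \<and> A $$ (b, a) = A $$ (a, b)"
    and block: "\<And>a b. a < n \<Longrightarrow> b < n \<Longrightarrow> A $$ (n + b, n + a) = - A $$ (a, b) \<and> A $$ (n + a, b) = A $$ (n + b, a)"
  shows "A \<in> lie_p0 (Sp_real n)"
proof -
  have "(\<Sum>c<2 * n. A $$ (c, a) * gram (Sp_real n) $$ (c, b)) +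
     (\<Sum>c<2 * n. gram (Sp_real n) $$ (a, c) * A $$ (c, b)) = 0" if ab: "a < 2 * n" "b < 2 * n" for a b
    by (rule less_double_cases[OF ab(1)]; rule less_double_cases[OF ab(2)])
      (use block real ab in \<open>auto simp: gram_Sp_sum simp del: gram.simps\<close>)
  then show ?thesis using A real unfolding lie_p0_entries lie_entries_def by simp
qed

lemma sym_pair_Sp:
  assumes "i < n" shows "sym_pair (2 * n) i (n + i) \<in> lie_p0 (Sp_real n)"
  using assms by (intro lie_p0_SpI) (auto simp: sym_pair_def)

lemma sym_pair_sum_Sp:
  assumes "i < n" "j < n" "i \<noteq> j"
  shows "sym_pair (2 * n) i (n + j) + sym_pair (2 * n) j (n + i) \<in> lie_p0 (Sp_real n)"
  using assms by (intro lie_p0_SpI) (auto simp: sym_pair_def)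

text \<open>The block matrix with S = E_ii and T = 0.\<close>

definition diag_pair :: "nat \<Rightarrow> nat \<Rightarrow> complex mat" where
  "diag_pair n i = mat (2 * n) (2 * n) (\<lambda>(x, y). if x = y then if x = i then 1 else if x = n + i then - 1 else 0 else 0)"

lemma diag_pair_sum:
  assumes "x < 2 * n"
  shows "(\<Sum>c<2 * n. diag_pair n i $$ (x, c) * f c) = (if x = i then f x else if x = n + i then - f x else 0)"
    "(\<Sum>c<2 * n. f c * diag_pair n i $$ (x, c)) = (if x = i then f x else if x = n + i then - f x else 0)"
    "(\<Sum>c<2 * n. diag_pair n i $$ (c, x) * f c) = (if x = i then f x else if x = n + i then - f x else 0)"
    "(\<Sum>c<2 * n. f c * diag_pair n i $$ (c, x)) = (if x = i then f x else if x = n + i then - f x else 0)"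
proof -
  have "(\<Sum>c<2 * n. diag_pair n i $$ (x, c) * f c) =
      (\<Sum>c<2 * n. if c = x then if x = i then f x else if x = n + i then - f x else 0 else 0)"
    using assms by (intro sum.cong) (auto simp: diag_pair_def)
  then show 1: "(\<Sum>c<2 * n. diag_pair n i $$ (x, c) * f c) = (if x = i then f x else if x = n + i then - f x else 0)"
    using assms by simp
  have "diag_pair n i $$ (c, x) = diag_pair n i $$ (x, c)" if "c < 2 * n" for c
    using assms that by (auto simp: diag_pair_def)
  then show "(\<Sum>c<2 * n. f c * diag_pair n i $$ (x, c)) = (if x = i then f x else if x = n + i then - f x else 0)"
    "(\<Sum>c<2 * n. diag_pair n i $$ (c, x) * f c) = (if x = i then f x else if x = n + i then - f x else 0)"
    "(\<Sum>c<2 * n. f c * diag_pair n i $$ (c, x)) = (if x = i then f x else if x = n + i then - f x else 0)"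
    using 1 by (simp_all add: mult.commute)
qed

lemma diag_pair_Sp:
  assumes "i < n" shows "diag_pair n i \<in> lie_p0 (Sp_real n)"
  using assms by (intro lie_p0_SpI) (auto simp: diag_pair_def)

text \<open>Multiplication by E_lm + E_ml exchanges rows, respectively columns, l and m and deletes
  all others. Comparing entries of the two products gives both claims.\<close>

lemma commute_sym_pair:
  fixes M :: "nat \<Rightarrow> nat \<Rightarrow> complex"
  assumes lm: "l < N" "m < N" "l \<noteq> m"
    and comm: "\<And>x y. x < N \<Longrightarrow> y < N \<Longrightarrow> (\<Sum>c<N. sym_pair N l m $$ (x, c) * M c y) = (\<Sum>c<N. M x c * sym_pair N l m $$ (c, y))"
  shows "M l l = M m m"
    "x < N \<Longrightarrow> x \<noteq> l \<Longrightarrow> x \<noteq> m \<Longrightarrow> M x l = 0 \<and> M x m = 0 \<and> M l x = 0 \<and> M m x = 0"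
  using comm[of l m] comm[of x l] comm[of x m] comm[of l x] comm[of m x] lm
  by (auto simp: sym_pair_sum split: if_splits)

text \<open>Schur's lemma for V by explicit elements of the noncompact part. Each swap matrix
  isolates a pair of indices and equates two diagonal entries of M; what a swap leaves coupled
  inside its pair is separated by another element, whose existence is where rank and parity
  enter.\<close>

lemma p0_commutant:
  fixes M :: "nat \<Rightarrow> nat \<Rightarrow> complex"
  assumes G: "(\<exists>n. G = Sp_real n) \<or> (\<exists>n p q. G = O_real p q \<and> q = min p q \<and> p + q = 2 * n + 1)"
    and rank: "1 \<le> real_rank G"
    and comm: "\<And>A x y. A \<in> lie_p0 G \<Longrightarrow> x < vdim G \<Longrightarrow> y < vdim G \<Longrightarrow>
      (\<Sum>c<vdim G. A $$ (x, c) * M c y) = (\<Sum>c<vdim G. M x c * A $$ (c, y))"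
  shows "\<exists>r. \<forall>x<vdim G. \<forall>y<vdim G. M x y = (if x = y then r else 0)"
proof (cases G)
  case (Sp_real n)
  then have n: "0 < n" using rank by simp
  have pair: "M i i = M (n + i) (n + i)"
    "x < 2 * n \<Longrightarrow> x \<noteq> i \<Longrightarrow> x \<noteq> n + i \<Longrightarrow> M x i = 0 \<and> M x (n + i) = 0" if i: "i < n" for i x
  proof -
    have c: "(\<Sum>c<2 * n. sym_pair (2 * n) i (n + i) $$ (x, c) * M c y) =
        (\<Sum>c<2 * n. M x c * sym_pair (2 * n) i (n + i) $$ (c, y))" if "x < 2 * n" "y < 2 * n" for x y
      using comm[OF sym_pair_Sp[OF i, folded Sp_real], of x y] that by (simp add: Sp_real)
    have l: "i < 2 * n" "n + i < 2 * n" "i \<noteq> n + i" using i by auto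
    show "M i i = M (n + i) (n + i)"
      by (rule commute_sym_pair(1)[OF l c])
    show "M x i = 0 \<and> M x (n + i) = 0" if "x < 2 * n" "x \<noteq> i" "x \<noteq> n + i"
      using commute_sym_pair(2)[OF l c that] by blast
  qed
  \<comment> \<open>A swap of i and n + i says nothing about the entries of M that couple these two
    indices. The diagonal element has eigenvalues 1 and -1 there and forces them to vanish.\<close>
  have diag: "M i (n + i) = 0" "M (n + i) i = 0" if "i < n" for i
    using comm[OF diag_pair_Sp[OF that, folded Sp_real], of i "n + i"]
      comm[OF diag_pair_Sp[OF that, folded Sp_real], of "n + i" i] that
    by (auto simp: Sp_real diag_pair_sum)
  \<comment> \<open>The swaps act inside the pairs i, n + i; an element with T = E_i0 + E_0i links
    the pair of i to the pair of 0.\<close>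
  have eq: "M i i = M 0 0" if "i < n" for i
  proof (cases "i = 0")
    case False
    have "(\<Sum>c<2 * n. (sym_pair (2 * n) i n + sym_pair (2 * n) 0 (n + i)) $$ (i, c) * M c n) =
        (\<Sum>c<2 * n. M i c * (sym_pair (2 * n) i n + sym_pair (2 * n) 0 (n + i)) $$ (c, n))"
      using comm[of "sym_pair (2 * n) i n + sym_pair (2 * n) 0 (n + i)" i n]
        sym_pair_sum_Sp[OF that n False] that n by (simp add: Sp_real)
    then have "M n n = M i i" using False that n by (simp add: add_mat_sum sym_pair_sum del: index_add_mat(1))
    then show ?thesis using pair(1)[of 0] n by simp
  qed simp
  have "M x y = (if x = y then M 0 0 else 0)" if "x < 2 * n" "y < 2 * n" for x y
    using that(2)
  proof (cases rule: less_double_cases)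
    case 1
    then show ?thesis using pair(2)[of y x] diag[of y] eq[of y] that by auto
  next
    case (2 i)
    then show ?thesis using pair(1)[of i] pair(2)[of i x] diag[of i] eq[of i] that by auto
  qed
  then have "\<forall>x<vdim G. \<forall>y<vdim G. M x y = (if x = y then M 0 0 else 0)"
    by (simp add: Sp_real)
  then show ?thesis by blast
next
  case (O_real p q)
  obtain n where n: "q = min p q" "p + q = 2 * n + 1" using G unfolding O_real by blast
  moreover have "1 \<le> q" using rank n(1) unfolding O_real by simp
  \<comment> \<open>With 1 \<le> q \<le> p, oddness of p + q excludes p = q = 1.\<close>
  ultimately have q: "0 < q" "q \<le> p" "2 \<le> p" by presburger+
  have pair: "M l l = M m m"
    "x < p + q \<Longrightarrow> x \<noteq> l \<Longrightarrow> x \<noteq> m \<Longrightarrow> M x l = 0 \<and> M x m = 0 \<and> M l x = 0 \<and> M m x = 0"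
    if lm: "l < p" "p \<le> m" "m < p + q" for l m x
  proof -
    have c: "(\<Sum>c<p + q. sym_pair (p + q) l m $$ (x, c) * M c y) =
        (\<Sum>c<p + q. M x c * sym_pair (p + q) l m $$ (c, y))" if "x < p + q" "y < p + q" for x y
      using comm[OF sym_pair_O[OF lm, folded O_real], of x y] that by (simp add: O_real)
    have l: "l < p + q" "m < p + q" "l \<noteq> m" using lm by auto
    show "M l l = M m m"
      by (rule commute_sym_pair(1)[OF l c])
    show "M x l = 0 \<and> M x m = 0 \<and> M l x = 0 \<and> M m x = 0" if "x < p + q" "x \<noteq> l" "x \<noteq> m"
      using commute_sym_pair(2)[OF l c that] by blast
  qed
  have eq: "M x x = M p p" if "x < p + q" for x
    using pair(1)[of x p] pair(1)[of 0 x] pair(1)[of 0 p] that q by (cases "x < p") auto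
  \<comment> \<open>Because p \<ge> 2, a swap through the positive block can avoid a prescribed
    index, here the other index of an off-diagonal entry.\<close>
  have ex: "\<exists>l<p. l \<noteq> z" for z
    by (rule exI[of _ "if z = 0 then 1 else 0"]) (use q in auto)
  have "M x y = 0" if "x < p + q" "y < p + q" "x \<noteq> y" for x y
  proof -
    consider "x < p" "y < p" | "p \<le> y" | "p \<le> x" "y < p" by linarith
    then show "M x y = 0"
    proof cases
      case 1
      then show ?thesis using pair(2)[of y p x] that q by simp
    next
      case 2
      obtain l where "l < p" "l \<noteq> x" using ex by blast
      then show ?thesis using pair(2)[of l y x] that 2 by simp
    next
      case 3
      obtain l where "l < p" "l \<noteq> y" using ex by blast
      then show ?thesis using pair(2)[of l x y] that 3 by simp
    qed
  qed
  then have "\<forall>x<vdim G. \<forall>y<vdim G. M x y = (if x = y then M p p else 0)"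
    using eq by (simp add: O_real)
  then show ?thesis by blast
qed

section \<open>The form on the defining module and the projection onto invariants\<close>

lemma hermitian_form_expand:
  assumes f: "hermitian_form (carrier_vec n) (+) (\<cdot>\<^sub>v) f" and v: "v \<in> carrier_vec n" and w: "w \<in> carrier_vec n"
  shows "f v w = (\<Sum>c<n. v $ c * f (unit_vec n c) w)" "f w v = (\<Sum>c<n. cnj (v $ c) * f w (unit_vec n c))"
proof -
  \<comment> \<open>Truncations of v; passing from m to m + 1 adds one multiple of a unit
    vector.\<close>
  define u where "u m = vec n (\<lambda>i. if i < m then v $ i else 0)" for m
  have uc: "u m \<in> carrier_vec n" for m by (simp add: u_def)
  have "f (u m) w = (\<Sum>c<m. v $ c * f (unit_vec n c) w) \<and> f w (u m) = (\<Sum>c<m. cnj (v $ c) * f w (unit_vec n c))"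
    if "m \<le> n" for m
    using that
  proof (induction m)
    case 0
    have "u 0 + u 0 = u 0" by (auto simp: u_def)
    moreover have "f (u 0 + u 0) w = f (u 0) w + f (u 0) w" "f w (u 0 + u 0) = f w (u 0) + f w (u 0)"
      using f uc w unfolding hermitian_form_def by blast+
    ultimately show ?case by simp
  next
    case (Suc m)
    have "u (Suc m) = u m + v $ m \<cdot>\<^sub>v unit_vec n m"
      using Suc.prems by (intro eq_vecI) (auto simp: u_def less_Suc_eq)
    moreover have "f (u m + v $ m \<cdot>\<^sub>v unit_vec n m) w = f (u m) w + f (v $ m \<cdot>\<^sub>v unit_vec n m) w"
      "f w (u m + v $ m \<cdot>\<^sub>v unit_vec n m) = f w (u m) + f w (v $ m \<cdot>\<^sub>v unit_vec n m)"
      using f uc w unfolding hermitian_form_def by (meson smult_carrier_vec unit_vec_carrier)+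
    moreover have "f (v $ m \<cdot>\<^sub>v unit_vec n m) w = v $ m * f (unit_vec n m) w"
      "f w (v $ m \<cdot>\<^sub>v unit_vec n m) = cnj (v $ m) * f w (unit_vec n m)"
      using f w unfolding hermitian_form_def by (meson unit_vec_carrier)+
    ultimately show ?case using Suc by simp
  qed
  moreover have "u n = v" using v by (auto simp: u_def)
  ultimately show "f v w = (\<Sum>c<n. v $ c * f (unit_vec n c) w)" "f w v = (\<Sum>c<n. cnj (v $ c) * f w (unit_vec n c))"
    by (metis order_refl)+
qed

lemma real_rank_vdim: "1 \<le> real_rank G \<Longrightarrow> 0 < vdim G"
  by (cases G) auto

text \<open>For A real and symmetric, self-adjointness of A says exactly that the matrix of values
  f(e_x, e_y) commutes with A. The resulting scalar is the value at e_0, positive by definiteness;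
  positive rank guarantees that e_0 exists.\<close>

lemma V_form_diagonal:
  assumes G: "(\<exists>n. G = Sp_real n) \<or> (\<exists>n p q. G = O_real p q \<and> q = min p q \<and> p + q = 2 * n + 1)"
    and rank: "1 \<le> real_rank G" and V: "V_bullet_unitary G f"
  obtains r :: real where "0 < r"
    "\<And>a b. a < vdim G \<Longrightarrow> b < vdim G \<Longrightarrow> f (unit_vec (vdim G) a) (unit_vec (vdim G) b) = (if a = b then of_real r else 0)"
proof -
  let ?N = "vdim G"
  let ?e = "unit_vec ?N"
  have herm: "hermitian_form (carrier_vec ?N) (+) (\<cdot>\<^sub>v) f"
    and pd: "positive_definite (carrier_vec ?N) (0\<^sub>v ?N) f"
    and p: "\<And>A v w. A \<in> lie_p0 G \<Longrightarrow> v \<in> carrier_vec ?N \<Longrightarrow> w \<in> carrier_vec ?N \<Longrightarrow> f (A *\<^sub>v v) w = f v (A *\<^sub>v w)"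
    using V unfolding V_bullet_unitary_def by blast+
  have "\<exists>r. \<forall>x<?N. \<forall>y<?N. f (?e x) (?e y) = (if x = y then r else 0)"
  proof (rule p0_commutant[OF G rank])
    fix A x y assume A: "A \<in> lie_p0 G" and xy: "x < ?N" "y < ?N"
    have c: "A \<in> carrier_mat ?N ?N" and s: "\<And>a b. a < ?N \<Longrightarrow> b < ?N \<Longrightarrow> cnj (A $$ (a, b)) = A $$ (a, b) \<and> A $$ (b, a) = A $$ (a, b)"
      using A by (auto simp: lie_p0_entries lie_entries_def Reals_cnj_iff)
    have col: "A *\<^sub>v ?e z \<in> carrier_vec ?N" "\<And>i. i < ?N \<Longrightarrow> (A *\<^sub>v ?e z) $ i = A $$ (i, z)" if "z < ?N" for z
      using c that by (auto simp: scalar_prod_right_unit row_def)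
    have "f (A *\<^sub>v ?e x) (?e y) = (\<Sum>c<?N. A $$ (x, c) * f (?e c) (?e y))"
      unfolding hermitian_form_expand(1)[OF herm col(1)[OF xy(1)] unit_vec_carrier]
      by (intro sum.cong HOL.refl) (use col(2)[OF xy(1)] s xy in simp)
    moreover have "f (?e x) (A *\<^sub>v ?e y) = (\<Sum>c<?N. f (?e x) (?e c) * A $$ (c, y))"
      unfolding hermitian_form_expand(2)[OF herm col(1)[OF xy(2)] unit_vec_carrier]
      by (intro sum.cong HOL.refl) (use col(2)[OF xy(2)] s xy in simp)
    ultimately show "(\<Sum>c<?N. A $$ (x, c) * f (?e c) (?e y)) = (\<Sum>c<?N. f (?e x) (?e c) * A $$ (c, y))"
      using p[OF A, of "?e x" "?e y"] by simp
  qed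
  then obtain r where r: "\<And>x y. x < ?N \<Longrightarrow> y < ?N \<Longrightarrow> f (?e x) (?e y) = (if x = y then r else 0)" by blast
  have N: "0 < ?N" using real_rank_vdim[OF rank] .
  have "?e 0 $ 0 \<noteq> 0\<^sub>v ?N $ 0" using N by simp
  then have "?e 0 \<noteq> 0\<^sub>v ?N" by metis
  then have "Im (f (?e 0) (?e 0)) = 0" "0 < Re (f (?e 0) (?e 0))"
    using pd unfolding positive_definite_def by auto
  then have "r = of_real (Re r)" "0 < Re r" using r[OF N N] by (auto simp: complex_eq_iff)
  then show ?thesis using that[of "Re r"] r by metis
qed

lemma mindex_nth: "I \<in> mindex N k \<Longrightarrow> j < k \<Longrightarrow> I ! j < N"
  unfolding mindex_def using nth_mem by fastforce

lemma finite_mindex: "finite (mindex N k)"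
  unfolding mindex_def using finite_lists_length_eq[of "{..<N}" k] by (simp add: conj_commute)

lemma tensor_form_diagonal:
  assumes f: "\<And>a b. a < N \<Longrightarrow> b < N \<Longrightarrow> fV (unit_vec N a) (unit_vec N b) = (if a = b then r else 0)"
  shows "tensor_form N k fX fV u v = r ^ k * (\<Sum>I\<in>mindex N k. fX (u I) (v I))"
proof -
  note fin = finite_mindex[of N k]
  have "(\<Prod>j<k. fV (unit_vec N (I ! j)) (unit_vec N (J ! j))) = (if I = J then r ^ k else 0)"
    if I: "I \<in> mindex N k" and J: "J \<in> mindex N k" for I J
  proof -
    have IJ: "I ! j < N \<and> J ! j < N" if "j < k" for j
      using mindex_nth I J that by blast
    show ?thesis
    proof (cases "I = J")
      case True then show ?thesis using f IJ by simp
    next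
      case False
      then obtain j where "j < k" "I ! j \<noteq> J ! j" using I J by (auto simp: mindex_def list_eq_iff_nth_eq)
      then have "\<exists>j\<in>{..<k}. fV (unit_vec N (I ! j)) (unit_vec N (J ! j)) = 0" using f IJ by auto
      then show ?thesis using False by (simp add: prod_zero)
    qed
  qed
  then have "tensor_form N k fX fV u v = (\<Sum>I\<in>mindex N k. \<Sum>J\<in>mindex N k. if J = I then r ^ k * fX (u I) (v I) else 0)"
    unfolding tensor_form_def by (intro sum.cong HOL.refl) auto
  then show ?thesis using fin by (simp add: sum_distrib_left)
qed

text \<open>The equation says that u, viewed as a tensor in V \<otimes> V, is annihilated by
  symmetric A. Since J also anticommutes with A, the product J u commutes with it and is a scalar;
  multiplying by J once more makes u a multiple of J.\<close>

lemma p0_anticommutant: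
  fixes u :: "nat \<Rightarrow> nat \<Rightarrow> complex"
  assumes G: "(\<exists>n. G = Sp_real n) \<or> (\<exists>n p q. G = O_real p q \<and> q = min p q \<and> p + q = 2 * n + 1)"
    and rank: "1 \<le> real_rank G"
    and anti: "\<And>A x y. A \<in> lie_p0 G \<Longrightarrow> x < vdim G \<Longrightarrow> y < vdim G \<Longrightarrow>
      (\<Sum>c<vdim G. A $$ (x, c) * u c y) + (\<Sum>c<vdim G. u x c * A $$ (c, y)) = 0"
  shows "\<exists>r. \<forall>x<vdim G. \<forall>y<vdim G. u x y = r * gram G $$ (x, y)"
proof -
  let ?N = "vdim G" and ?J = "gram G"
  define U where "U = mat ?N ?N (\<lambda>(x, y). u x y)"
  note as = mult_assoc_n[of _ ?N] and cr = mult_carrier_n[of _ ?N]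
  have Uc: "U \<in> carrier_mat ?N ?N" by (simp add: U_def)
  have comm: "A * (?J * U) = ?J * U * A" if A: "A \<in> lie_p0 G" for A
  proof -
    have c: "A \<in> carrier_mat ?N ?N" and t: "transpose_mat A = A" and g: "A \<in> lie_g0 G"
      using A by (auto simp: lie_p0_iff lie_g0_entries lie_entries_def)
    have neg: "M = - M'" if "M + M' = 0\<^sub>m ?N ?N" "M \<in> carrier_mat ?N ?N" "M' \<in> carrier_mat ?N ?N" for M M' :: "complex mat"
    proof (rule mat_eqI[of _ ?N])
      fix a b assume "a < ?N" "b < ?N"
      moreover from this have "(M + M') $$ (a, b) = 0" unfolding that(1) by simp
      ultimately show "M $$ (a, b) = (- M') $$ (a, b)"
        using that(2,3) by (simp add: eq_neg_iff_add_eq_0)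
    qed (use that in auto)
    have AJ: "A * ?J = - (?J * A)"
      using g t c by (intro neg) (auto simp: lie_g0_def cr)
    have "A * U + U * A = 0\<^sub>m ?N ?N"
    proof (rule mat_eqI[of _ ?N])
      fix a b assume ab: "a < ?N" "b < ?N"
      then show "(A * U + U * A) $$ (a, b) = 0\<^sub>m ?N ?N $$ (a, b)"
        using anti[OF A ab] mat_mult_entry[OF c Uc ab] mat_mult_entry[OF Uc c ab] c Uc
        by (simp add: U_def del: index_mult_mat(1))
    qed (use c Uc in \<open>auto simp: cr\<close>)
    then have AU: "A * U = - (U * A)" using c Uc by (intro neg) (auto simp: cr)
    have "A * (?J * U) = A * ?J * U" using c Uc by (simp add: as)
    also have "\<dots> = - (?J * (A * U))" unfolding AJ using c Uc by (simp add: as)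
    also have "\<dots> = ?J * U * A" unfolding AU using c Uc by (simp add: as cr)
    finally show ?thesis .
  qed
  have JU: "?J * U \<in> carrier_mat ?N ?N" using Uc by (simp add: cr)
  have "\<exists>r. \<forall>x<?N. \<forall>y<?N. (?J * U) $$ (x, y) = (if x = y then r else 0)"
  proof (rule p0_commutant[OF G rank])
    fix A x y assume A: "A \<in> lie_p0 G" and xy: "x < ?N" "y < ?N"
    have c: "A \<in> carrier_mat ?N ?N" using A by (auto simp: lie_p0_iff lie_g0_entries lie_entries_def)
    show "(\<Sum>c<?N. A $$ (x, c) * (?J * U) $$ (c, y)) = (\<Sum>c<?N. (?J * U) $$ (x, c) * A $$ (c, y))"
      using mat_mult_entry[OF c JU xy] mat_mult_entry[OF JU c xy] comm[OF A] by metis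
  qed
  then obtain r where "\<And>x y. x < ?N \<Longrightarrow> y < ?N \<Longrightarrow> (?J * U) $$ (x, y) = (if x = y then r else 0)" by blast
  then have r: "?J * U = r \<cdot>\<^sub>m 1\<^sub>m ?N" using JU by (intro mat_eqI[of _ ?N]) auto
  have "?J * (?J * U) = r \<cdot>\<^sub>m ?J" unfolding r by (simp add: mult_smult_distrib[of _ ?N ?N _ ?N])
  moreover have "?J * (?J * U) = gram_sign G \<cdot>\<^sub>m U"
    using Uc by (simp add: as[symmetric] gram_sq mult_smult_assoc_mat[of _ ?N ?N _ ?N])
  ultimately have "gram_sign G \<cdot>\<^sub>m (gram_sign G \<cdot>\<^sub>m U) = gram_sign G \<cdot>\<^sub>m (r \<cdot>\<^sub>m ?J)" by simp
  then have U: "U = (gram_sign G * r) \<cdot>\<^sub>m ?J" by (simp add: smult_smult one_smult)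
  have "u x y = gram_sign G * r * ?J $$ (x, y)" if "x < ?N" "y < ?N" for x y
    using arg_cong[OF U, of "\<lambda>M. M $$ (x, y)"] that by (simp add: U_def)
  then show ?thesis by blast
qed

text \<open>In matrix form the claim is A J + J A^T = 0, obtained from \<open>lie_g_iff\<close>
  because J is a multiple of the involution \<open>xi G\<close>.\<close>

lemma gram_trivial:
  "(\<lambda>a b. if a < vdim G \<and> b < vdim G then gram G $$ (a, b) else 0) \<in> trivial_part G"
proof -
  let ?N = "vdim G" and ?J = "gram G" and ?x = "xi G"
  note as = mult_assoc_n[of _ ?N] and cr = mult_carrier_n[of _ ?N]
  have "(\<Sum>c<?N. A $$ (a, c) * ?J $$ (c, b)) + (\<Sum>c<?N. A $$ (b, c) * ?J $$ (a, c)) = 0"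
    if A: "A \<in> lie_g G" and ab: "a < ?N" "b < ?N" for A a b
  proof -
    let ?t = "transpose_mat A"
    have c: "A \<in> carrier_mat ?N ?N" and t: "?t = - (?x * A * ?x)" using A by (auto simp: lie_g_iff)
    have "?x * ?t = - (?x * (?x * A * ?x))" unfolding t using c by (simp add: cr)
    also have "?x * (?x * A * ?x) = A * ?x" using c by (simp add: as[symmetric] cr xi_sq)
    finally have xt: "?x * ?t = - (A * ?x)" .
    have Jx: "?J = (gram_sign G * xi_unit G) \<cdot>\<^sub>m ?x"
      by (simp add: xi_gram smult_smult one_smult xi_unit_sq mult.assoc)
    have "?J * ?t = (gram_sign G * xi_unit G) \<cdot>\<^sub>m (?x * ?t)"
      unfolding Jx using c by (intro mult_smult_assoc_mat[of _ ?N ?N _ ?N]) auto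
    also have "\<dots> = - (A * ?J)"
      unfolding xt Jx using c by (simp add: uminus_smult mult_smult_distrib[of _ ?N ?N _ ?N])
    finally have JA: "?J * ?t = - (A * ?J)" .
    have "(?J * ?t) $$ (a, b) = (\<Sum>c<?N. A $$ (b, c) * ?J $$ (a, c))"
      using mat_mult_entry[of ?J ?N ?t a b] c ab by (simp add: mult.commute del: index_mult_mat(1))
    moreover have "(- (A * ?J)) $$ (a, b) = - (\<Sum>c<?N. A $$ (a, c) * ?J $$ (c, b))"
      using mat_mult_entry[of A ?N ?J a b] c ab by (simp del: index_mult_mat(1))
    ultimately show ?thesis unfolding JA by (simp add: add_eq_0_iff)
  qed
  then show ?thesis by (auto simp: trivial_part_def VV_space_def VV_lie_def fun_eq_iff)
qed

text \<open>As a function of either index pair P is an invariant tensor, hence a multiple of J, so P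
  has rank one. The condition P J = J then determines the constant and shows that it is real, which
  is needed for self-adjointness.\<close>

lemma trivial_projection_entries:
  assumes G: "(\<exists>n. G = Sp_real n) \<or> (\<exists>n p q. G = O_real p q \<and> q = min p q \<and> p + q = 2 * n + 1)"
    and rank: "1 \<le> real_rank G" and P: "trivial_projection G P"
  obtains r :: real where "\<And>a b c e. a < vdim G \<Longrightarrow> b < vdim G \<Longrightarrow> c < vdim G \<Longrightarrow> e < vdim G \<Longrightarrow>
    P (a, b) (c, e) = of_real r * gram G $$ (a, b) * gram G $$ (c, e)"
proof -
  let ?N = "vdim G" and ?J = "gram G"
  define \<delta> where "\<delta> c e a b = (if a = c \<and> b = e then 1 else 0 :: complex)" for c e a b :: nat
  have \<delta>: "\<delta> c e \<in> VV_space ?N" if "c < ?N" "e < ?N" for c e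
    using that by (auto simp: VV_space_def \<delta>_def)
  have sum_\<delta>: "(\<Sum>x<?N. \<Sum>y<?N. f x y * \<delta> c e x y) = f c e" if "c < ?N" "e < ?N" for f c e
  proof -
    have "(\<Sum>y<?N. f x y * \<delta> c e x y) = (\<Sum>y<?N. if y = e then if x = c then f x y else 0 else 0)" for x
      by (intro sum.cong) (auto simp: \<delta>_def)
    then show ?thesis using that by simp
  qed
  have op_\<delta>: "VV_op ?N P (\<delta> c e) a b = P (a, b) (c, e)" if "a < ?N" "b < ?N" "c < ?N" "e < ?N" for a b c e
    using that sum_\<delta>[of c e "\<lambda>x y. P (a, b) (x, y)"] by (simp add: VV_op_def)
  have p0g: "A \<in> lie_p0 G \<Longrightarrow> A \<in> lie_g G" for A
    by (simp add: lie_p0_entries lie_g_entries)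
  have sym: "A $$ (y, x) = A $$ (x, y)" if "A \<in> lie_p0 G" "x < ?N" "y < ?N" for A x y
    using that by (simp add: lie_p0_entries)
  \<comment> \<open>The columns are the images of the standard basis tensors, hence
    invariant.\<close>
  have "\<exists>r. \<forall>x<?N. \<forall>y<?N. P (x, y) (c, e) = r * ?J $$ (x, y)" if ce: "c < ?N" "e < ?N" for c e
  proof (rule p0_anticommutant[OF G rank])
    fix A x y assume A: "A \<in> lie_p0 G" and xy: "x < ?N" "y < ?N"
    have "VV_op ?N P (\<delta> c e) \<in> trivial_part G" using P \<delta> ce unfolding trivial_projection_def by blast
    then have "VV_lie ?N A (VV_op ?N P (\<delta> c e)) x y = 0" using p0g[OF A] unfolding trivial_part_def by simp
    then have "(\<Sum>z<?N. A $$ (x, z) * VV_op ?N P (\<delta> c e) z y) + (\<Sum>z<?N. A $$ (y, z) * VV_op ?N P (\<delta> c e) x z) = 0"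
      using xy by (simp add: VV_lie_def)
    also have "(\<Sum>z<?N. A $$ (x, z) * VV_op ?N P (\<delta> c e) z y) = (\<Sum>z<?N. A $$ (x, z) * P (z, y) (c, e))"
      by (intro sum.cong HOL.refl) (use xy ce in \<open>simp add: op_\<delta>\<close>)
    also have "(\<Sum>z<?N. A $$ (y, z) * VV_op ?N P (\<delta> c e) x z) = (\<Sum>z<?N. P (x, z) (c, e) * A $$ (z, y))"
      by (intro sum.cong HOL.refl) (use xy ce sym[OF A] in \<open>simp add: op_\<delta>\<close>)
    finally show "(\<Sum>z<?N. A $$ (x, z) * P (z, y) (c, e)) + (\<Sum>z<?N. P (x, z) (c, e) * A $$ (z, y)) = 0" .
  qed
  then obtain col where col: "\<And>c e x y. c < ?N \<Longrightarrow> e < ?N \<Longrightarrow> x < ?N \<Longrightarrow> y < ?N \<Longrightarrow> P (x, y) (c, e) = col c e * ?J $$ (x, y)"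
    by metis
  \<comment> \<open>For the rows, P (A u) = A (P u) = 0 because the image of P is invariant;
    symmetry of A brings this to the same equation.\<close>
  have "\<exists>r. \<forall>x<?N. \<forall>y<?N. P (a, b) (x, y) = r * ?J $$ (x, y)" if ab: "a < ?N" "b < ?N" for a b
  proof (rule p0_anticommutant[OF G rank])
    fix A x y assume A: "A \<in> lie_p0 G" and xy: "x < ?N" "y < ?N"
    have triv: "VV_op ?N P (\<delta> x y) \<in> trivial_part G" using P \<delta> xy unfolding trivial_projection_def by blast
    have "VV_op ?N P (VV_lie ?N A (\<delta> x y)) = VV_lie ?N A (VV_op ?N P (\<delta> x y))"
      using P \<delta> xy p0g[OF A] unfolding trivial_projection_def by blast
    also have "\<dots> = (\<lambda>_ _. 0)" using triv p0g[OF A] unfolding trivial_part_def by simp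
    finally have 0: "VV_op ?N P (VV_lie ?N A (\<delta> x y)) a b = 0" by simp
    have e: "VV_lie ?N A (\<delta> x y) c e = (if e = y then A $$ (c, x) else 0) + (if c = x then A $$ (e, y) else 0)"
      if "c < ?N" "e < ?N" for c e
    proof -
      have "(\<Sum>z<?N. A $$ (c, z) * \<delta> x y z e) = (\<Sum>z<?N. if z = x then if e = y then A $$ (c, z) else 0 else 0)"
        "(\<Sum>z<?N. A $$ (e, z) * \<delta> x y c z) = (\<Sum>z<?N. if z = y then if c = x then A $$ (e, z) else 0 else 0)"
        by (intro sum.cong; auto simp: \<delta>_def)+
      then show ?thesis using that xy by (simp add: VV_lie_def)
    qed
    have "VV_op ?N P (VV_lie ?N A (\<delta> x y)) a b =
      (\<Sum>c<?N. \<Sum>e<?N. (if e = y then P (a, b) (c, e) * A $$ (c, x) else 0) + (if c = x then P (a, b) (c, e) * A $$ (e, y) else 0))"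
      unfolding VV_op_def using ab by (auto simp: e ring_distribs intro!: sum.cong)
    also have "\<dots> = (\<Sum>c<?N. \<Sum>e<?N. if e = y then P (a, b) (c, e) * A $$ (c, x) else 0) +
        (\<Sum>c<?N. \<Sum>e<?N. if c = x then P (a, b) (c, e) * A $$ (e, y) else 0)"
      by (simp only: sum.distrib)
    also have "(\<Sum>c<?N. \<Sum>e<?N. if e = y then P (a, b) (c, e) * A $$ (c, x) else 0) =
        (\<Sum>c<?N. P (a, b) (c, y) * A $$ (c, x))"
      using xy by simp
    also have "(\<Sum>c<?N. \<Sum>e<?N. if c = x then P (a, b) (c, e) * A $$ (e, y) else 0) =
        (\<Sum>e<?N. P (a, b) (x, e) * A $$ (e, y))"
      using xy by (subst sum.swap) simp
    also have "(\<Sum>c<?N. P (a, b) (c, y) * A $$ (c, x)) = (\<Sum>z<?N. A $$ (x, z) * P (a, b) (z, y))"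
      by (intro sum.cong HOL.refl) (use xy sym[OF A] in simp)
    finally show "(\<Sum>z<?N. A $$ (x, z) * P (a, b) (z, y)) + (\<Sum>z<?N. P (a, b) (x, z) * A $$ (z, y)) = 0"
      using 0 xy by simp
  qed
  then obtain row where row: "\<And>a b x y. a < ?N \<Longrightarrow> b < ?N \<Longrightarrow> x < ?N \<Longrightarrow> y < ?N \<Longrightarrow> P (a, b) (x, y) = row a b * ?J $$ (x, y)"
    by metis
  have "gram_sign G \<cdot>\<^sub>m 1\<^sub>m ?N \<noteq> 0\<^sub>m ?N ?N"
  proof
    assume z: "gram_sign G \<cdot>\<^sub>m 1\<^sub>m ?N = 0\<^sub>m ?N ?N"
    have "(gram_sign G \<cdot>\<^sub>m 1\<^sub>m ?N) $$ (0, 0) = 0" unfolding z using real_rank_vdim[OF rank] by simp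
    then show False using real_rank_vdim[OF rank] by simp
  qed
  then have "?J \<noteq> 0\<^sub>m ?N ?N" using gram_sq[of G] by auto
  then obtain x y where xy: "x < ?N" "y < ?N" "?J $$ (x, y) \<noteq> 0"
    using mat_eqI[OF gram_carrier, of "0\<^sub>m ?N ?N" G] by auto
  \<comment> \<open>Computing the entries of P in column (x, y) from the row and from the column
    formula expresses every row factor through the one number \<open>col x y\<close>.\<close>
  define r where "r = col x y / ?J $$ (x, y)"
  have PJ: "P (a, b) (c, e) = r * ?J $$ (a, b) * ?J $$ (c, e)" if "a < ?N" "b < ?N" "c < ?N" "e < ?N" for a b c e
  proof -
    have "row a b * ?J $$ (x, y) = col x y * ?J $$ (a, b)"
      using row[OF that(1,2) xy(1,2)] col[OF xy(1,2) that(1,2)] by simp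
    then have "row a b = r * ?J $$ (a, b)" using xy(3) by (simp add: r_def field_simps)
    then show ?thesis using row[OF that] by simp
  qed
  \<comment> \<open>The sum of the squares of the entries of J is real, and P J = J amounts to r S =
    1.\<close>
  define S where "S = (\<Sum>c<?N. \<Sum>e<?N. ?J $$ (c, e) * ?J $$ (c, e))"
  let ?JJ = "\<lambda>a b. if a < ?N \<and> b < ?N then ?J $$ (a, b) else 0"
  have "\<forall>u\<in>trivial_part G. VV_op ?N P u = u"
    using P by (simp add: trivial_projection_def)
  then have "VV_op ?N P ?JJ = ?JJ"
    using gram_trivial[of G] by (rule bspec)
  then have "VV_op ?N P ?JJ x y = ?JJ x y" by (rule fun_cong[OF fun_cong])
  then have "(\<Sum>c<?N. \<Sum>e<?N. P (x, y) (c, e) * ?J $$ (c, e)) = ?J $$ (x, y)"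
    using xy by (simp add: VV_op_def)
  moreover have "(\<Sum>c<?N. \<Sum>e<?N. P (x, y) (c, e) * ?J $$ (c, e)) = ?J $$ (x, y) * (r * S)"
    unfolding S_def sum_distrib_left using xy by (intro sum.cong HOL.refl) (simp add: PJ)
  ultimately have "r * S = 1" using xy(3) by simp
  moreover have "cnj S = S" by (simp add: S_def gram_real)
  ultimately have "cnj r * S = r * S" using complex_cnj_mult[of r S] by simp
  moreover have "S \<noteq> 0" using \<open>r * S = 1\<close> by auto
  ultimately have "cnj r = r" by simp
  then have "r = of_real (Re r)" by (simp add: complex_eq_iff)
  then show ?thesis using that[of "Re r"] PJ by simp
qed

section \<open>Operators on tensor factors\<close>

lemma mindex_update: "I \<in> mindex N k \<Longrightarrow> a < N \<Longrightarrow> I[p := a] \<in> mindex N k"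
  unfolding mindex_def using set_update_subset_insert[of I p a] by auto

lemma mindex_length: "I \<in> mindex N k \<Longrightarrow> length I = k"
  by (simp add: mindex_def)

text \<open>The map (J, a) \<mapsto> (J[p := a], J ! p) is an involution. It exchanges the row and
  column index of an operator at position p, which is how such operators are composed and moved
  across a form.\<close>

lemma sum_mindex_swap:
  assumes p: "p < k"
  shows "(\<Sum>J\<in>mindex N k. \<Sum>a<N. F J a) = (\<Sum>J\<in>mindex N k. \<Sum>a<N. F (J[p := a]) (J ! p))"
proof -
  have "(\<Sum>(J, a)\<in>mindex N k \<times> {..<N}. F J a) = (\<Sum>(J, a)\<in>mindex N k \<times> {..<N}. F (J[p := a]) (J ! p))"
    by (rule sum.reindex_bij_witness[where i = "\<lambda>(J, a). (J[p := a], J ! p)" and j = "\<lambda>(J, a). (J[p := a], J ! p)"])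
      (use p in \<open>auto simp: mindex_update mindex_nth mindex_length\<close>)
  then show ?thesis by (simp add: sum.cartesian_product)
qed

lemma sum_mindex_swap2:
  assumes "p < k" "q < k" "p \<noteq> q"
  shows "(\<Sum>J\<in>mindex N k. \<Sum>a<N. \<Sum>b<N. F J a b) =
    (\<Sum>J\<in>mindex N k. \<Sum>a<N. \<Sum>b<N. F (J[p := a, q := b]) (J ! p) (J ! q))"
proof -
  have "(\<Sum>J\<in>mindex N k. \<Sum>a<N. \<Sum>b<N. F J a b) = (\<Sum>J\<in>mindex N k. \<Sum>a<N. \<Sum>b<N. F (J[p := a]) (J ! p) b)"
    by (rule sum_mindex_swap[OF assms(1)])
  also have "\<dots> = (\<Sum>a<N. \<Sum>J\<in>mindex N k. \<Sum>b<N. F (J[p := a]) (J ! p) b)"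
    by (rule sum.swap)
  also have "\<dots> = (\<Sum>a<N. \<Sum>J\<in>mindex N k. \<Sum>b<N. F (J[q := b, p := a]) (J[q := b] ! p) (J ! q))"
    by (intro sum.cong HOL.refl sum_mindex_swap[OF assms(2)])
  also have "\<dots> = (\<Sum>J\<in>mindex N k. \<Sum>a<N. \<Sum>b<N. F (J[p := a, q := b]) (J ! p) (J ! q))"
    using assms by (subst sum.swap) (simp add: list_update_swap)
  finally show ?thesis .
qed

lemma list_update_restore: "J[p := a, i := b, p := J ! p, i := J ! i] = J"
proof (rule nth_equalityI)
  fix l assume "l < length (J[p := a, i := b, p := J ! p, i := J ! i])"
  then show "J[p := a, i := b, p := J ! p, i := J ! i] ! l = J ! l"
    by (cases "l = i"; cases "l = p") auto
qed simp

text \<open>The operator h \<otimes> M_0 \<otimes> ... \<otimes> M_(k-1), where \<open>Ms j\<close>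
  acts on tensor factor j + 1. Both the action of K and that of \<open>w0\<close> have this shape,
  so commutation with the generators is proved once for the two.\<close>

definition tens_act :: "(complex \<Rightarrow> 'x \<Rightarrow> 'x) \<Rightarrow> nat \<Rightarrow> nat \<Rightarrow> (nat \<Rightarrow> complex mat) \<Rightarrow> ('x \<Rightarrow> 'x) \<Rightarrow>
    (nat list \<Rightarrow> 'x::ab_group_add) \<Rightarrow> nat list \<Rightarrow> 'x" where
  "tens_act s N k Ms h u = (\<lambda>I. if I \<in> mindex N k
     then (\<Sum>J\<in>mindex N k. s (\<Prod>j<k. Ms j $$ (I ! j, J ! j)) (h (u J))) else 0)"

lemma K_act_tens: "K_act G X k g = tens_act (scl X) (vdim G) k (\<lambda>_. g) (grp X g)"
  by (simp add: K_act_def tens_act_def fun_eq_iff)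

lemma prod_update:
  assumes "p < (k :: nat)"
  shows "(\<Prod>j<k. f j) = f p * (\<Prod>j\<in>{..<k} - {p}. f j :: complex)"
  using assms by (simp add: prod.remove)

definition lin_op :: "(complex \<Rightarrow> 'x \<Rightarrow> 'x) \<Rightarrow> ((nat list \<Rightarrow> 'x::ab_group_add) \<Rightarrow> nat list \<Rightarrow> 'x) \<Rightarrow> bool" where
  "lin_op s S \<longleftrightarrow> (\<forall>u v. S (\<lambda>I. u I + v I) = (\<lambda>I. S u I + S v I)) \<and> (\<forall>c u. S (\<lambda>I. s c (u I)) = (\<lambda>I. s c (S u I)))"

lemma lin_opD:
  assumes "lin_op s S"
  shows "S (\<lambda>I. u I + v I) = (\<lambda>I. S u I + S v I)" "S (\<lambda>I. s c (u I)) = (\<lambda>I. s c (S u I))"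
  using assms by (simp_all add: lin_op_def)

lemma lin_op_sum:
  assumes "lin_op s S" "finite A"
  shows "S (\<lambda>I. \<Sum>b\<in>A. f b I) = (\<lambda>I. \<Sum>b\<in>A. S (f b) I)"
  using assms(2)
proof (induction A rule: finite_induct)
  case empty
  have "S (\<lambda>I. 0 + 0) = (\<lambda>I. S (\<lambda>I. 0) I + S (\<lambda>I. 0) I)"
    by (rule lin_opD(1)[OF assms(1)])
  then show ?case by (auto simp: fun_eq_iff)
next
  case (insert b A)
  have "S (\<lambda>I. f b I + (\<Sum>b\<in>A. f b I)) = (\<lambda>I. S (f b) I + S (\<lambda>I. \<Sum>b\<in>A. f b I) I)"
    by (rule lin_opD(1)[OF assms(1)])
  then show ?case using insert by simp
qed

lemma lin_op_comp: "lin_op s S \<Longrightarrow> lin_op s S' \<Longrightarrow> lin_op s (\<lambda>u. S (S' u))"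
  by (simp add: lin_op_def)

definition sum_form :: "nat \<Rightarrow> nat \<Rightarrow> ('x \<Rightarrow> 'x \<Rightarrow> complex) \<Rightarrow> (nat list \<Rightarrow> 'x) \<Rightarrow> (nat list \<Rightarrow> 'x) \<Rightarrow> complex" where
  "sum_form N k f u v = (\<Sum>I\<in>mindex N k. f (u I) (v I))"

lemma gK_moduleD:
  assumes "gK_module G X"
  shows "\<forall>A\<in>lie_g G. Vector_Spaces.linear (scl X) (scl X) (lie X A)"
    "\<forall>A\<in>lie_g G. \<forall>B\<in>lie_g G. \<forall>v. lie X (A + B) v = lie X A v + lie X B v"
    "\<forall>a. \<forall>A\<in>lie_g G. \<forall>v. lie X (a \<cdot>\<^sub>m A) v = scl X a (lie X A v)"
    "\<forall>g\<in>grp_K G. Vector_Spaces.linear (scl X) (scl X) (grp X g)"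
    "\<forall>g\<in>grp_K G. \<forall>h\<in>grp_K G. g * h = 1\<^sub>m (vdim G) \<longrightarrow>
        (\<forall>A\<in>lie_g G. \<forall>v. grp X g (lie X A v) = lie X (g * A * h) (grp X g v))"
proof -
  note g = assms[unfolded gK_module_def]
  show "\<forall>A\<in>lie_g G. Vector_Spaces.linear (scl X) (scl X) (lie X A)"
    using g by (elim conjE)
  show "\<forall>A\<in>lie_g G. \<forall>B\<in>lie_g G. \<forall>v. lie X (A + B) v = lie X A v + lie X B v"
    using g by (elim conjE)
  show "\<forall>a. \<forall>A\<in>lie_g G. \<forall>v. lie X (a \<cdot>\<^sub>m A) v = scl X a (lie X A v)"
    using g by (elim conjE)
  show "\<forall>g\<in>grp_K G. Vector_Spaces.linear (scl X) (scl X) (grp X g)"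
    using g by (elim conjE)
  show "\<forall>g\<in>grp_K G. \<forall>h\<in>grp_K G. g * h = 1\<^sub>m (vdim G) \<longrightarrow>
        (\<forall>A\<in>lie_g G. \<forall>v. grp X g (lie X A v) = lie X (g * A * h) (grp X g v))"
    using g by (elim conjE)
qed

locale tensor_module = lie_dual_basis G B d
  for G B d +
  fixes X :: "'x::ab_group_add gK_data" and k :: nat and P :: "nat \<times> nat \<Rightarrow> nat \<times> nat \<Rightarrow> complex" and r :: real
  assumes gK: "gK_module G X"
    and P: "2 \<le> k \<Longrightarrow> a < vdim G \<Longrightarrow> b < vdim G \<Longrightarrow> c < vdim G \<Longrightarrow> e < vdim G \<Longrightarrow>
      P (a, b) (c, e) = of_real r * gram G $$ (a, b) * gram G $$ (c, e)"
begin

abbreviation "N \<equiv> vdim G"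

sublocale vector_space "scl X"
  using gK by (simp add: gK_module_def)

lemma lie_linear:
  assumes "A \<in> lie_g G"
  shows "lie X A (u + v) = lie X A u + lie X A v" "lie X A (scl X c u) = scl X c (lie X A u)"
    "lie X A (\<Sum>a\<in>S. f a) = (\<Sum>a\<in>S. lie X A (f a))"
proof -
  have l: "Vector_Spaces.linear (scl X) (scl X) (lie X A)" using gK_moduleD(1)[OF gK] assms by blast
  interpret l: Vector_Spaces.linear "scl X" "scl X" "lie X A" by fact
  show "lie X A (u + v) = lie X A u + lie X A v" "lie X A (scl X c u) = scl X c (lie X A u)"
    by (rule l.add, rule l.scale)
  show "lie X A (\<Sum>a\<in>S. f a) = (\<Sum>a\<in>S. lie X A (f a))" by (rule l.sum)
qed

lemma grp_linear:
  assumes "g \<in> grp_K G"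
  shows "grp X g (u + v) = grp X g u + grp X g v" "grp X g (scl X c u) = scl X c (grp X g u)"
    "grp X g (\<Sum>a\<in>S. f a) = (\<Sum>a\<in>S. grp X g (f a))"
proof -
  have l: "Vector_Spaces.linear (scl X) (scl X) (grp X g)" using gK_moduleD(4)[OF gK] assms by blast
  interpret l: Vector_Spaces.linear "scl X" "scl X" "grp X g" by fact
  show "grp X g (u + v) = grp X g u + grp X g v" "grp X g (scl X c u) = scl X c (grp X g u)"
    by (rule l.add, rule l.scale)
  show "grp X g (\<Sum>a\<in>S. f a) = (\<Sum>a\<in>S. grp X g (f a))" by (rule l.sum)
qed

lemma lie_mat_linear:
  assumes "A \<in> lie_g G"
  shows "A' \<in> lie_g G \<Longrightarrow> lie X (A + A') v = lie X A v + lie X A' v" "lie X (c \<cdot>\<^sub>m A) v = scl X c (lie X A v)"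
  using gK_moduleD(2,3)[OF gK] assms by blast+

lemma grp_lie:
  assumes "g \<in> grp_K G" "A \<in> lie_g G"
  shows "grp X g (lie X A v) = lie X (g * A * transpose_mat g) (grp X g v)"
  using gK_moduleD(5)[OF gK] assms grp_K_facts(6,8)[OF assms(1)] by blast

abbreviation "on \<equiv> on_factor G X k"
abbreviation "tens \<equiv> tens_act (scl X) N k"

definition lin_map :: "('x \<Rightarrow> 'x) \<Rightarrow> bool" where
  "lin_map h \<longleftrightarrow> (\<forall>u v. h (u + v) = h u + h v) \<and> (\<forall>c u. h (scl X c u) = scl X c (h u))"

lemma lin_map_sum: "lin_map h \<Longrightarrow> h (\<Sum>a\<in>S. f a) = (\<Sum>a\<in>S. h (f a))"
proof (induction S rule: infinite_finite_induct)
  case (infinite A)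
  then have "h (0 + 0) = h 0 + h 0" unfolding lin_map_def by blast
  then show ?case using infinite by simp
next
  case empty
  then have "h (0 + 0) = h 0 + h 0" unfolding lin_map_def by blast
  then show ?case by simp
qed (simp add: lin_map_def)

lemma lin_map_id: "lin_map (\<lambda>x. x)" and lin_map_grp: "g \<in> grp_K G \<Longrightarrow> lin_map (grp X g)"
  by (simp_all add: lin_map_def grp_linear)

lemma lin_op_tens: "lin_map h \<Longrightarrow> lin_op (scl X) (tens Ms h)"
  unfolding lin_op_def tens_act_def lin_map_def
  by (auto simp: fun_eq_iff scale_right_distrib sum.distrib scale_sum_right mult.commute)

lemma lin_op_on: "A \<in> lie_g G \<or> 1 \<le> i \<Longrightarrow> lin_op (scl X) (on i A)"
  unfolding lin_op_def on_factor_def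
  by (auto simp: fun_eq_iff scale_right_distrib sum.distrib scale_sum_right mult.commute lie_linear)

lemma lin_op_proj: "lin_op (scl X) (proj_factors G X k Q i)"
  unfolding lin_op_def proj_factors_def
  by (auto simp: fun_eq_iff scale_right_distrib sum.distrib scale_sum_right mult.commute)

text \<open>Operators on a single factor multiply the matrix of that factor and leave the others
  alone.\<close>

lemma tens_on:
  assumes i: "1 \<le> i" "i \<le> k" and M: "Ms (i - 1) \<in> carrier_mat N N" and A: "A \<in> carrier_mat N N" and h: "lin_map h"
  shows "tens Ms h (on i A u) = tens (Ms(i - 1 := Ms (i - 1) * A)) h u"
    "on i A (tens Ms h u) = tens (Ms(i - 1 := A * Ms (i - 1))) h u"
proof -
  \<comment> \<open>Tensor factor i sits at position i - 1 of a multi-index, factor 0 being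
    X.\<close>
  define p where "p = i - 1"
  have p: "p < k" "i - 1 = p" "i - Suc 0 = p" using i by (auto simp: p_def)
  have pr: "(\<Prod>j<k. f j ((J[p := a]) ! j)) = f p a * (\<Prod>j\<in>{..<k} - {p}. f j (J ! j))" if "J \<in> mindex N k"
    for f :: "nat \<Rightarrow> nat \<Rightarrow> complex" and a J
  proof -
    have "(\<Prod>j\<in>{..<k} - {p}. f j ((J[p := a]) ! j)) = (\<Prod>j\<in>{..<k} - {p}. f j (J ! j))"
      by (intro prod.cong) auto
    then show ?thesis using p that by (simp add: prod_update[OF p(1)] mindex_length)
  qed
  have pr': "(\<Prod>j<k. (Ms(p := M')) j $$ (I ! j, J ! j)) = M' $$ (I ! p, J ! p) * (\<Prod>j\<in>{..<k} - {p}. Ms j $$ (I ! j, J ! j))" for M' I J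
    unfolding prod_update[OF p(1)] by (intro arg_cong2[of _ _ _ _ "(*)"] prod.cong) auto
  show "tens Ms h (on i A u) = tens (Ms(i - 1 := Ms (i - 1) * A)) h u"
  proof
    fix I
    show "tens Ms h (on i A u) I = tens (Ms(i - 1 := Ms (i - 1) * A)) h u I"
    proof (cases "I \<in> mindex N k")
      case I: True
      have "tens Ms h (on i A u) I = (\<Sum>J\<in>mindex N k. \<Sum>a<N.
          scl X ((\<Prod>j<k. Ms j $$ (I ! j, J ! j)) * A $$ (J ! p, a)) (h (u (J[p := a]))))"
        using I i h by (simp add: tens_act_def on_factor_def p lin_map_sum scale_sum_right)
          (simp add: lin_map_def)
      \<comment> \<open>After the exchange, u is evaluated at J for every a, and a has become the
        inner index of a matrix product.\<close>
      also have "\<dots> = (\<Sum>J\<in>mindex N k. \<Sum>a<N.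
          scl X ((\<Prod>j<k. Ms j $$ (I ! j, (J[p := a]) ! j)) * A $$ ((J[p := a]) ! p, J ! p)) (h (u (J[p := a, p := J ! p]))))"
        by (rule sum_mindex_swap[OF p(1)])
      also have "\<dots> = (\<Sum>J\<in>mindex N k. scl X (\<Prod>j<k. (Ms(p := Ms p * A)) j $$ (I ! j, J ! j)) (h (u J)))"
      proof (intro sum.cong HOL.refl)
        fix J assume J: "J \<in> mindex N k"
        have "(\<Sum>a<N. scl X ((\<Prod>j<k. Ms j $$ (I ! j, (J[p := a]) ! j)) * A $$ ((J[p := a]) ! p, J ! p)) (h (u (J[p := a, p := J ! p])))) =
          (\<Sum>a<N. scl X (Ms p $$ (I ! p, a) * A $$ (a, J ! p) * (\<Prod>j\<in>{..<k} - {p}. Ms j $$ (I ! j, J ! j))) (h (u J)))"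
          using J p by (intro sum.cong HOL.refl) (simp add: pr[where f = "\<lambda>j x. Ms j $$ (I ! j, x)"] mindex_length ac_simps)
        also have "\<dots> = scl X ((\<Sum>a<N. Ms p $$ (I ! p, a) * A $$ (a, J ! p)) * (\<Prod>j\<in>{..<k} - {p}. Ms j $$ (I ! j, J ! j))) (h (u J))"
          by (simp add: scale_sum_left sum_distrib_right)
        also have "(\<Sum>a<N. Ms p $$ (I ! p, a) * A $$ (a, J ! p)) = (Ms p * A) $$ (I ! p, J ! p)"
          using mat_mult_entry[of "Ms p" N A "I ! p" "J ! p"] M A p I J by (simp add: mindex_nth del: index_mult_mat(1))
        finally show "(\<Sum>a<N. scl X ((\<Prod>j<k. Ms j $$ (I ! j, (J[p := a]) ! j)) * A $$ ((J[p := a]) ! p, J ! p)) (h (u (J[p := a, p := J ! p])))) =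
          scl X (\<Prod>j<k. (Ms(p := Ms p * A)) j $$ (I ! j, J ! j)) (h (u J))"
          unfolding pr' .
      qed
      finally show ?thesis using I by (simp add: tens_act_def p del: fun_upd_apply)
    qed (simp add: tens_act_def)
  qed
  show "on i A (tens Ms h u) = tens (Ms(i - 1 := A * Ms (i - 1))) h u"
  proof
    fix I
    show "on i A (tens Ms h u) I = tens (Ms(i - 1 := A * Ms (i - 1))) h u I"
    proof (cases "I \<in> mindex N k")
      case I: True
      have "on i A (tens Ms h u) I = (\<Sum>J\<in>mindex N k. \<Sum>a<N.
          scl X (A $$ (I ! p, a) * (\<Prod>j<k. Ms j $$ ((I[p := a]) ! j, J ! j))) (h (u J)))"
        using I i by (subst sum.swap) (simp add: tens_act_def on_factor_def p mindex_update scale_sum_right)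
      also have "\<dots> = (\<Sum>J\<in>mindex N k. scl X (\<Prod>j<k. (Ms(p := A * Ms p)) j $$ (I ! j, J ! j)) (h (u J)))"
      proof (intro sum.cong HOL.refl)
        fix J assume J: "J \<in> mindex N k"
        have "(\<Sum>a<N. scl X (A $$ (I ! p, a) * (\<Prod>j<k. Ms j $$ ((I[p := a]) ! j, J ! j))) (h (u J))) =
          (\<Sum>a<N. scl X (A $$ (I ! p, a) * Ms p $$ (a, J ! p) * (\<Prod>j\<in>{..<k} - {p}. Ms j $$ (I ! j, J ! j))) (h (u J)))"
          using I p by (intro sum.cong HOL.refl) (simp add: pr[where f = "\<lambda>j x. Ms j $$ (x, J ! j)"] ac_simps)
        also have "\<dots> = scl X ((\<Sum>a<N. A $$ (I ! p, a) * Ms p $$ (a, J ! p)) * (\<Prod>j\<in>{..<k} - {p}. Ms j $$ (I ! j, J ! j))) (h (u J))"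
          by (simp add: scale_sum_left sum_distrib_right)
        also have "(\<Sum>a<N. A $$ (I ! p, a) * Ms p $$ (a, J ! p)) = (A * Ms p) $$ (I ! p, J ! p)"
          using mat_mult_entry[of A N "Ms p" "I ! p" "J ! p"] M A p I J by (simp add: mindex_nth del: index_mult_mat(1))
        finally show "(\<Sum>a<N. scl X (A $$ (I ! p, a) * (\<Prod>j<k. Ms j $$ ((I[p := a]) ! j, J ! j))) (h (u J))) =
          scl X (\<Prod>j<k. (Ms(p := A * Ms p)) j $$ (I ! j, J ! j)) (h (u J))"
          unfolding pr' .
      qed
      finally show ?thesis using I by (simp add: tens_act_def p del: fun_upd_apply)
    qed (simp add: tens_act_def on_factor_def)
  qed
qed

lemma tens_on_commute:
  assumes "1 \<le> i" "i \<le> k" "M \<in> carrier_mat N N" "A \<in> carrier_mat N N" "A' \<in> carrier_mat N N" "lin_map h"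
    and "M * A = A' * M"
  shows "tens (\<lambda>_. M) h (on i A u) = on i A' (tens (\<lambda>_. M) h u)"
  using assms tens_on(1)[of i "\<lambda>_. M" A h u] tens_on(2)[of i "\<lambda>_. M" A' h u] by simp

lemma tens_on_0:
  assumes "lin_map h" "A' \<in> lie_g G" "\<And>v. h (lie X A v) = lie X A' (h v)"
  shows "tens Ms h (on 0 A u) = on 0 A' (tens Ms h u)"
  using assms by (auto simp: tens_act_def on_factor_def fun_eq_iff lie_linear intro!: sum.cong)

text \<open>The hypothesis on Q says that the operator with kernel Q on V \<otimes> V commutes with
  M \<otimes> M; the remaining factors of the product, \<open>?R\<close>, are untouched.\<close>

lemma tens_proj:
  assumes i: "1 \<le> i" "i < k" and h: "lin_map h"
    and Q: "\<And>x y c e. x < N \<Longrightarrow> y < N \<Longrightarrow> c < N \<Longrightarrow> e < N \<Longrightarrow>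
      (\<Sum>a<N. \<Sum>b<N. M $$ (x, a) * M $$ (y, b) * Q (a, b) (c, e)) = (\<Sum>a<N. \<Sum>b<N. Q (x, y) (a, b) * (M $$ (a, c) * M $$ (b, e)))"
  shows "tens (\<lambda>_. M) h (proj_factors G X k Q i u) = proj_factors G X k Q i (tens (\<lambda>_. M) h u)"
proof
  fix I
  define p where "p = i - 1"
  have p: "p < k" "p \<noteq> i" "i - 1 = p" "i - Suc 0 = p" using i by (auto simp: p_def)
  let ?R = "\<lambda>I J. \<Prod>j\<in>{..<k} - {p} - {i}. M $$ (I ! j, J ! j)"
  have pr: "(\<Prod>j<k. M $$ (I ! j, J ! j)) = M $$ (I ! p, J ! p) * M $$ (I ! i, J ! i) * ?R I J" for I J
    using p i by (simp add: prod_update[OF p(1)] prod.remove[of _ i] mult.assoc)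
  have R: "?R I (J[p := a, i := b]) = ?R I J" "?R (J[p := a, i := b]) I = ?R J I" for I J a b
    by (intro prod.cong; simp)+
  show "tens (\<lambda>_. M) h (proj_factors G X k Q i u) I = proj_factors G X k Q i (tens (\<lambda>_. M) h u) I"
  proof (cases "I \<in> mindex N k")
    case I: True
    have "tens (\<lambda>_. M) h (proj_factors G X k Q i u) I = (\<Sum>J\<in>mindex N k. \<Sum>a<N. \<Sum>b<N.
        scl X ((\<Prod>j<k. M $$ (I ! j, J ! j)) * Q (J ! p, J ! i) (a, b)) (h (u (J[p := a, i := b]))))"
      using I i h by (simp add: tens_act_def proj_factors_def p lin_map_sum scale_sum_right) (simp add: lin_map_def)
    also have "\<dots> = (\<Sum>J\<in>mindex N k. \<Sum>a<N. \<Sum>b<N.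
        scl X ((\<Prod>j<k. M $$ (I ! j, (J[p := a, i := b]) ! j)) * Q ((J[p := a, i := b]) ! p, (J[p := a, i := b]) ! i) (J ! p, J ! i))
          (h (u (J[p := a, i := b, p := J ! p, i := J ! i]))))"
      by (rule sum_mindex_swap2[OF p(1) i(2) p(2)])
    also have "\<dots> = (\<Sum>J\<in>mindex N k. \<Sum>a<N. \<Sum>b<N.
        scl X (M $$ (I ! p, a) * M $$ (I ! i, b) * Q (a, b) (J ! p, J ! i) * ?R I J) (h (u J)))"
      using p i by (intro sum.cong HOL.refl)
        (simp add: pr R list_update_restore mindex_length ac_simps)
    also have "\<dots> = (\<Sum>J\<in>mindex N k.
        scl X ((\<Sum>a<N. \<Sum>b<N. M $$ (I ! p, a) * M $$ (I ! i, b) * Q (a, b) (J ! p, J ! i)) * ?R I J) (h (u J)))"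
      by (simp add: scale_sum_left sum_distrib_right)
    also have "\<dots> = (\<Sum>J\<in>mindex N k.
        scl X ((\<Sum>a<N. \<Sum>b<N. Q (I ! p, I ! i) (a, b) * (M $$ (a, J ! p) * M $$ (b, J ! i))) * ?R I J) (h (u J)))"
      using I p i by (intro sum.cong HOL.refl) (simp add: Q mindex_nth)
    also have "\<dots> = (\<Sum>J\<in>mindex N k. \<Sum>a<N. \<Sum>b<N.
        scl X (Q (I ! p, I ! i) (a, b) * (\<Prod>j<k. M $$ ((I[p := a, i := b]) ! j, J ! j))) (h (u J)))"
      using p i I by (simp add: scale_sum_left sum_distrib_right pr R mindex_length mult.assoc)
    also have "\<dots> = (\<Sum>a<N. \<Sum>b<N. \<Sum>J\<in>mindex N k.
        scl X (Q (I ! p, I ! i) (a, b) * (\<Prod>j<k. M $$ ((I[p := a, i := b]) ! j, J ! j))) (h (u J)))"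
      by (subst sum.swap, rule sum.cong[OF HOL.refl], rule sum.swap)
    also have "\<dots> = proj_factors G X k Q i (tens (\<lambda>_. M) h u) I"
      using I by (simp add: tens_act_def proj_factors_def p mindex_update scale_sum_right)
    finally show ?thesis .
  qed (simp add: tens_act_def proj_factors_def)
qed

end

section \<open>Equivariance and adjoints of the generators\<close>

lemma lin_op_sum_ops:
  assumes "vector_space s" "\<And>b. b \<in> A \<Longrightarrow> lin_op s (S b)" shows "lin_op s (\<lambda>u I. \<Sum>b\<in>A. S b u I)"
proof -
  interpret vector_space s by fact
  have "(\<Sum>b\<in>A. S b (\<lambda>I. u I + v I) I) = (\<Sum>b\<in>A. S b u I) + (\<Sum>b\<in>A. S b v I)" for u v I
    unfolding sum.distrib[symmetric] by (intro sum.cong HOL.refl) (simp add: lin_opD(1)[OF assms(2)])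
  moreover have "(\<Sum>b\<in>A. S b (\<lambda>I. s c (u I)) I) = s c (\<Sum>b\<in>A. S b u I)" for u c I
    unfolding scale_sum_right by (intro sum.cong HOL.refl) (simp add: lin_opD(2)[OF assms(2)])
  ultimately show ?thesis by (simp add: lin_op_def)
qed

text \<open>The flip as a kernel on V \<otimes> V, so that the generators \<open>tt i\<close> and
  \<open>ee i\<close> share their commutation and adjoint lemmas.\<close>

definition flip_kernel :: "nat \<times> nat \<Rightarrow> nat \<times> nat \<Rightarrow> complex" where
  "flip_kernel = (\<lambda>(x, y) (a, b). if a = y \<and> b = x then 1 else 0)"

context tensor_module
begin

abbreviation "Tsp \<equiv> tensor_space N k"
abbreviation "act \<equiv> expr_act G X k B d P"

lemma tens_in: "tens Ms h u \<in> Tsp" and on_in: "on i A u \<in> Tsp"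
  by (auto simp: tensor_space_def tens_act_def on_factor_def)

lemma gen_act_in: "gen_act G X k B d P g u \<in> Tsp"
  by (cases g) (auto simp: tensor_space_def flip_def on_factor_def proj_factors_def Omega_def)

lemma expr_act_in: "u \<in> Tsp \<Longrightarrow> act x u \<in> Tsp"
proof (induction x arbitrary: u)
  case (Gen g) then show ?case using gen_act_in by simp
qed (auto simp: tensor_space_def)

lemma flip_proj:
  assumes "1 \<le> i" "i < k" shows "flip N k i u = proj_factors G X k flip_kernel i u"
proof
  fix I
  show "flip N k i u I = proj_factors G X k flip_kernel i u I"
  proof (cases "I \<in> mindex N k")
    case I: True
    let ?p = "i - 1"
    have l: "I ! ?p < N" "I ! i < N" using mindex_nth[OF I] assms by auto
    have "(\<Sum>a<N. \<Sum>b<N. scl X (flip_kernel (I ! ?p, I ! i) (a, b)) (u (I[?p := a, i := b]))) =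
      (\<Sum>a<N. \<Sum>b<N. if b = I ! ?p then if a = I ! i then u (I[?p := a, i := b]) else 0 else 0)"
      by (intro sum.cong HOL.refl) (auto simp: flip_kernel_def)
    also have "\<dots> = u (I[?p := I ! i, i := I ! ?p])" using l by simp
    finally show ?thesis using I by (simp add: flip_def proj_factors_def)
  qed (simp add: flip_def proj_factors_def)
qed

lemma flip_kernel_commute:
  assumes "x < N" "y < N" "c < N" "e < N"
  shows "(\<Sum>a<N. \<Sum>b<N. M $$ (x, a) * M $$ (y, b) * flip_kernel (a, b) (c, e)) =
    (\<Sum>a<N. \<Sum>b<N. flip_kernel (x, y) (a, b) * (M $$ (a, c) * M $$ (b, e)))"
proof -
  have "(\<Sum>a<N. \<Sum>b<N. M $$ (x, a) * M $$ (y, b) * flip_kernel (a, b) (c, e)) =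
      (\<Sum>a<N. \<Sum>b<N. if b = c then if a = e then M $$ (x, a) * M $$ (y, b) else 0 else 0)"
    "(\<Sum>a<N. \<Sum>b<N. flip_kernel (x, y) (a, b) * (M $$ (a, c) * M $$ (b, e))) =
      (\<Sum>a<N. \<Sum>b<N. if b = x then if a = y then M $$ (a, c) * M $$ (b, e) else 0 else 0)"
    by (intro sum.cong HOL.refl; auto simp: flip_kernel_def)+
  then show ?thesis using assms by (simp add: mult.commute)
qed

text \<open>J is an eigenvector of M \<otimes> M and of its transpose, with the same eigenvalue t: 1
  for elements of K, the sign \<epsilon> for \<open>xi G\<close>.\<close>

definition preserves_gram :: "complex mat \<Rightarrow> bool" where
  "preserves_gram M \<longleftrightarrow> M \<in> carrier_mat N N \<and> (\<exists>t. M * gram G * transpose_mat M = t \<cdot>\<^sub>m gram G \<and>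
     transpose_mat M * gram G * M = t \<cdot>\<^sub>m gram G)"

lemma preserves_gram_K: "g \<in> grp_K G \<Longrightarrow> preserves_gram g"
proof -
  assume g: "g \<in> grp_K G"
  note gf = grp_K_facts[OF g]
  have "g * gram G * transpose_mat g = gram G"
    using gf by (simp add: gf(4)[symmetric] mult_assoc_n[of _ N])
  moreover have "transpose_mat g * gram G * g = gram G" using g by (simp add: grp_K_def grp_G_def)
  ultimately show ?thesis unfolding preserves_gram_def using gf(1) by (auto intro!: exI[of _ 1] simp: one_smult)
qed

lemma preserves_gram_xi: "preserves_gram (xi G)"
proof -
  have Jx: "gram G = (gram_sign G * xi_unit G) \<cdot>\<^sub>m xi G"
    by (simp add: xi_gram smult_smult one_smult xi_unit_sq mult.assoc)
  have t: "transpose_mat (xi G) = gram_sign G \<cdot>\<^sub>m xi G"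
  proof -
    have "transpose_mat (xi G) = xi_unit G \<cdot>\<^sub>m transpose_mat (gram G)"
      by (rule eq_matI) (auto simp: xi_gram)
    then show ?thesis by (simp add: transpose_gram xi_gram smult_smult mult.commute)
  qed
  have J: "xi G * gram G * xi G = gram G"
    unfolding Jx by (simp add: mult_smult_distrib[of _ N N _ N] mult_smult_assoc_mat[of _ N N _ N] xi_sq mult_carrier_n[of _ N])
  have "xi G * gram G * transpose_mat (xi G) = gram_sign G \<cdot>\<^sub>m gram G"
    unfolding t using J by (simp add: mult_smult_distrib[of _ N N _ N] mult_carrier_n[of _ N])
  moreover have "transpose_mat (xi G) * gram G * xi G = gram_sign G \<cdot>\<^sub>m gram G"
    unfolding t using J by (simp add: mult_smult_assoc_mat[of _ N N _ N] mult_carrier_n[of _ N])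
  ultimately show ?thesis by (auto simp: preserves_gram_def)
qed

text \<open>P is a multiple of the column J times the row J. On one side M \<otimes> M acts on the
  column, on the other on the row, and both times the factor t appears.\<close>

lemma P_commute:
  assumes k: "2 \<le> k" and M: "preserves_gram M" and xy: "x < N" "y < N" "c < N" "e < N"
  shows "(\<Sum>a<N. \<Sum>b<N. M $$ (x, a) * M $$ (y, b) * P (a, b) (c, e)) =
    (\<Sum>a<N. \<Sum>b<N. P (x, y) (a, b) * (M $$ (a, c) * M $$ (b, e)))"
proof -
  let ?J = "gram G"
  obtain t where Mc: "M \<in> carrier_mat N N" and t: "M * ?J * transpose_mat M = t \<cdot>\<^sub>m ?J" "transpose_mat M * ?J * M = t \<cdot>\<^sub>m ?J"
    using M by (auto simp: preserves_gram_def)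
  note cr = mult_carrier_n[of _ N]
  have Mt: "transpose_mat M \<in> carrier_mat N N" using Mc by simp
  have "(\<Sum>b<N. (\<Sum>a<N. M $$ (x, a) * ?J $$ (a, b)) * M $$ (y, b)) = (M * ?J * transpose_mat M) $$ (x, y)"
    using Mc xy by (simp add: mat_mult_entry[OF cr[OF Mc gram_carrier] Mt] mat_mult_entry[OF Mc gram_carrier]
      del: index_mult_mat(1))
  then have 1: "(\<Sum>a<N. \<Sum>b<N. M $$ (x, a) * M $$ (y, b) * ?J $$ (a, b)) = t * ?J $$ (x, y)"
    unfolding t using xy by (subst sum.swap) (simp add: sum_distrib_right sum_distrib_left ac_simps)
  have "(\<Sum>b<N. (\<Sum>a<N. M $$ (a, c) * ?J $$ (a, b)) * M $$ (b, e)) = (transpose_mat M * ?J * M) $$ (c, e)"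
    using Mc xy by (simp add: mat_mult_entry[OF cr[OF Mt gram_carrier] Mc] mat_mult_entry[OF Mt gram_carrier]
      del: index_mult_mat(1))
  then have 2: "(\<Sum>a<N. \<Sum>b<N. ?J $$ (a, b) * (M $$ (a, c) * M $$ (b, e))) = t * ?J $$ (c, e)"
    unfolding t using xy by (subst sum.swap) (simp add: sum_distrib_right sum_distrib_left ac_simps)
  have "(\<Sum>a<N. \<Sum>b<N. M $$ (x, a) * M $$ (y, b) * P (a, b) (c, e)) =
      of_real r * ?J $$ (c, e) * (\<Sum>a<N. \<Sum>b<N. M $$ (x, a) * M $$ (y, b) * ?J $$ (a, b))"
    unfolding sum_distrib_left using xy by (intro sum.cong HOL.refl) (simp add: P[OF k])
  moreover have "(\<Sum>a<N. \<Sum>b<N. P (x, y) (a, b) * (M $$ (a, c) * M $$ (b, e))) =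
      of_real r * ?J $$ (x, y) * (\<Sum>a<N. \<Sum>b<N. ?J $$ (a, b) * (M $$ (a, c) * M $$ (b, e)))"
    unfolding sum_distrib_left using xy by (intro sum.cong HOL.refl) (simp add: P[OF k])
  ultimately show ?thesis by (simp add: 1 2)
qed

lemma lin_op_scale: "lin_op (scl X) S \<Longrightarrow> lin_op (scl X) (\<lambda>u I. scl X c (S u I))"
  by (simp add: lin_op_def scale_right_distrib mult.commute)

lemma lin_op_gen: "gen_ok k g \<Longrightarrow> lin_op (scl X) (gen_act G X k B d P g)"
proof (cases g)
  case (T i)
  assume "gen_ok k g"
  then have "gen_act G X k B d P g = proj_factors G X k flip_kernel i" using T flip_proj by (auto simp: fun_eq_iff)
  then show ?thesis using lin_op_proj by simp
next
  case (E i)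
  then show ?thesis using lin_op_scale[OF lin_op_proj, of "par0 G" P i] by (simp add: lin_op_def)
next
  case (Z i)
  assume "gen_ok k g"
  then have i: "1 \<le> i" using Z by simp
  have "gen_act G X k B d P g = (\<lambda>u I. \<Sum>j<i. \<Sum>b\<in>B. on j b (on i (d b) u) I)"
    by (simp add: Z Omega_def fun_eq_iff)
  moreover have "lin_op (scl X) (\<lambda>u I. \<Sum>j<i. \<Sum>b\<in>B. on j b (on i (d b) u) I)"
    by (intro lin_op_sum_ops[OF vector_space_axioms] lin_op_comp[OF lin_op_on lin_op_on])
      (use i in \<open>auto simp: B_sub\<close>)
  ultimately show ?thesis by simp
next
  case (Th i)
  assume "gen_ok k g"
  then show ?thesis using Th lin_op_on[of "xi G" i] by (simp add: lin_op_def)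
qed

lemma lin_op_expr: "expr_ok k x \<Longrightarrow> lin_op (scl X) (act x)"
proof (induction x)
  case (Gen g) then show ?case using lin_op_gen by (simp add: lin_op_def)
next
  case (Const c) then show ?case by (simp add: lin_op_def scale_right_distrib mult.commute)
next
  case (Add x y) then show ?case by (simp add: lin_op_def scale_right_distrib add.assoc add.left_commute)
next
  case (Mul x y) then show ?case by (simp add: lin_op_def)
qed

lemma on_commute:
  assumes "i \<noteq> j" "A \<in> lie_g G" "A' \<in> lie_g G" "i \<le> k" "j \<le> k"
  shows "on i A (on j A' u) = on j A' (on i A u)"
proof -
  have zero: "on 0 A (on j A' u) = on j A' (on 0 A u)" if "A \<in> lie_g G" "1 \<le> j" "j \<le> k" for A A' j
    using that by (auto simp: on_factor_def fun_eq_iff lie_linear mindex_update)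
  have "on i A (on j A' u) = on j A' (on i A u)" if ij: "1 \<le> i" "1 \<le> j"
  proof
    fix I
    have ne: "i - 1 \<noteq> j - 1" using ij assms(1) by auto
    show "on i A (on j A' u) I = on j A' (on i A u) I"
    proof (cases "I \<in> mindex N k")
      case True
      have "on i A (on j A' u) I = (\<Sum>a<N. \<Sum>b<N. scl X (A $$ (I ! (i - 1), a) * A' $$ (I ! (j - 1), b)) (u (I[i - 1 := a, j - 1 := b])))"
        using True ij ne by (simp add: on_factor_def mindex_update scale_sum_right)
      also have "\<dots> = (\<Sum>b<N. \<Sum>a<N. scl X (A' $$ (I ! (j - 1), b) * A $$ (I ! (i - 1), a)) (u (I[j - 1 := b, i - 1 := a])))"
        by (subst sum.swap) (simp only: mult.commute list_update_swap[OF ne])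
      also have "\<dots> = on j A' (on i A u) I"
        using True ij ne by (simp add: on_factor_def mindex_update scale_sum_right)
      finally show ?thesis .
    qed (simp add: on_factor_def)
  qed
  then show ?thesis using zero[of A j A'] zero[of A' i A] assms
    by (cases "i = 0"; cases "j = 0") auto
qed

lemma on_mat_linear:
  assumes "A \<in> lie_g G" "A' \<in> lie_g G" "j \<le> k"
  shows "on j (A + A') u = (\<lambda>I. on j A u I + on j A' u I)" "on j (c \<cdot>\<^sub>m A) u = (\<lambda>I. scl X c (on j A u I))"
proof -
  have c: "A \<in> carrier_mat N N" "A' \<in> carrier_mat N N" using assms lie_g_carrier by auto
  have n: "I ! (j - 1) < N" if "I \<in> mindex N k" "j \<noteq> 0" for I using mindex_nth[OF that(1)] that(2) assms(3) by simp
  show "on j (A + A') u = (\<lambda>I. on j A u I + on j A' u I)"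
  proof
    fix I
    show "on j (A + A') u I = on j A u I + on j A' u I"
      using c n[of I] assms
      by (cases "j = 0") (simp_all add: on_factor_def lie_mat_linear scale_left_distrib flip: sum.distrib)
  qed
  show "on j (c \<cdot>\<^sub>m A) u = (\<lambda>I. scl X c (on j A u I))"
  proof
    fix I
    show "on j (c \<cdot>\<^sub>m A) u I = scl X c (on j A u I)"
      using c n[of I] assms
      by (cases "j = 0") (simp_all add: on_factor_def lie_mat_linear scale_sum_right)
  qed
qed

text \<open>Fixing a multi-index I makes the values lie in X, where the results on the Casimir
  tensor apply.\<close>

lemma casimir_semilin:
  assumes "i \<le> k" "j \<le> k"
  shows "A' \<in> lie_g G \<Longrightarrow> semilin G (\<lambda>a. a) (scl X) (\<lambda>A. on j A (on i A' u) I)"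
    "A \<in> lie_g G \<Longrightarrow> semilin G (\<lambda>a. a) (scl X) (\<lambda>A'. on j A (on i A' u) I)"
proof -
  show "A' \<in> lie_g G \<Longrightarrow> semilin G (\<lambda>a. a) (scl X) (\<lambda>A. on j A (on i A' u) I)"
    using assms by (simp add: semilin_def on_mat_linear)
  assume A: "A \<in> lie_g G"
  have l: "lin_op (scl X) (on j A)" using A lin_op_on by blast
  show "semilin G (\<lambda>a. a) (scl X) (\<lambda>A'. on j A (on i A' u) I)"
    using assms by (simp add: semilin_def on_mat_linear lin_opD[OF l])
qed

section \<open>Equivariance under K\<close>

lemma K_act_on:
  assumes g: "g \<in> grp_K G" and A: "A \<in> lie_g G" and j: "j \<le> k"
  shows "K_act G X k g (on j A u) = on j (g * A * transpose_mat g) (K_act G X k g u)"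
proof (cases "j = 0")
  case True
  then show ?thesis unfolding K_act_tens using lie_g_conjugate[OF g A]
    by (simp add: tens_on_0 lin_map_grp g grp_lie[OF g A])
next
  case False
  note gf = grp_K_facts[OF g]
  have Ac: "A \<in> carrier_mat N N" using A lie_g_carrier by auto
  have "g * A * transpose_mat g * g = g * A" using gf(1,5) Ac by (simp add: mult_assoc_n[of _ N] mult_carrier_n[of _ N])
  then show ?thesis unfolding K_act_tens using False j gf(1) Ac
    by (intro tens_on_commute) (auto simp: lin_map_grp g mult_carrier_n[of _ N])
qed

lemma K_act_gen:
  assumes g: "g \<in> grp_K G" and x: "gen_ok k x"
  shows "K_act G X k g (gen_act G X k B d P x u) = gen_act G X k B d P x (K_act G X k g u)"
proof -
  have lin: "lin_op (scl X) (K_act G X k g)" unfolding K_act_tens by (intro lin_op_tens lin_map_grp g)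
  show ?thesis
  proof (cases x)
    case (T i)
    then have "1 \<le> i" "i < k" using x by auto
    then show ?thesis using T unfolding K_act_tens
      by (simp add: flip_proj tens_proj[OF _ _ lin_map_grp[OF g] flip_kernel_commute])
  next
    case (E i)
    then have i: "1 \<le> i" "i < k" using x by auto
    then have k: "2 \<le> k" by simp
    have "K_act G X k g (proj_factors G X k P i u) = proj_factors G X k P i (K_act G X k g u)"
      unfolding K_act_tens by (rule tens_proj[OF i lin_map_grp[OF g] P_commute[OF k preserves_gram_K[OF g]]])
    then show ?thesis using E by (simp add: lin_opD(2)[OF lin])
  next
    case (Z i)
    then have i: "1 \<le> i" "i \<le> k" using x by auto
    have "K_act G X k g (gen_act G X k B d P x u) = (\<lambda>I. \<Sum>j<i. \<Sum>b\<in>B. K_act G X k g (on j b (on i (d b) u)) I)"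
      by (simp add: Z Omega_def lin_op_sum[OF lin] finite_B)
    also have "\<dots> = (\<lambda>I. \<Sum>j<i. \<Sum>b\<in>B. on j b (on i (d b) (K_act G X k g u)) I)"
    proof (rule ext, rule sum.cong[OF HOL.refl])
      fix I j assume "j \<in> {..<i}"
      then have j: "j \<le> k" using i by simp
      have "(\<Sum>b\<in>B. K_act G X k g (on j b (on i (d b) u)) I) =
          (\<Sum>b\<in>B. on j (g * b * transpose_mat g) (on i (g * d b * transpose_mat g) (K_act G X k g u)) I)"
        by (intro sum.cong HOL.refl) (simp add: K_act_on[OF g] B_sub dual_in i j)
      \<comment> \<open>Both legs of the Casimir tensor have been conjugated by g, which does not
        change the tensor.\<close>
      also have "\<dots> = (\<Sum>b\<in>B. on j b (on i (d b) (K_act G X k g u)) I)"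
        by (rule casimir_conjugate[OF g casimir_semilin[OF i(2) j] vector_space_axioms])
      finally show "(\<Sum>b\<in>B. K_act G X k g (on j b (on i (d b) u)) I) = (\<Sum>b\<in>B. on j b (on i (d b) (K_act G X k g u)) I)" .
    qed
    finally show ?thesis by (simp add: Z Omega_def)
  next
    case (Th i)
    then have i: "1 \<le> i" "i \<le> k" using x by auto
    note gf = grp_K_facts[OF g]
    show ?thesis using Th unfolding K_act_tens
      by (simp add: tens_on_commute[OF i gf(1) xi_carrier xi_carrier lin_map_grp[OF g] gf(3)[symmetric]])
  qed
qed

lemma K_act_expr:
  assumes g: "g \<in> grp_K G"
  shows "expr_ok k x \<Longrightarrow> K_act G X k g (act x u) = act x (K_act G X k g u)"
proof (induction x arbitrary: u)
  have lin: "lin_op (scl X) (K_act G X k g)" unfolding K_act_tens by (intro lin_op_tens lin_map_grp g)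
  {
    case (Gen x) then show ?case by (simp add: K_act_gen[OF g])
  next
    case (Const c) then show ?case by (simp add: lin_opD(2)[OF lin])
  next
    case (Add x y) then show ?case by (simp add: lin_opD(1)[OF lin])
  next
    case (Mul x y) then show ?case by simp
  }
qed

section \<open>The operator of \<open>w0\<close>\<close>

abbreviation "W \<equiv> tens (\<lambda>_. xi G) (\<lambda>x. x)"

lemma tens_cong: "(\<And>j. j < k \<Longrightarrow> Ms j = Ms' j) \<Longrightarrow> tens Ms h u = tens Ms' h u"
proof -
  assume "\<And>j. j < k \<Longrightarrow> Ms j = Ms' j"
  then have "(\<Prod>j<k. Ms j $$ (I ! j, J ! j)) = (\<Prod>j<k. Ms' j $$ (I ! j, J ! j))" for I J :: "nat list"
    by (intro prod.cong) auto
  then show ?thesis by (simp only: tens_act_def)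
qed

lemma tens_one:
  assumes "u \<in> Tsp" shows "tens (\<lambda>_. 1\<^sub>m N) (\<lambda>x. x) u = u"
proof
  fix I
  show "tens (\<lambda>_. 1\<^sub>m N) (\<lambda>x. x) u I = u I"
  proof (cases "I \<in> mindex N k")
    case I: True
    have "(\<Prod>j<k. 1\<^sub>m N $$ (I ! j, J ! j)) = (if J = I then 1 else 0 :: complex)" if J: "J \<in> mindex N k" for J
    proof (cases "J = I")
      case True then show ?thesis using mindex_nth[OF I] by simp
    next
      case False
      then obtain j where "j < k" "I ! j \<noteq> J ! j" using I J by (auto simp: mindex_def list_eq_iff_nth_eq)
      then have "\<exists>j\<in>{..<k}. 1\<^sub>m N $$ (I ! j, J ! j) = (0 :: complex)" using mindex_nth[OF I] mindex_nth[OF J] by auto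
      then show ?thesis using False by (simp add: prod_zero)
    qed
    then have "tens (\<lambda>_. 1\<^sub>m N) (\<lambda>x. x) u I = (\<Sum>J\<in>mindex N k. if J = I then u J else 0)"
      using I by (auto simp: tens_act_def intro!: sum.cong)
    then show ?thesis using I by (simp add: finite_mindex)
  qed (use assms in \<open>simp add: tens_act_def tensor_space_def\<close>)
qed

text \<open>The rightmost factor of \<open>w0 (Suc m)\<close> acts before the rest and changes the
  matrix at position m, which is tensor factor m + 1; the induction therefore runs over arbitrary
  \<open>Ms\<close>.\<close>

lemma w0_tens:
  assumes "m \<le> k" "\<And>j. Ms j \<in> carrier_mat N N"
  shows "act (w0 m) (tens Ms (\<lambda>x. x) u) = tens (\<lambda>j. if j < m then xi G * Ms j else Ms j) (\<lambda>x. x) u"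
  using assms
proof (induction m arbitrary: Ms)
  case 0
  then show ?case by (simp add: one_expr_def)
next
  case (Suc m)
  let ?M = "Ms(m := xi G * Ms m)"
  have "act (w0 (Suc m)) (tens Ms (\<lambda>x. x) u) = act (w0 m) (tens ?M (\<lambda>x. x) u)"
    using Suc.prems tens_on(2)[of "Suc m" Ms "xi G" "\<lambda>x. x" u] by (simp add: times_expr_def lin_map_id)
  also have "\<dots> = tens (\<lambda>j. if j < m then xi G * ?M j else ?M j) (\<lambda>x. x) u"
    using Suc.prems by (intro Suc.IH) (auto simp: mult_carrier_n[of _ N])
  also have "\<dots> = tens (\<lambda>j. if j < Suc m then xi G * Ms j else Ms j) (\<lambda>x. x) u"
    by (intro tens_cong) (auto simp: less_Suc_eq)
  finally show ?case .
qed

lemma w0_W: "u \<in> Tsp \<Longrightarrow> act (w0 k) u = W u"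
proof -
  assume u: "u \<in> Tsp"
  \<comment> \<open>The family u is viewed as the image of itself under the identity matrices, to
    which the formula for \<open>w0\<close> applies.\<close>
  have "act (w0 k) (tens (\<lambda>_. 1\<^sub>m N) (\<lambda>x. x) u) = tens (\<lambda>j. if j < k then xi G * 1\<^sub>m N else 1\<^sub>m N) (\<lambda>x. x) u"
    by (rule w0_tens) auto
  also have "\<dots> = W u" by (intro tens_cong) simp
  finally show ?thesis by (simp add: tens_one u)
qed

lemma W_W: "u \<in> Tsp \<Longrightarrow> W (W u) = u"
proof -
  assume u: "u \<in> Tsp"
  have "W (W u) = act (w0 k) (W u)" by (simp add: w0_W tens_in)
  also have "\<dots> = tens (\<lambda>j. if j < k then xi G * xi G else xi G) (\<lambda>x. x) u"
    by (rule w0_tens) auto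
  also have "\<dots> = tens (\<lambda>_. 1\<^sub>m N) (\<lambda>x. x) u" by (intro tens_cong) (simp add: xi_sq)
  finally show ?thesis by (simp add: tens_one u)
qed

lemma lin_op_W: "lin_op (scl X) W"
  by (intro lin_op_tens lin_map_id)

lemma act_star: "v \<in> Tsp \<Longrightarrow> act (star k x) v = W (act (bullet x) (W v))"
  by (simp add: star_def times_expr_def w0_W tens_in expr_act_in)

section \<open>Adjoints for an invariant form on X\<close>

context
  fixes f :: "'x \<Rightarrow> 'x \<Rightarrow> complex"
  assumes f: "hermitian_form UNIV (+) (scl X) f" and inv: "HC_star_invariant G X f"
begin

abbreviation "ip \<equiv> sum_form N k f"

lemma f_simps: "f (u + v) w = f u w + f v w" "f w (u + v) = f w u + f w v"
  "f (scl X a u) v = a * f u v" "f u (scl X a v) = cnj a * f u v"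
  using f by (simp_all add: hermitian_form_def)

lemma f_sum: "f (\<Sum>a\<in>S. g a) w = (\<Sum>a\<in>S. f (g a) w)" "f w (\<Sum>a\<in>S. g a) = (\<Sum>a\<in>S. f w (g a))"
proof -
  have z: "f 0 w = 0" "f w 0 = 0" using f_simps(1)[of 0 0 w] f_simps(2)[of w 0 0] by simp_all
  show "f (\<Sum>a\<in>S. g a) w = (\<Sum>a\<in>S. f (g a) w)" "f w (\<Sum>a\<in>S. g a) = (\<Sum>a\<in>S. f w (g a))"
    by (induction S rule: infinite_finite_induct) (simp_all add: z f_simps)
qed

lemma ip_sum: "ip (\<lambda>I. \<Sum>a\<in>S. u a I) w = (\<Sum>a\<in>S. ip (u a) w)" "ip w (\<lambda>I. \<Sum>a\<in>S. u a I) = (\<Sum>a\<in>S. ip w (u a))"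
  unfolding sum_form_def f_sum by (rule sum.swap)+

lemma adjoint_on:
  assumes i: "1 \<le> i" "i \<le> k" and A: "\<And>a b. a < N \<Longrightarrow> b < N \<Longrightarrow> A' $$ (a, b) = cnj (A $$ (b, a))"
  shows "ip (on i A u) v = ip u (on i A' v)"
proof -
  define p where "p = i - 1"
  have p: "p < k" "i - 1 = p" "i - Suc 0 = p" using i by (auto simp: p_def)
  have "ip (on i A u) v = (\<Sum>I\<in>mindex N k. \<Sum>a<N. A $$ (I ! p, a) * f (u (I[p := a])) (v I))"
    unfolding sum_form_def using i by (intro sum.cong HOL.refl) (simp add: on_factor_def p f_sum f_simps)
  also have "\<dots> = (\<Sum>I\<in>mindex N k. \<Sum>a<N. A $$ (I[p := a] ! p, I ! p) * f (u (I[p := a, p := I ! p])) (v (I[p := a])))"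
    by (rule sum_mindex_swap[OF p(1)])
  also have "\<dots> = ip u (on i A' v)"
    unfolding sum_form_def using i p(1)
    by (intro sum.cong HOL.refl) (simp add: on_factor_def p f_sum f_simps A mindex_nth mindex_length)
  finally show ?thesis .
qed

lemma adjoint_proj:
  assumes i: "1 \<le> i" "i < k"
    and Q: "\<And>a b c e. a < N \<Longrightarrow> b < N \<Longrightarrow> c < N \<Longrightarrow> e < N \<Longrightarrow> Q (a, b) (c, e) = cnj (Q (c, e) (a, b))"
  shows "ip (proj_factors G X k Q i u) v = ip u (proj_factors G X k Q i v)"
proof -
  define p where "p = i - 1"
  have p: "p < k" "p \<noteq> i" "i - 1 = p" "i - Suc 0 = p" using i by (auto simp: p_def)
  have "ip (proj_factors G X k Q i u) v =
      (\<Sum>I\<in>mindex N k. \<Sum>a<N. \<Sum>b<N. Q (I ! p, I ! i) (a, b) * f (u (I[p := a, i := b])) (v I))"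
    unfolding sum_form_def by (intro sum.cong HOL.refl) (simp add: proj_factors_def p f_sum f_simps)
  also have "\<dots> = (\<Sum>I\<in>mindex N k. \<Sum>a<N. \<Sum>b<N. Q (I[p := a, i := b] ! p, I[p := a, i := b] ! i) (I ! p, I ! i) *
      f (u (I[p := a, i := b, p := I ! p, i := I ! i])) (v (I[p := a, i := b])))"
    by (rule sum_mindex_swap2[OF p(1) i(2) p(2)])
  also have "\<dots> = (\<Sum>I\<in>mindex N k. \<Sum>a<N. \<Sum>b<N. cnj (Q (I ! p, I ! i) (a, b)) * f (u I) (v (I[p := a, i := b])))"
    using i p by (intro sum.cong HOL.refl arg_cong2[of _ _ _ _ "(*)"])
      (simp_all add: list_update_restore mindex_length mindex_nth, rule Q, auto simp: mindex_nth)
  also have "\<dots> = ip u (proj_factors G X k Q i v)"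
    unfolding sum_form_def by (intro sum.cong HOL.refl) (simp add: proj_factors_def p f_sum f_simps)
  finally show ?thesis .
qed

text \<open>One rule for all factors, as the operators mix factor 0 with the others. On X the
  operator \<open>W\<close> acts trivially and the rule is invariance of f; on V the adjoint is the
  conjugate transpose, and \<open>lie_g_iff\<close> for the conjugate of A rewrites it.\<close>

lemma adjoint_on_W:
  assumes A: "A \<in> lie_g G" and j: "j \<le> k" and v: "v \<in> Tsp"
  shows "ip (on j A u) v = ip u (W (on j (mat_star A) (W v)))"
proof (cases "j = 0")
  case True
  have "ip (on 0 A u) v = ip u (on 0 (mat_star A) v)"
    unfolding sum_form_def using inv A by (intro sum.cong HOL.refl) (simp add: on_factor_def HC_star_invariant_def)
  moreover have "W (on 0 (mat_star A) (W v)) = on 0 (mat_star A) v"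
    by (subst tens_on_0[OF lin_map_id lie_g_mat_star[OF A]]) (simp_all add: W_W v)
  ultimately show ?thesis using True by simp
next
  case False
  let ?x = "xi G"
  have c: "mat_star A \<in> carrier_mat N N" and Ac: "A \<in> carrier_mat N N"
    using A lie_g_carrier lie_g_mat_star by auto
  have "W (on j (mat_star A) (W v)) = on j (?x * mat_star A * ?x) (W (W v))"
    using False j c by (intro tens_on_commute lin_map_id)
      (auto simp: mult_carrier_n[of _ N] mult_assoc_n[of _ N] xi_sq)
  moreover have "?x * mat_star A * ?x = transpose_mat (map_mat cnj A)"
    using lie_g_cnj[OF A] Ac by (simp add: lie_g_iff mat_star_def mult_carrier_n[of _ N])
  ultimately have "W (on j (mat_star A) (W v)) = on j (transpose_mat (map_mat cnj A)) v"
    by (simp add: W_W v)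
  then show ?thesis using False j Ac adjoint_on[of j "transpose_mat (map_mat cnj A)" A u v] by simp
qed

lemma star_gen:
  assumes x: "gen_ok k x" and v: "v \<in> Tsp"
  shows "ip (gen_act G X k B d P x u) v = ip u (W (gen_act G X k B d P x (W v)))"
proof (cases x)
  case (T i)
  then have i: "1 \<le> i" "i < k" using x by auto
  have "ip (proj_factors G X k flip_kernel i u) v = ip u (proj_factors G X k flip_kernel i v)"
    by (rule adjoint_proj[OF i]) (auto simp: flip_kernel_def)
  then show ?thesis using T i v
    by (simp add: flip_proj tens_proj[OF _ _ lin_map_id flip_kernel_commute] W_W)
next
  case (E i)
  then have i: "1 \<le> i" "i < k" using x by auto
  then have k: "2 \<le> k" by simp
  have par: "cnj (par0 G) = par0 G" by (cases G) auto
  have "ip (proj_factors G X k P i u) v = ip u (proj_factors G X k P i v)"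
    by (rule adjoint_proj[OF i]) (simp add: P[OF k] gram_real)
  moreover have "W (proj_factors G X k P i (W v)) = proj_factors G X k P i v"
    using tens_proj[OF i lin_map_id P_commute[OF k preserves_gram_xi]] v by (simp add: W_W)
  moreover have "ip (\<lambda>I. scl X c (u I)) w = c * ip u w" "ip w (\<lambda>I. scl X c (u I)) = cnj c * ip w u" for c u w
    by (simp_all add: sum_form_def f_simps sum_distrib_left)
  ultimately show ?thesis using E by (simp add: lin_opD(2)[OF lin_op_W] par)
next
  case (Z i)
  then have i: "1 \<le> i" "i \<le> k" using x by auto
  have "ip (gen_act G X k B d P x u) v = (\<Sum>j<i. \<Sum>b\<in>B. ip (on j b (on i (d b) u)) v)"
    by (simp add: Z Omega_def ip_sum)
  also have "\<dots> = (\<Sum>j<i. ip u (W (\<lambda>I. \<Sum>b\<in>B. on j b (on i (d b) (W v)) I)))"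
  proof (intro sum.cong HOL.refl)
    fix j assume "j \<in> {..<i}"
    then have j: "j \<le> k" "j \<noteq> i" using i by auto
    have "(\<Sum>b\<in>B. ip (on j b (on i (d b) u)) v) = (\<Sum>b\<in>B. ip u (W (on j (mat_star b) (on i (mat_star (d b)) (W v)))))"
    proof (intro sum.cong HOL.refl)
      fix b assume b: "b \<in> B"
      \<comment> \<open>Adjoints reverse the order of the two legs. The inner copies of
        \<open>W\<close> cancel, and the order is restored afterwards since j < i are different
        factors.\<close>
      have "ip (on j b (on i (d b) u)) v = ip u (W (on i (mat_star (d b)) (W (W (on j (mat_star b) (W v))))))"
        using b i j v by (simp add: adjoint_on_W B_sub dual_in tens_in)
      also have "\<dots> = ip u (W (on j (mat_star b) (on i (mat_star (d b)) (W v))))"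
        using b i j by (simp add: W_W on_in on_commute[of i j] B_sub dual_in lie_g_mat_star)
      finally show "ip (on j b (on i (d b) u)) v = ip u (W (on j (mat_star b) (on i (mat_star (d b)) (W v))))" .
    qed
    also have "\<dots> = ip u (W (\<lambda>I. \<Sum>b\<in>B. on j (mat_star b) (on i (mat_star (d b)) (W v)) I))"
      by (simp add: lin_op_sum[OF lin_op_W finite_B] ip_sum)
    \<comment> \<open>Both legs carry a star, which the Casimir tensor absorbs.\<close>
    also have "(\<lambda>I. \<Sum>b\<in>B. on j (mat_star b) (on i (mat_star (d b)) (W v)) I) = (\<lambda>I. \<Sum>b\<in>B. on j b (on i (d b) (W v)) I)"
      by (intro ext casimir_star[OF casimir_semilin[OF i(2) j(1)] vector_space_axioms])
    finally show "(\<Sum>b\<in>B. ip (on j b (on i (d b) u)) v) = ip u (W (\<lambda>I. \<Sum>b\<in>B. on j b (on i (d b) (W v)) I))" .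
  qed
  also have "\<dots> = ip u (W (gen_act G X k B d P x (W v)))"
    by (simp add: Z Omega_def lin_op_sum[OF lin_op_W] ip_sum)
  finally show ?thesis .
next
  case (Th i)
  then have i: "1 \<le> i" "i \<le> k" using x by auto
  have "ip (on i (xi G) u) v = ip u (on i (xi G) v)"
    by (rule adjoint_on[OF i]) (simp add: xi_hermitian)
  moreover have "W (on i (xi G) (W v)) = on i (xi G) v"
    by (subst tens_on_commute[OF i xi_carrier xi_carrier xi_carrier lin_map_id HOL.refl]) (simp add: W_W v)
  ultimately show ?thesis using Th by simp
qed

text \<open>In a product, \<open>bullet\<close> reverses the factors and the two copies of
  \<open>W\<close> between them cancel, so the rule passes from the factors to the product.\<close>

lemma star_expr:
  "expr_ok k x \<Longrightarrow> u \<in> Tsp \<Longrightarrow> v \<in> Tsp \<Longrightarrow> ip (act x u) v = ip u (W (act (bullet x) (W v)))"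
proof (induction x arbitrary: u v)
  case (Gen x)
  then show ?case by (simp add: star_gen)
next
  case (Const c)
  then show ?case by (simp add: lin_opD(2)[OF lin_op_W] W_W) (simp add: sum_form_def f_simps sum_distrib_left)
next
  case (Add x y)
  have "ip (act (Add x y) u) v = ip (act x u) v + ip (act y u) v"
    by (simp add: sum_form_def f_simps sum.distrib)
  also have "\<dots> = ip u (W (act (bullet x) (W v))) + ip u (W (act (bullet y) (W v)))"
    using Add by simp
  also have "\<dots> = ip u (W (act (bullet (Add x y)) (W v)))"
    by (simp add: lin_opD(1)[OF lin_op_W]) (simp add: sum_form_def f_simps sum.distrib)
  finally show ?case .
next
  case (Mul x y)
  then show ?case by (simp add: expr_act_in tens_in W_W)
qed

lemma star_expr_act:
  assumes "expr_ok k x" "u \<in> Tsp" "v \<in> Tsp" shows "ip (act x u) v = ip u (act (star k x) v)"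
  using star_expr[OF assms] assms(3) by (simp add: act_star)

end

lemma F_act_in:
  assumes x: "x \<in> exprs k" and \<phi>: "\<phi> \<in> F_space G X \<mu> k"
  shows "F_act G X k B d P x \<phi> \<in> F_space G X \<mu> k"
proof -
  have x: "expr_ok k x" using x by (simp add: exprs_def)
  have \<phi>: "\<And>c. \<phi> c \<in> Tsp" "\<And>c d. \<phi> (c + d) = (\<lambda>I. \<phi> c I + \<phi> d I)" "\<And>a c. \<phi> (a * c) = (\<lambda>I. scl X a (\<phi> c I))"
    "\<And>g c. g \<in> grp_K G \<Longrightarrow> \<phi> (\<mu> g * c) = K_act G X k g (\<phi> c)"
    using \<phi> unfolding F_space_def by blast+
  have "act x (\<phi> (\<mu> g * c)) = K_act G X k g (act x (\<phi> c))" if "g \<in> grp_K G" for g c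
    using K_act_expr[OF that x] \<phi>(4)[OF that] by simp
  then show ?thesis
    using \<phi>(1) by (auto simp: F_space_def F_act_def expr_act_in lin_opD[OF lin_op_expr[OF x]] \<phi>(2,3))
qed

end

text \<open>For k = 0 the only multi-index is empty and the constant is 1. Otherwise the real rank
  is positive, and each factor of V contributes the scalar of
  \<open>V_form_diagonal\<close>.\<close>

lemma tensor_form_sum_form:
  assumes G: "(\<exists>n. G = Sp_real n) \<or> (\<exists>n p q. G = O_real p q \<and> q = min p q \<and> p + q = 2 * n + 1)"
    and k: "k \<le> real_rank G" and V: "V_bullet_unitary G fV"
  obtains c :: real where "0 < c"
    "\<And>(f :: 'x \<Rightarrow> 'x \<Rightarrow> complex) u v. tensor_form (vdim G) k f fV u v = of_real c * sum_form (vdim G) k f u v"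
proof (cases "k = 0")
  case True
  have "mindex N 0 = {[]}" for N by (auto simp: mindex_def)
  then have "tensor_form (vdim G) k f fV u v = of_real 1 * sum_form (vdim G) k f u v"
    for f :: "'x \<Rightarrow> 'x \<Rightarrow> complex" and u v
    using True by (simp add: tensor_form_def sum_form_def)
  then show ?thesis using that[of 1] by simp
next
  case False
  then have "1 \<le> real_rank G" using k by simp
  then obtain c :: real where c: "0 < c"
    "\<And>a b. a < vdim G \<Longrightarrow> b < vdim G \<Longrightarrow>
      fV (unit_vec (vdim G) a) (unit_vec (vdim G) b) = (if a = b then of_real c else 0)"
    using V_form_diagonal[OF G _ V] by blast
  have "tensor_form (vdim G) k f fV u v = of_real (c ^ k) * sum_form (vdim G) k f u v"
    for f :: "'x \<Rightarrow> 'x \<Rightarrow> complex" and u v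
    using tensor_form_diagonal[of "vdim G" fV "of_real c" k f u v] c(2) by (simp add: sum_form_def)
  then show ?thesis using that[of "c ^ k"] c(1) by simp
qed

theorem lemma9p23:
  fixes G :: classical
    and X :: "'x::ab_group_add gK_data"
    and \<mu> :: "complex mat \<Rightarrow> complex"
    and k :: nat
    and B :: "complex mat set" and d :: "complex mat \<Rightarrow> complex mat"
    and P :: "nat \<times> nat \<Rightarrow> nat \<times> nat \<Rightarrow> complex"
    and fX :: "'x \<Rightarrow> 'x \<Rightarrow> complex"
    and fV :: "complex vec \<Rightarrow> complex vec \<Rightarrow> complex"
    and w :: "nat \<Rightarrow> complex"
  assumes G: "(\<exists>n. G = Sp_real n) \<or> (\<exists>n p q. G = O_real p q \<and> q = min p q \<and> p + q = 2 * n + 1)"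
    and mu: "K_character G \<mu>"
    and k: "k \<le> real_rank G"
    and basis: "lie_basis G B" "dual_basis G B d"
    and proj: "trivial_projection G P"
    and V: "V_bullet_unitary G fV"
    and X: "Harish_Chandra_module G X"
    and fX: "hermitian_form UNIV (+) (scl X) fX" "HC_star_invariant G X fX"
  shows "(\<forall>x\<in>exprs k. \<forall>\<phi>\<in>F_space G X \<mu> k. F_act G X k B d P x \<phi> \<in> F_space G X \<mu> k)
    \<and> hermitian_form (F_space G X \<mu> k) F_add (F_scale X) (F_form G k fX fV)
    \<and> (conj_symmetric UNIV fX \<longrightarrow> conj_symmetric (F_space G X \<mu> k) (F_form G k fX fV))
    \<and> VW_star_invariant k (par0 G) (par1 G) w (F_space G X \<mu> k) (F_act G X k B d P)
        (F_form G k fX fV)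
    \<and> (HC_unitary G X \<longrightarrow>
        VW_unitary k (par0 G) (par1 G) w (F_space G X \<mu> k) F_add (F_scale X) (\<lambda>_ _. 0)
          (F_act G X k B d P))"
proof -
  have "\<exists>r :: real. \<forall>a<vdim G. \<forall>b<vdim G. \<forall>c<vdim G. \<forall>e<vdim G. 2 \<le> k \<longrightarrow>
      P (a, b) (c, e) = of_real r * gram G $$ (a, b) * gram G $$ (c, e)"
  proof (cases "2 \<le> k")
    case True
    then have "1 \<le> real_rank G" using k by simp
    then show ?thesis by (rule trivial_projection_entries[OF G _ proj]) blast
  qed simp
  then obtain r :: real where r: "\<And>a b c e. 2 \<le> k \<Longrightarrow> a < vdim G \<Longrightarrow> b < vdim G \<Longrightarrow> c < vdim G \<Longrightarrow> e < vdim G \<Longrightarrow>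
      P (a, b) (c, e) = of_real r * gram G $$ (a, b) * gram G $$ (c, e)"
    by blast
  have gK: "gK_module G X" using X by (simp add: Harish_Chandra_module_def)
  interpret tensor_module G B d X k P r
    by unfold_locales (use basis gK r in auto)
  obtain c :: real where c: "0 < c"
    "\<And>(f :: 'x \<Rightarrow> 'x \<Rightarrow> complex) u v. tensor_form N k f fV u v = of_real c * sum_form N k f u v"
    using tensor_form_sum_form[OF G k V] by blast
  let ?F = "F_space G X \<mu> k"
  have F: "\<phi> c' \<in> Tsp" "\<phi> (a * c') = (\<lambda>I. scl X a (\<phi> c' I))" if "\<phi> \<in> ?F" for \<phi> a c'
    using that unfolding F_space_def by blast+
  \<comment> \<open>This and the next claim are for arbitrary f: unitarity of X supplies a form of
    its own, which may differ from \<open>fX\<close>.\<close>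
  have herm: "hermitian_form ?F F_add (F_scale X) (F_form G k f fV)"
    if f: "hermitian_form UNIV (+) (scl X) f" for f
    unfolding hermitian_form_def F_form_def c(2) sum_form_def F_add_def F_scale_def
    using f by (simp add: hermitian_form_def sum.distrib ring_distribs sum_distrib_left mult.left_commute)
  have star: "VW_star_invariant k (par0 G) (par1 G) w ?F (F_act G X k B d P) (F_form G k f fV)"
    if f: "hermitian_form UNIV (+) (scl X) f" "HC_star_invariant G X f" for f
    unfolding VW_star_invariant_def
  proof (intro ballI)
    fix b x \<phi> \<psi> assume "b \<in> VW_algebra k (par0 G) (par1 G) w" "x \<in> b" and F': "\<phi> \<in> ?F" "\<psi> \<in> ?F"
    then have "expr_ok k x" by (auto simp: VW_algebra_def exprs_def elim!: quotientE)
    then have "sum_form N k f (act x (\<phi> 1)) (\<psi> 1) = sum_form N k f (\<phi> 1) (act (star k x) (\<psi> 1))"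
      using F(1)[OF F'(1)] F(1)[OF F'(2)] by (rule star_expr_act[OF f])
    then show "F_form G k f fV (F_act G X k B d P x \<phi>) \<psi> = F_form G k f fV \<phi> (F_act G X k B d P (star k x) \<psi>)"
      by (simp add: F_form_def F_act_def c(2))
  qed
  have sym: "conj_symmetric ?F (F_form G k fX fV)" if "conj_symmetric UNIV fX"
  proof -
    have "cnj (fX u v) = fX v u" for u v using that unfolding conj_symmetric_def by (metis UNIV_I)
    then show ?thesis by (simp add: conj_symmetric_def F_form_def c(2) sum_form_def)
  qed
  have unitary: "VW_unitary k (par0 G) (par1 G) w ?F F_add (F_scale X) (\<lambda>_ _. 0) (F_act G X k B d P)"
    if unitary_X: "HC_unitary G X"
  proof -
    obtain f where f: "hermitian_form UNIV (+) (scl X) f" "HC_star_invariant G X f"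
      and pd: "positive_definite UNIV 0 f"
      using unitary_X unfolding HC_unitary_def by blast
    have "f (0 + 0) v = f 0 v + f 0 v" for v using f(1) unfolding hermitian_form_def by blast
    then have f0: "f 0 v = 0" for v by simp
    have f_pos: "Im (f u u) = 0" "0 \<le> Re (f u u)" "u \<noteq> 0 \<Longrightarrow> 0 < Re (f u u)" for u
      using pd f0[of u] by (cases "u = 0"; force simp: positive_definite_def f0)+
    have "positive_definite ?F (\<lambda>_ _. 0) (F_form G k f fV)"
      unfolding positive_definite_def
    proof (intro ballI impI)
      fix \<phi> assume \<phi>: "\<phi> \<in> ?F" "\<phi> \<noteq> (\<lambda>_ _. 0)"
      \<comment> \<open>A map out of a one-dimensional module is determined by its value at the
        spanning vector 1.\<close>
      have "\<phi> 1 \<noteq> (\<lambda>_. 0)"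
      proof
        assume z: "\<phi> 1 = (\<lambda>_. 0)"
        have "\<phi> a = (\<lambda>_. 0)" for a using F(2)[OF \<phi>(1), of a 1] by (simp add: z)
        then show False using \<phi>(2) by (simp add: fun_eq_iff)
      qed
      then obtain I where I: "\<phi> 1 I \<noteq> 0" by auto
      then have Im: "I \<in> mindex N k" using F(1)[OF \<phi>(1), of 1] by (auto simp: tensor_space_def)
      have "0 < (\<Sum>I\<in>mindex N k. Re (f (\<phi> 1 I) (\<phi> 1 I)))"
        by (rule sum_pos2[OF finite_mindex Im]) (use I f_pos in auto)
      then show "Im (F_form G k f fV \<phi> \<phi>) = 0 \<and> 0 < Re (F_form G k f fV \<phi> \<phi>)"
        using c(1) by (simp add: F_form_def c(2) sum_form_def f_pos)
    qed
    then show ?thesis unfolding VW_unitary_def using herm[OF f(1)] star[OF f] by blast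
  qed
  show ?thesis using F_act_in herm[OF fX(1)] star[OF fX] sym unitary by blast
qed

end
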